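(* Fix $\varepsilon>0$ and suppose that $p=p(n)$ satisfies $n^{-2/5+\varepsilon}\ll p\ll n^{-1/3}$ or $n^{-1/3+\varepsilon}\ll p\ll1$. Then there is a choice of the real-valued parameter $\delta=\delta(n,p,\varepsilon)$ with $\min\{\varepsilon,1/200\}\le\delta\le1/2$ such that the following hold. (i) $\delta\in(0,1)$ and $n^{1-\delta}p\gg\log^2(n)$. (ii) The parameter $s=s(n,p,\delta)=\lfloor\delta\log_{1/(1-p)}(n)\rfloor$ satisfies $s\ge2$ for all sufficiently large $n$. (iii) With high probability, every useful set $W\subseteq V$ in $G_{n,p}$ contains a clique $K$ so that every vertex $v\in V\setminus W$ has at least one non-neighbor in $K$. Furthermore, we have $\delta=1/2+o(1)$ when $n^{-o(1)}\le p\ll1$.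
   Context: $G_{n,p}$ is the binomial random graph on vertex set $V=\{1,\dots,n\}$, in which each pair of vertices is an edge independently with probability $p=p(n)\in(0,1)$. All asymptotics are as $n\to\infty$; $f\ll g$ (equivalently $g\gg f$) means $f/g\to0$; $p\ge n^{-o(1)}$ means $p\ge n^{-\gamma(n)}$ for some $\gamma(n)\to0$; $\log$ without base is the natural logarithm. "With high probability" means with probability tending to $1$ as $n\to\infty$. Given $\delta=\delta(n,p,\varepsilon)\in(0,1)$, let $s=\lfloor\delta\log_{1/(1-p)}(n)\rfloor$ and $$\tau=\tau(n,p,\delta):=\max\Bigl\{\tfrac{2\log n}{np},\ \sqrt{\tfrac{32\log^2(n)}{n^{1-\delta}p\,[1-\log(n)/(np)]}}\Bigr\},$$ which satisfies $\tau=o(1)$ when $n^{1-\delta}p\gg\log^2(n)$. A set $W\subseteq V$ is called useful (in the graph $G_{n,p}$, with respect to $\delta$) if $|V\setminus W|\ge\max\{s-1,1\}$ and every vertex $v\in V\setminus W$ has at least $$\ell_1(W):=\max\bigl\{(1-\tau)n^{1-\delta}/s,\ |W|-2np\bigr\}$$ many non-neighbors in $W$. *)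

theory Defs
  imports "HOL-Probability.Probability" "HOL-Probability.Product_PMF" "HOL-Library.Landau_Symbols"
begin

text \<open>A simple graph on the vertex set \<open>{1..n}\<close> is represented by its edge set, a set of
  two-element subsets of \<open>{1..n}\<close>.\<close>

definition vertex_pairs :: "nat \<Rightarrow> nat set set" where
  "vertex_pairs n = {e. e \<subseteq> {1..n} \<and> card e = 2}"

definition random_graph :: "nat \<Rightarrow> real \<Rightarrow> nat set set pmf" where
  "random_graph n p =
     map_pmf (\<lambda>\<omega>. {e \<in> vertex_pairs n. \<omega> e})
       (Pi_pmf (vertex_pairs n) False (\<lambda>_. bernoulli_pmf p))"

definition is_clique :: "nat set set \<Rightarrow> nat set \<Rightarrow> bool" where
  "is_clique E K \<longleftrightarrow> (\<forall>u\<in>K. \<forall>v\<in>K. u \<noteq> v \<longrightarrow> {u, v} \<in> E)"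

definition non_neighbors_in :: "nat set set \<Rightarrow> nat set \<Rightarrow> nat \<Rightarrow> nat set" where
  "non_neighbors_in E A v = {u \<in> A. u \<noteq> v \<and> {u, v} \<notin> E}"

definition s_param :: "nat \<Rightarrow> real \<Rightarrow> real \<Rightarrow> int" where
  "s_param n p \<delta> = \<lfloor>\<delta> * log (1 / (1 - p)) (real n)\<rfloor>"

definition tau_param :: "nat \<Rightarrow> real \<Rightarrow> real \<Rightarrow> real" where
  "tau_param n p \<delta> =
     max (2 * ln (real n) / (real n * p))
         (sqrt (32 * (ln (real n))\<^sup>2 /
            (real n powr (1 - \<delta>) * p * (1 - ln (real n) / (real n * p)))))"

text \<open>For \<open>s_param n p \<delta> = 0\<close> the first entry of the maximum is \<open>0\<close>, since division by zero
  yields zero.\<close>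

definition ell1 :: "nat \<Rightarrow> real \<Rightarrow> real \<Rightarrow> nat set \<Rightarrow> real" where
  "ell1 n p \<delta> W =
     max ((1 - tau_param n p \<delta>) * real n powr (1 - \<delta>) / real_of_int (s_param n p \<delta>))
         (real (card W) - 2 * real n * p)"

definition useful :: "nat \<Rightarrow> real \<Rightarrow> real \<Rightarrow> nat set set \<Rightarrow> nat set \<Rightarrow> bool" where
  "useful n p \<delta> E W \<longleftrightarrow>
     W \<subseteq> {1..n} \<and>
     int (card ({1..n} - W)) \<ge> max (s_param n p \<delta> - 1) 1 \<and>
     (\<forall>v\<in>{1..n} - W. real (card (non_neighbors_in E W v)) \<ge> ell1 n p \<delta> W)"

text \<open>The lower bound \<open>n\<^sup>-\<^sup>o\<^sup>(\<^sup>1\<^sup>) \<le> p\<close>; it is only required for large \<open>n\<close>, because at \<open>n = 1\<close> it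
  would read \<open>1 \<le> p 1\<close>.\<close>

definition subpoly_lower_bound :: "(nat \<Rightarrow> real) \<Rightarrow> bool" where
  "subpoly_lower_bound p \<longleftrightarrow>
     (\<exists>\<gamma>. \<gamma> \<longlonglongrightarrow> 0 \<and> (\<forall>\<^sub>F n in sequentially. p n \<ge> real n powr (- \<gamma> n)))"

end

theory Submission
  imports Defs "HOL-Real_Asymp.Real_Asymp"
begin

text \<open>Write \<open>p = n^(-x)\<close>, so that \<open>x < 2/5\<close>. Since \<open>s \<le> log n / p\<close> and \<open>\<tau> \<le> 1/2\<close> for large \<open>n\<close>, usefulness of \<open>W\<close>
gives every vertex outside \<open>W\<close> at least \<open>a = n^(1-\<delta>) p / (2 log n)\<close> non-neighbours in \<open>W\<close>. Let \<open>k\<close> be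
slightly larger than \<open>1/x\<close>, so that \<open>n p^k\<close> is small. If every vertex outside \<open>W\<close> had about \<open>p |W|\<close>
neighbours in \<open>W\<close>, then for \<open>k\<close> random vertices of \<open>W\<close> the expected number of outside vertices
adjacent to all of them would be about \<open>n p^k\<close>, and it would remain to find a clique among the good
choices of \<open>k\<close> vertices.

Two things stand in the way. First, \<open>W\<close> may depend on the graph, so some outside vertices can be
adjacent to most of \<open>W\<close>. They are few: there are only about \<open>(n/|W|)^|W|\<close> sets of the size of \<open>W\<close>, and
adjacency to a fraction \<open>f\<close> of a fixed set costs probability \<open>p^(f|W|)\<close>. Hence with high probability,
for all \<open>W\<close> at once, those of the fractions that are not tiny have sum at most \<open>\<beta>'\<close>, where any number
\<open>\<beta>'\<close> somewhat above \<open>1 + \<delta>/x\<close> will do (\<open>heavy_degrees_rare\<close>). Fewer than \<open>k\<close> vertices have a fraction above \<open>2/3\<close>. For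
each of those, one of the \<open>k\<close> random vertices is drawn from its non-neighbours in \<open>W\<close>, which settles
it; the other random vertices are drawn from \<open>W\<close>. The bound on the sum of the fractions then shows
that the expected number of outside vertices adjacent to all \<open>k\<close> chosen vertices is at most \<open>3/4\<close>
(\<open>tuple_sets_exist\<close>), so that a positive proportion of the choices is good.

Second, a clique must exist among the good choices with probability so close to \<open>1\<close> that a union over
all \<open>W\<close> is possible. Which choices are good does not depend on the edges inside \<open>W\<close>, so those edges
are still independent and Janson's inequality applies to them (\<open>janson\<close>). It bounds the failure
probability by \<open>n^(-2|W|)\<close> if \<open>(a/k^2)^j p^(j(j-1)/2)\<close> exceeds \<open>n p\<close> by logarithmic factors for
\<open>2 \<le> j \<le> k\<close> (\<open>no_clique_among_tuples\<close>, \<open>no_hitting_clique_rare\<close>).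

By concavity in \<open>j\<close> only \<open>j = 2\<close> and \<open>j = k\<close> matter, and \<open>j = k\<close> is where the two ranges of \<open>p\<close> come
from. For \<open>k = 3\<close> the condition reads \<open>5x < 2 - 3\<delta>\<close>, which gives the lower end of the first range, and
\<open>n p^3 \<longlonglongrightarrow> 0\<close> is its upper end. If \<open>x < 1/3\<close>, then \<open>k\<close> is at least \<open>4\<close>, for which the condition reads
\<open>9x < 3 - 4\<delta>\<close>; this gives the lower end of the second range. For small \<open>x\<close> the clique needs about
\<open>1/x\<close> vertices, and sets of \<open>n^(1-\<delta>)\<close> vertices contain cliques of about \<open>2(1-\<delta>)/x\<close> vertices, which
leaves room up to \<open>\<delta> = 1/2\<close> and explains the limit of \<open>\<delta>\<close> for subpolynomial \<open>p\<close>.\<close>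

section \<open>Expectations over random subsets\<close>

text \<open>The expectation of \<open>f X\<close> when \<open>X\<close> contains each element of \<open>E\<close> independently with probability \<open>p\<close>.
It is written as a finite sum so that exposing the elements of \<open>E\<close> in two rounds is a mere
regrouping of summands (\<open>subset_expect_union\<close>).\<close>

definition subset_expect :: "'a set \<Rightarrow> real \<Rightarrow> ('a set \<Rightarrow> real) \<Rightarrow> real" where
  "subset_expect E p f = (\<Sum>X\<in>Pow E. p ^ card X * (1 - p) ^ card (E - X) * f X)"

lemma subset_expect_empty [simp]: "subset_expect {} p f = f {}"
  by (simp add: subset_expect_def)

lemma subset_expect_insert:
  assumes "finite E" "e \<notin> E"
  shows "subset_expect (insert e E) p f =
    p * subset_expect E p (\<lambda>X. f (insert e X)) + (1 - p) * subset_expect E p f"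
proof -
  let ?w = "\<lambda>X. p ^ card X * (1 - p) ^ card (insert e E - X) * f X"
  have inj: "inj_on (insert e) (Pow E)" using assms(2) by (auto simp: inj_on_def)
  have "subset_expect (insert e E) p f = sum ?w (Pow E) + sum ?w (insert e ` Pow E)"
    unfolding subset_expect_def Pow_insert
    by (rule sum.union_disjoint) (use assms in auto)
  also have "sum ?w (Pow E) = (1 - p) * subset_expect E p f"
    unfolding subset_expect_def sum_distrib_left
  proof (rule sum.cong[OF refl])
    fix X assume X: "X \<in> Pow E"
    then have "insert e E - X = insert e (E - X)" using assms by auto
    then have "card (insert e E - X) = Suc (card (E - X))" using assms by simp
    then show "?w X = (1 - p) * (p ^ card X * (1 - p) ^ card (E - X) * f X)" by simp
  qed
  also have "sum ?w (insert e ` Pow E) = p * subset_expect E p (\<lambda>X. f (insert e X))"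
    unfolding subset_expect_def sum_distrib_left sum.reindex[OF inj] o_def
  proof (rule sum.cong[OF refl])
    fix X assume X: "X \<in> Pow E"
    then have "insert e E - insert e X = E - X" using assms by auto
    moreover have "card (insert e X) = Suc (card X)"
      using X assms by (meson PowD card_insert_disjoint finite_subset in_mono)
    ultimately show "?w (insert e X) = p * (p ^ card X * (1 - p) ^ card (E - X) * f (insert e X))"
      by simp
  qed
  finally show ?thesis by simp
qed

lemma subset_expect_cong:
  "(\<And>X. X \<subseteq> E \<Longrightarrow> f X = g X) \<Longrightarrow> subset_expect E p f = subset_expect E p g"
  unfolding subset_expect_def by (rule sum.cong) auto

lemma subset_expect_mono:
  assumes "0 \<le> p" "p \<le> 1" "\<And>X. X \<subseteq> E \<Longrightarrow> f X \<le> g X"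
  shows "subset_expect E p f \<le> subset_expect E p g"
  unfolding subset_expect_def using assms by (intro sum_mono mult_left_mono) auto

lemma subset_expect_const:
  "finite E \<Longrightarrow> subset_expect E p (\<lambda>_. c) = c"
  by (induction rule: finite_induct) (auto simp: subset_expect_insert algebra_simps)

lemma subset_expect_add: "subset_expect E p (\<lambda>X. f X + g X) = subset_expect E p f + subset_expect E p g"
  unfolding subset_expect_def by (simp add: algebra_simps sum.distrib)

lemma subset_expect_cmult: "subset_expect E p (\<lambda>X. c * f X) = c * subset_expect E p f"
  unfolding subset_expect_def sum_distrib_left by (rule sum.cong) auto

lemma subset_expect_diff: "subset_expect E p (\<lambda>X. f X - g X) = subset_expect E p f - subset_expect E p g"
  using subset_expect_add[of E p f "\<lambda>X. - 1 * g X"] by (simp only: subset_expect_cmult) simp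

lemma subset_expect_sum: "subset_expect E p (\<lambda>X. \<Sum>i\<in>I. f i X) = (\<Sum>i\<in>I. subset_expect E p (f i))"
  unfolding subset_expect_def sum_distrib_left by (rule sum.swap)

lemma subset_expect_union:
  assumes "finite D" "finite E" "D \<inter> E = {}"
  shows "subset_expect (D \<union> E) p f = subset_expect D p (\<lambda>X. subset_expect E p (\<lambda>Y. f (X \<union> Y)))"
  using assms(1,3)
proof (induction D arbitrary: f rule: finite_induct)
  case (insert e D)
  then show ?case using assms(2) by (simp add: subset_expect_insert)
qed simp

text \<open>Conditioning on \<open>C \<subseteq> X\<close> just adds \<open>C\<close> to the random set. This identity yields both facts that Janson's
inequality needs, independence of events on disjoint sets and the correlation inequality of Harris:
for a decreasing event \<open>D\<close>, \<open>X \<union> C \<in> D\<close> implies \<open>X \<in> D\<close>, and the two are equivalent if \<open>D\<close> does not depend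
on the elements of \<open>C\<close>.\<close>

lemma subset_expect_superset:
  assumes "finite E" "C \<subseteq> E"
  shows "subset_expect E p (\<lambda>X. of_bool (C \<subseteq> X) * f X) = p ^ card C * subset_expect E p (\<lambda>X. f (X \<union> C))"
proof -
  have fin: "finite C" "finite (E - C)" using assms finite_subset by auto
  have E: "E = (E - C) \<union> C" "(E - C) \<inter> C = {}" using assms by auto
  have 1: "subset_expect C p (\<lambda>Y. of_bool (C \<subseteq> X \<union> Y) * f (X \<union> Y)) = p ^ card C * f (X \<union> C)"
    if X: "X \<subseteq> E - C" for X
  proof -
    have "subset_expect C p (\<lambda>Y. of_bool (C \<subseteq> X \<union> Y) * f (X \<union> Y)) =
      (\<Sum>Y\<in>{C}. p ^ card Y * (1 - p) ^ card (C - Y) * (of_bool (C \<subseteq> X \<union> Y) * f (X \<union> Y)))"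
      unfolding subset_expect_def using X fin by (intro sum.mono_neutral_right) auto
    also have "\<dots> = p ^ card C * f (X \<union> C)" by simp
    finally show ?thesis .
  qed
  have 2: "subset_expect C p (\<lambda>Y. f (X \<union> Y \<union> C)) = f (X \<union> C)" for X
  proof -
    have "subset_expect C p (\<lambda>Y. f (X \<union> Y \<union> C)) = subset_expect C p (\<lambda>Y. f (X \<union> C))"
      by (rule subset_expect_cong, rule arg_cong[where f = f]) auto
    then show ?thesis using fin by (simp add: subset_expect_const)
  qed
  have "subset_expect E p (\<lambda>X. of_bool (C \<subseteq> X) * f X) =
      subset_expect (E - C) p (\<lambda>X. subset_expect C p (\<lambda>Y. of_bool (C \<subseteq> X \<union> Y) * f (X \<union> Y)))"
    by (subst E(1), subst subset_expect_union) (use fin E in auto)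
  also have "\<dots> = subset_expect (E - C) p (\<lambda>X. p ^ card C * f (X \<union> C))"
    by (rule subset_expect_cong) (rule 1)
  also have "\<dots> = p ^ card C * subset_expect (E - C) p (\<lambda>X. subset_expect C p (\<lambda>Y. f (X \<union> Y \<union> C)))"
    by (simp add: subset_expect_cmult 2)
  also have "\<dots> = p ^ card C * subset_expect E p (\<lambda>X. f (X \<union> C))"
    using subset_expect_union[OF fin(2,1) E(2), of p "\<lambda>X. f (X \<union> C)"] E(1) by simp
  finally show ?thesis .
qed

lemma subset_expect_contains:
  assumes "finite E" "C \<subseteq> E"
  shows "subset_expect E p (\<lambda>X. of_bool (C \<subseteq> X)) = p ^ card C"
  using subset_expect_superset[OF assms, of p "\<lambda>_. 1"] subset_expect_const[OF assms(1), of p 1] by simp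

section \<open>Janson's inequality\<close>

text \<open>The argument of Boppana and Spencer. Adding the event \<open>C t \<subseteq> X\<close> to those already avoided multiplies
the avoidance probability by at most \<open>1 - x \<le> exp (-x)\<close>, where \<open>x\<close> is \<open>p^|C t|\<close> minus the probabilities
that \<open>C t\<close> occurs together with an earlier \<open>C u\<close> that meets it: the earlier events that are disjoint
from \<open>C t\<close> are independent of it, and avoiding only those is at least as likely.\<close>

lemma janson_unsampled:
  fixes C :: "'t \<Rightarrow> 'a set"
  assumes "finite E" "finite T" "\<And>t. t \<in> T \<Longrightarrow> C t \<subseteq> E" "0 \<le> p" "p \<le> 1"
  shows "subset_expect E p (\<lambda>X. of_bool (\<forall>t\<in>T. \<not> C t \<subseteq> X)) \<le>
    exp (- (\<Sum>t\<in>T. p ^ card (C t))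
      + (\<Sum>t\<in>T. \<Sum>u\<in>T. of_bool (t \<noteq> u \<and> C t \<inter> C u \<noteq> {}) * p ^ card (C t \<union> C u)) / 2)"
  using assms(2,3)
proof (induction T rule: finite_induct)
  case empty
  then show ?case using assms by (simp add: subset_expect_const)
next
  case (insert t T)
  let ?N = "\<lambda>S X. of_bool (\<forall>t\<in>S. \<not> C t \<subseteq> X) :: real"
  let ?P = "\<lambda>S. subset_expect E p (?N S)"
  let ?d = "\<lambda>t u. of_bool (t \<noteq> u \<and> C t \<inter> C u \<noteq> {}) * p ^ card (C t \<union> C u) :: real"
  define R where "R = {u \<in> T. C t \<inter> C u \<noteq> {}}"
  define x where "x = p ^ card (C t) - (\<Sum>u\<in>T. ?d t u)"
  have tE: "C t \<subseteq> E" using insert by auto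
  have finT: "finite T" "finite R" using insert by (auto simp: R_def)
  have P_nonneg: "?P S \<ge> 0" for S
    unfolding subset_expect_def using assms by (intro sum_nonneg mult_nonneg_nonneg) auto
  have sumR: "(\<Sum>u\<in>T. ?d t u) = (\<Sum>u\<in>R. p ^ card (C t \<union> C u))"
  proof -
    have "(\<Sum>u\<in>R. p ^ card (C t \<union> C u)) = (\<Sum>u\<in>R. ?d t u)"
      by (rule sum.cong) (use insert in \<open>auto simp: R_def\<close>)
    also have "\<dots> = (\<Sum>u\<in>T. ?d t u)"
      using finT by (intro sum.mono_neutral_left) (auto simp: R_def)
    finally show ?thesis by simp
  qed
  \<comment> \<open>Avoiding all earlier events is avoiding those in \<open>R\<close> and those outside \<open>R\<close>; only the latter are
    independent of \<open>C t\<close>.\<close>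
  have step: "subset_expect E p (\<lambda>X. of_bool (C t \<subseteq> X) * ?N T X) \<ge> ?P (T - R) * x"
  proof -
    have "subset_expect E p (\<lambda>X. of_bool (C t \<subseteq> X) * ?N (T - R) X
        - (\<Sum>u\<in>R. of_bool (C t \<union> C u \<subseteq> X) * ?N (T - R) X))
      \<le> subset_expect E p (\<lambda>X. of_bool (C t \<subseteq> X) * ?N T X)"
    proof (rule subset_expect_mono[OF assms(4,5)])
      fix X
      show "of_bool (C t \<subseteq> X) * ?N (T - R) X
        - (\<Sum>u\<in>R. of_bool (C t \<union> C u \<subseteq> X) * ?N (T - R) X) \<le> of_bool (C t \<subseteq> X) * ?N T X"
      proof (cases "\<exists>u\<in>R. C t \<union> C u \<subseteq> X")
        case True
        then obtain u where u: "u \<in> R" "C t \<union> C u \<subseteq> X" by blast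
        have "of_bool (C t \<union> C u \<subseteq> X) * ?N (T - R) X \<le> (\<Sum>u\<in>R. of_bool (C t \<union> C u \<subseteq> X) * ?N (T - R) X)"
          by (rule member_le_sum[OF u(1)]) (use finT in auto)
        then show ?thesis using u by auto
      next
        case False
        then have z: "(\<Sum>u\<in>R. of_bool (C t \<union> C u \<subseteq> X) * ?N (T - R) X) = 0"
          by (intro sum.neutral) auto
        have w: "of_bool (C t \<subseteq> X) * ?N (T - R) X = of_bool (C t \<subseteq> X) * ?N T X"
          using False by auto
        show ?thesis unfolding z w by simp
      qed
    qed
    moreover have "subset_expect E p (\<lambda>X. of_bool (C t \<subseteq> X) * ?N (T - R) X) = p ^ card (C t) * ?P (T - R)"
    proof -
      have "subset_expect E p (\<lambda>X. ?N (T - R) (X \<union> C t)) = ?P (T - R)"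
        by (rule subset_expect_cong, rule arg_cong[where f = of_bool]) (auto simp: R_def)
      then show ?thesis using subset_expect_superset[OF assms(1) tE, of p "?N (T - R)"] by simp
    qed
    moreover have "subset_expect E p (\<lambda>X. of_bool (C t \<union> C u \<subseteq> X) * ?N (T - R) X)
        \<le> p ^ card (C t \<union> C u) * ?P (T - R)" if "u \<in> R" for u
    proof -
      have "C t \<union> C u \<subseteq> E" using that insert by (auto simp: R_def)
      then have "subset_expect E p (\<lambda>X. of_bool (C t \<union> C u \<subseteq> X) * ?N (T - R) X)
        = p ^ card (C t \<union> C u) * subset_expect E p (\<lambda>X. ?N (T - R) (X \<union> (C t \<union> C u)))"
        by (rule subset_expect_superset[OF assms(1)])
      also have "\<dots> \<le> p ^ card (C t \<union> C u) * ?P (T - R)"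
        using assms by (intro mult_left_mono subset_expect_mono) auto
      finally show ?thesis .
    qed
    then have "(\<Sum>u\<in>R. subset_expect E p (\<lambda>X. of_bool (C t \<union> C u \<subseteq> X) * ?N (T - R) X))
        \<le> (\<Sum>u\<in>R. p ^ card (C t \<union> C u)) * ?P (T - R)"
      unfolding sum_distrib_right by (rule sum_mono)
    ultimately show ?thesis
      unfolding subset_expect_diff subset_expect_sum x_def sumR by (simp add: algebra_simps)
  qed
  have "?P (insert t T) = ?P T - subset_expect E p (\<lambda>X. of_bool (C t \<subseteq> X) * ?N T X)"
    unfolding subset_expect_diff[symmetric] by (rule subset_expect_cong) auto
  also have "\<dots> \<le> ?P T * exp (- x)"
  proof (cases "x \<ge> 0")
    case True
    have "?P T \<le> ?P (T - R)" using assms by (intro subset_expect_mono) auto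
    then have "?P T * x \<le> ?P (T - R) * x" using True by (intro mult_right_mono) auto
    then have "?P T - subset_expect E p (\<lambda>X. of_bool (C t \<subseteq> X) * ?N T X) \<le> ?P T * (1 + (- x))"
      using step by (simp add: algebra_simps)
    also have "\<dots> \<le> ?P T * exp (- x)"
      using P_nonneg[of T] exp_ge_add_one_self[of "- x"] by (intro mult_left_mono) auto
    finally show ?thesis .
  next
    case False
    have "subset_expect E p (\<lambda>X. of_bool (C t \<subseteq> X) * ?N T X) \<ge> 0"
      unfolding subset_expect_def using assms by (intro sum_nonneg mult_nonneg_nonneg) auto
    moreover have "?P T * 1 \<le> ?P T * exp (- x)"
      using P_nonneg[of T] False by (intro mult_left_mono) auto
    ultimately show ?thesis by simp
  qed
  also have "\<dots> \<le> exp (- (\<Sum>t\<in>T. p ^ card (C t)) + (\<Sum>t\<in>T. \<Sum>u\<in>T. ?d t u) / 2) * exp (- x)"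
    using insert by (intro mult_right_mono) auto
  also have "\<dots> = exp (- (\<Sum>t\<in>T. p ^ card (C t)) + (\<Sum>t\<in>T. \<Sum>u\<in>T. ?d t u) / 2 - x)"
    by (simp add: exp_add[symmetric])
  also have "- (\<Sum>t\<in>T. p ^ card (C t)) + (\<Sum>t\<in>T. \<Sum>u\<in>T. ?d t u) / 2 - x
    = - (\<Sum>t\<in>insert t T. p ^ card (C t)) + (\<Sum>s\<in>insert t T. \<Sum>u\<in>insert t T. ?d s u) / 2"
  proof -
    have sym: "(\<Sum>u\<in>T. ?d u t) = (\<Sum>u\<in>T. ?d t u)"
      by (rule sum.cong) (auto simp: Int_commute Un_commute)
    have "(\<Sum>s\<in>insert t T. \<Sum>u\<in>insert t T. ?d s u)
      = (\<Sum>u\<in>T. ?d t u) + ((\<Sum>s\<in>T. ?d s t) + (\<Sum>s\<in>T. \<Sum>u\<in>T. ?d s u))"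
    proof -
      have "(\<Sum>s\<in>insert t T. \<Sum>u\<in>insert t T. h s u)
        = (\<Sum>u\<in>T. h t u) + ((\<Sum>s\<in>T. h s t) + (\<Sum>s\<in>T. \<Sum>u\<in>T. h s u))"
        if "h t t = 0" for h :: "'t \<Rightarrow> 't \<Rightarrow> real"
        using insert(1,2) that by (simp add: sum.distrib)
      from this[of ?d] show ?thesis by simp
    qed
    also have "\<dots> = 2 * (\<Sum>u\<in>T. ?d t u) + (\<Sum>s\<in>T. \<Sum>u\<in>T. ?d s u)" unfolding sym by simp
    finally have eq: "(\<Sum>s\<in>insert t T. \<Sum>u\<in>insert t T. ?d s u)
      = 2 * (\<Sum>u\<in>T. ?d t u) + (\<Sum>s\<in>T. \<Sum>u\<in>T. ?d s u)" .
    have "(\<Sum>t\<in>insert t T. p ^ card (C t)) = p ^ card (C t) + (\<Sum>t\<in>T. p ^ card (C t))"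
      using insert(1,2) by simp
    note sum_eq = this
    have arith: "- A + B / 2 - (c - D) = - (c + A) + (2 * D + B) / 2" for A B c D :: real
      by (simp add: field_simps)
    show ?thesis unfolding x_def eq sum_eq by (rule arith)
  qed
  finally show ?case .
qed

text \<open>The sum over pairs in the previous bound may exceed \<open>\<mu>\<close> and make it useless. Keeping each event with
probability \<open>q = \<mu>/\<Delta>\<close> multiplies the expectation of the first sum by \<open>q\<close> and that of the second by \<open>q\<^sup>2\<close>,
and some subfamily does at least as well as the average.\<close>

lemma janson:
  fixes C :: "'t \<Rightarrow> 'a set"
  assumes "finite E" "finite T" "\<And>t. t \<in> T \<Longrightarrow> C t \<subseteq> E" "0 < p" "p \<le> 1"
  defines "\<mu> \<equiv> \<Sum>t\<in>T. p ^ card (C t)"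
  defines "\<Delta> \<equiv> \<Sum>t\<in>T. \<Sum>u\<in>T. of_bool (t = u \<or> C t \<inter> C u \<noteq> {}) * p ^ card (C t \<union> C u)"
  shows "subset_expect E p (\<lambda>X. of_bool (\<forall>t\<in>T. \<not> C t \<subseteq> X)) \<le> exp (- (\<mu>\<^sup>2 / (2 * \<Delta>)))"
proof (cases "T = {}")
  case True
  then show ?thesis using assms by (simp add: subset_expect_const)
next
  case False
  let ?d = "\<lambda>t u. of_bool (t \<noteq> u \<and> C t \<inter> C u \<noteq> {}) * p ^ card (C t \<union> C u) :: real"
  define D where "D = (\<Sum>t\<in>T. \<Sum>u\<in>T. ?d t u)"
  have D0: "D \<ge> 0" unfolding D_def using assms by (intro sum_nonneg mult_nonneg_nonneg) auto
  have mu0: "\<mu> > 0" unfolding \<mu>_def using assms False by (intro sum_pos) auto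
  have Delta: "\<Delta> = \<mu> + D"
  proof -
    have "of_bool (t = u \<or> C t \<inter> C u \<noteq> {}) * p ^ card (C t \<union> C u)
      = (if t = u then p ^ card (C t) else 0) + ?d t u" for t u by auto
    then show ?thesis unfolding \<Delta>_def \<mu>_def D_def using assms(2) by (simp add: sum.distrib)
  qed
  define q where "q = \<mu> / \<Delta>"
  have q: "0 < q" "q \<le> 1" unfolding q_def using mu0 D0 Delta by auto
  let ?g = "\<lambda>S. (\<Sum>t\<in>S. p ^ card (C t)) - (\<Sum>t\<in>S. \<Sum>u\<in>S. ?d t u) / 2"
  have "subset_expect T q ?g = q * \<mu> - q\<^sup>2 * D / 2"
  proof -
    have "subset_expect T q ?g = subset_expect T q (\<lambda>S. (\<Sum>t\<in>T. p ^ card (C t) * of_bool ({t} \<subseteq> S))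
        - 1/2 * (\<Sum>t\<in>T. \<Sum>u\<in>T. ?d t u * of_bool ({t, u} \<subseteq> S)))"
    proof (rule subset_expect_cong)
      fix S assume S: "S \<subseteq> T"
      have 1: "(\<Sum>t\<in>S. h t) = (\<Sum>t\<in>T. h t * of_bool (t \<in> S))" for h :: "'t \<Rightarrow> real"
      proof -
        have "(\<Sum>t\<in>S. h t) = (\<Sum>t\<in>S. h t * of_bool (t \<in> S))" by (rule sum.cong) auto
        also have "\<dots> = (\<Sum>t\<in>T. h t * of_bool (t \<in> S))"
          using S assms(2) by (intro sum.mono_neutral_left) auto
        finally show ?thesis .
      qed
      have pairs: "(\<Sum>t\<in>S. \<Sum>u\<in>S. ?d t u) = (\<Sum>t\<in>T. \<Sum>u\<in>T. ?d t u * of_bool ({t, u} \<subseteq> S))"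
      proof -
        have "(\<Sum>u\<in>S. ?d t u) * of_bool (t \<in> S) = (\<Sum>u\<in>T. ?d t u * of_bool ({t, u} \<subseteq> S))" for t
          unfolding 1[of "?d t"] sum_distrib_right by (rule sum.cong) auto
        then show ?thesis unfolding 1[of "\<lambda>t. \<Sum>u\<in>S. ?d t u"] by (rule sum.cong[OF refl])
      qed
      show "?g S = (\<Sum>t\<in>T. p ^ card (C t) * of_bool ({t} \<subseteq> S))
        - 1/2 * (\<Sum>t\<in>T. \<Sum>u\<in>T. ?d t u * of_bool ({t, u} \<subseteq> S))"
        unfolding 1[of "\<lambda>t. p ^ card (C t)"] pairs by simp
    qed
    also have "\<dots> = (\<Sum>t\<in>T. p ^ card (C t) * q) - 1/2 * (\<Sum>t\<in>T. \<Sum>u\<in>T. ?d t u * q\<^sup>2)"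
    proof -
      have 1: "subset_expect T q (\<lambda>S. of_bool ({t} \<subseteq> S)) = q" if "t \<in> T" for t
        using subset_expect_contains[of T "{t}" q] that assms(2) by simp
      have 2: "?d t u * subset_expect T q (\<lambda>S. of_bool ({t, u} \<subseteq> S)) = ?d t u * q\<^sup>2"
        if "t \<in> T" "u \<in> T" for t u
        using subset_expect_contains[of T "{t, u}" q] that assms(2) by (cases "t = u") (auto simp: power2_eq_square)
      have "(\<Sum>t\<in>T. p ^ card (C t) * subset_expect T q (\<lambda>S. of_bool ({t} \<subseteq> S))) = (\<Sum>t\<in>T. p ^ card (C t) * q)"
        by (rule sum.cong[OF refl], drule 1) (simp only:)
      moreover have "(\<Sum>t\<in>T. \<Sum>u\<in>T. ?d t u * subset_expect T q (\<lambda>S. of_bool ({t, u} \<subseteq> S)))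
          = (\<Sum>t\<in>T. \<Sum>u\<in>T. ?d t u * q\<^sup>2)"
        by (intro sum.cong refl) (rule 2)
      ultimately show ?thesis
        unfolding subset_expect_diff subset_expect_cmult subset_expect_sum by (rule arg_cong2[where f = "\<lambda>a b. a - 1/2 * b"])
    qed
    also have "\<dots> = q * \<mu> - q\<^sup>2 * D / 2"
      unfolding \<mu>_def D_def sum_distrib_left sum_divide_distrib by (simp add: algebra_simps)
    finally show ?thesis .
  qed
  moreover have "q * \<mu> - q\<^sup>2 * D / 2 \<ge> \<mu>\<^sup>2 / (2 * \<Delta>)"
  proof -
    have "q\<^sup>2 * D \<le> q\<^sup>2 * \<Delta>" using Delta mu0 by (intro mult_left_mono) auto
    moreover have "q\<^sup>2 * \<Delta> = \<mu>\<^sup>2 / \<Delta>" "q * \<mu> = \<mu>\<^sup>2 / \<Delta>"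
      unfolding q_def using Delta mu0 D0 by (simp_all add: power2_eq_square divide_simps)
    ultimately show ?thesis by simp
  qed
  moreover define g where "g = ?g"
  ultimately have ex: "\<mu>\<^sup>2 / (2 * \<Delta>) \<le> subset_expect T q g" by (simp only:)
  have "\<exists>S\<subseteq>T. \<mu>\<^sup>2 / (2 * \<Delta>) \<le> g S"
  proof (rule ccontr)
    assume "\<not> (\<exists>S\<subseteq>T. \<mu>\<^sup>2 / (2 * \<Delta>) \<le> g S)"
    then have less: "g S < \<mu>\<^sup>2 / (2 * \<Delta>)" if "S \<subseteq> T" for S using that by (meson not_le)
    have "Max (g ` Pow T) \<in> g ` Pow T" using assms(2) by (intro Max_in) auto
    then obtain R where R: "R \<subseteq> T" "Max (g ` Pow T) = g R" by blast
    have "g S \<le> g R" if "S \<subseteq> T" for S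
      unfolding R(2)[symmetric] using that assms(2) by (intro Max_ge) auto
    then have "subset_expect T q g \<le> subset_expect T q (\<lambda>_. g R)"
      using q by (intro subset_expect_mono) auto
    also have "\<dots> = g R" using assms(2) by (rule subset_expect_const)
    finally show False using less[OF R(1)] ex by linarith
  qed
  then obtain S where S: "S \<subseteq> T" "\<mu>\<^sup>2 / (2 * \<Delta>) \<le> g S" by blast
  have finS: "finite S" using S assms(2) finite_subset by auto
  have "subset_expect E p (\<lambda>X. of_bool (\<forall>t\<in>T. \<not> C t \<subseteq> X)) \<le> subset_expect E p (\<lambda>X. of_bool (\<forall>t\<in>S. \<not> C t \<subseteq> X))"
    using S assms by (intro subset_expect_mono) auto
  also have "\<dots> \<le> exp (- ?g S)"
    using janson_unsampled[OF assms(1) finS, of C p] S(1) assms(3,4,5) by auto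
  also have "\<dots> \<le> exp (- (\<mu>\<^sup>2 / (2 * \<Delta>)))" using S(2) unfolding g_def by simp
  finally show ?thesis .
qed

section \<open>The random graph as a random subset\<close>

lemma finite_vertex_pairs: "finite (vertex_pairs n)"
  unfolding vertex_pairs_def by (rule finite_subset[of _ "Pow {1..n}"]) auto

lemma prob_random_graph:
  assumes "0 \<le> p" "p \<le> 1"
  shows "measure_pmf.prob (random_graph n p) S = subset_expect (vertex_pairs n) p (\<lambda>X. of_bool (X \<in> S))"
proof -
  define A where "A = vertex_pairs n"
  define M where "M = Pi_pmf A False (\<lambda>_::nat set. bernoulli_pmf p)"
  have fin: "finite A" unfolding A_def by (rule finite_vertex_pairs)
  define G where "G = (\<lambda>\<omega> :: nat set \<Rightarrow> bool. {e \<in> A. \<omega> e})"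
  have rg: "random_graph n p = map_pmf G M" unfolding random_graph_def G_def M_def A_def ..
  have pmfG: "pmf (map_pmf G M) X = p ^ card X * (1 - p) ^ card (A - X)" if "X \<subseteq> A" for X
  proof -
    have "pmf (map_pmf G M) X = measure M (G -` {X})" by (simp add: pmf_map)
    also have "\<dots> = measure M {\<lambda>e. e \<in> X}"
    proof (rule measure_prob_cong_0)
      fix \<omega> assume w: "\<omega> \<in> G -` {X} - {\<lambda>e. e \<in> X}"
      have "\<omega> = (\<lambda>e. e \<in> X)" if "\<forall>e. e \<notin> A \<longrightarrow> \<not> \<omega> e"
        using that w by (auto simp: G_def)
      then have "\<not> (\<forall>e. e \<notin> A \<longrightarrow> \<omega> e = False)" using w by blast
      then show "pmf M \<omega> = 0" unfolding M_def using pmf_Pi[OF fin, of False "\<lambda>_. bernoulli_pmf p" \<omega>] by auto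
    next
      fix \<omega> assume w: "\<omega> \<in> {\<lambda>e. e \<in> X} - G -` {X}"
      then show "pmf M \<omega> = 0" using \<open>X \<subseteq> A\<close> by (auto simp: G_def)
    qed
    also have "\<dots> = pmf M (\<lambda>e. e \<in> X)" by (simp add: pmf.rep_eq)
    also have "\<dots> = (\<Prod>e\<in>A. pmf (bernoulli_pmf p) (e \<in> X))"
      unfolding M_def using that by (subst pmf_Pi[OF fin]) auto
    also have "\<dots> = (\<Prod>e\<in>X \<union> (A - X). pmf (bernoulli_pmf p) (e \<in> X))"
      using that by (intro prod.cong) auto
    also have "\<dots> = (\<Prod>e\<in>X. pmf (bernoulli_pmf p) (e \<in> X)) * (\<Prod>e\<in>A - X. pmf (bernoulli_pmf p) (e \<in> X))"
      using that fin by (intro prod.union_disjoint) (auto intro: finite_subset)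
    also have "\<dots> = p ^ card X * (1 - p) ^ card (A - X)" using assms by simp
    finally show ?thesis .
  qed
  have "measure_pmf.prob (map_pmf G M) S = measure_pmf.prob (map_pmf G M) (S \<inter> Pow A)"
  proof (rule measure_prob_cong_0)
    fix X assume "X \<in> S - (S \<inter> Pow A)"
    then have "X \<notin> set_pmf (map_pmf G M)" by (auto simp: G_def)
    then show "pmf (map_pmf G M) X = 0" by (metis set_pmf_iff)
  qed auto
  also have "\<dots> = sum (pmf (map_pmf G M)) (S \<inter> Pow A)"
    using fin by (intro measure_measure_pmf_finite) auto
  also have "\<dots> = (\<Sum>X\<in>S \<inter> Pow A. p ^ card X * (1 - p) ^ card (A - X) * of_bool (X \<in> S))"
    by (rule sum.cong) (auto simp: pmfG)
  also have "\<dots> = (\<Sum>X\<in>Pow A. p ^ card X * (1 - p) ^ card (A - X) * of_bool (X \<in> S))"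
    using fin by (intro sum.mono_neutral_left) auto
  finally show ?thesis unfolding rg subset_expect_def A_def .
qed

section \<open>Cliques spanned by tuples\<close>

definition pairs :: "'a set \<Rightarrow> 'a set set" where
  "pairs A = {e. e \<subseteq> A \<and> card e = 2}"

lemma finite_pairs: "finite A \<Longrightarrow> finite (pairs A)"
  unfolding pairs_def by (rule finite_subset[of _ "Pow A"]) auto

lemma card_pairs: "finite A \<Longrightarrow> card (pairs A) = card A choose 2"
  unfolding pairs_def by (rule n_subsets)

lemma pairs_Int: "pairs (A \<inter> B) = pairs A \<inter> pairs B"
  unfolding pairs_def by auto

lemma card_PiE_noninjective:
  fixes A :: "nat \<Rightarrow> 'a set"
  assumes fin: "\<And>i. i < k \<Longrightarrow> finite (A i)" and big: "\<And>i. i < k \<Longrightarrow> \<alpha> \<le> real (card (A i))"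
    and "0 < \<alpha>"
  shows "real (card {u \<in> PiE {..<k} A. \<not> inj_on u {..<k}}) \<le> (real k)\<^sup>2 / \<alpha> * (\<Prod>i<k. real (card (A i)))"
proof -
  define P where "P = (\<Prod>i<k. real (card (A i)))"
  let ?B = "\<lambda>(i, j). {u \<in> PiE {..<k} A. u i = u j}"
  have finP: "finite (PiE {..<k} A)" using fin by (intro finite_PiE) auto
  have P0: "P \<ge> 0" unfolding P_def by (intro prod_nonneg) auto
  have B: "real (card (?B (i, j))) \<le> P / \<alpha>" if "i < k" "j < k" "i \<noteq> j" for i j
  proof -
    have "real (card (A j)) > 0" using big[OF that(2)] assms(3) by linarith
    have "inj_on (\<lambda>u. restrict u ({..<k} - {j})) (?B (i, j))"
    proof (rule inj_onI)
      fix u w assume u: "u \<in> ?B (i, j)" and w: "w \<in> ?B (i, j)"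
        and eq: "restrict u ({..<k} - {j}) = restrict w ({..<k} - {j})"
      have e: "u x = w x" if "x < k" "x \<noteq> j" for x
        using fun_cong[OF eq, of x] that by simp
      have "u x = w x" if "x < k" for x
        using e[OF that] e[OF \<open>i < k\<close> \<open>i \<noteq> j\<close>] u w by (cases "x = j") auto
      then show "u = w" using u w by (auto intro: PiE_ext)
    qed
    then have "card (?B (i, j)) \<le> card (PiE ({..<k} - {j}) A)"
      using fin by (intro card_inj_on_le finite_PiE) (auto simp: PiE_def Pi_def extensional_def)
    also have "\<dots> = (\<Prod>x\<in>{..<k} - {j}. card (A x))" by (rule card_PiE) auto
    finally have "real (card (?B (i, j))) \<le> real (\<Prod>x\<in>{..<k} - {j}. card (A x))"
      by (rule of_nat_mono)
    also have "\<dots> = (\<Prod>x\<in>{..<k} - {j}. real (card (A x)))" by (rule of_nat_prod)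
    also have "\<dots> = P / real (card (A j))"
      unfolding P_def using that \<open>real (card (A j)) > 0\<close> by (subst prod.remove[of "{..<k}" j]) auto
    also have "\<dots> \<le> P / \<alpha>" using big[OF that(2)] assms(3) P0 by (intro divide_left_mono) auto
    finally show ?thesis .
  qed
  let ?I = "{(i, j). i < k \<and> j < k \<and> i \<noteq> j}"
  have finI: "finite ?I" by (rule finite_subset[of _ "{..<k} \<times> {..<k}"]) auto
  have cI: "card ?I \<le> k\<^sup>2"
  proof -
    have "card ?I \<le> card ({..<k} \<times> {..<k})" by (rule card_mono) auto
    then show ?thesis by (simp add: power2_eq_square)
  qed
  have "{u \<in> PiE {..<k} A. \<not> inj_on u {..<k}} \<subseteq> (\<Union>x\<in>?I. ?B x)"
    by (auto simp: inj_on_def)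
  then have "card {u \<in> PiE {..<k} A. \<not> inj_on u {..<k}} \<le> card (\<Union>x\<in>?I. ?B x)"
    using finP finI by (intro card_mono) auto
  also have "\<dots> \<le> (\<Sum>x\<in>?I. card (?B x))" using finI by (rule card_UN_le)
  finally have "real (card {u \<in> PiE {..<k} A. \<not> inj_on u {..<k}}) \<le> real (\<Sum>x\<in>?I. card (?B x))"
    by (rule of_nat_mono)
  also have "\<dots> = (\<Sum>x\<in>?I. real (card (?B x)))" by (rule of_nat_sum)
  also have "\<dots> \<le> (\<Sum>x\<in>?I. P / \<alpha>)" using B by (intro sum_mono) auto
  also have "\<dots> = real (card ?I) * (P / \<alpha>)" by simp
  also have "\<dots> \<le> real (k\<^sup>2) * (P / \<alpha>)" using cI P0 assms(3)
    by (intro mult_right_mono) (auto simp del: of_nat_power)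
  finally show ?thesis unfolding P_def by (simp add: field_simps)
qed

text \<open>Counts the tuples whose overlap with another tuple, with \<open>K\<close> as its set of entries, is exactly in the
positions \<open>S\<close>.\<close>

lemma card_PiE_meeting:
  fixes A :: "nat \<Rightarrow> 'a set"
  assumes fin: "\<And>i. i < k \<Longrightarrow> finite (A i)" and "finite K" "card K \<le> k" "S \<subseteq> {..<k}"
  shows "card {w \<in> PiE {..<k} A. {i \<in> {..<k}. w i \<in> K} = S} \<le> k ^ card S * (\<Prod>i\<in>{..<k} - S. card (A i))"
proof -
  let ?D = "\<lambda>i. if i \<in> S then K else A i"
  have "{w \<in> PiE {..<k} A. {i \<in> {..<k}. w i \<in> K} = S} \<subseteq> PiE {..<k} ?D"
    by (auto simp: PiE_def Pi_def)
  then have "card {w \<in> PiE {..<k} A. {i \<in> {..<k}. w i \<in> K} = S} \<le> card (PiE {..<k} ?D)"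
    using fin assms(2) by (intro card_mono finite_PiE) auto
  also have "\<dots> = (\<Prod>i<k. card (?D i))" by (rule card_PiE) auto
  also have "\<dots> = (\<Prod>i\<in>S. card (?D i)) * (\<Prod>i\<in>{..<k} - S. card (?D i))"
    using prod.subset_diff[OF assms(4) finite_lessThan, of "\<lambda>i. card (?D i)"] by (simp only: mult.commute)
  also have "\<dots> = card K ^ card S * (\<Prod>i\<in>{..<k} - S. card (A i))" by simp
  also have "\<dots> \<le> k ^ card S * (\<Prod>i\<in>{..<k} - S. card (A i))"
    using assms(3) by (intro mult_right_mono power_mono) auto
  finally show ?thesis .
qed

text \<open>Janson's inequality for the cliques spanned by the tuples in \<open>T\<close>. Two tuples that share \<open>j\<close> entries
share \<open>j choose 2\<close> edges, and a given tuple shares \<open>j\<close> entries with at most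
\<open>(k choose j) k^j \<Prod>|A i| / \<alpha>^j \<le> (k\<^sup>2/\<alpha>)^j \<Prod>|A i|\<close> others, which is where \<open>\<alpha>/k\<^sup>2\<close> in \<open>cond\<close> comes from.\<close>

lemma no_clique_among_tuples:
  fixes A :: "nat \<Rightarrow> 'a set"
  assumes fin: "finite V" and sub: "\<And>i. i < k \<Longrightarrow> A i \<subseteq> V"
    and big: "\<And>i. i < k \<Longrightarrow> \<alpha> \<le> real (card (A i))"
    and T: "T \<subseteq> PiE {..<k} A" "\<And>u. u \<in> T \<Longrightarrow> inj_on u {..<k}"
    and dens: "\<rho> * (\<Prod>i<k. real (card (A i))) \<le> real (card T)"
    and par: "0 < p" "p \<le> 1" "0 < \<alpha>" "2 \<le> k" "0 < Q" "0 < \<rho>"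
    and cond: "\<And>j. 2 \<le> j \<Longrightarrow> j \<le> k \<Longrightarrow> real k * Q \<le> (\<alpha> / (real k)\<^sup>2) ^ j * p ^ (j choose 2)"
  shows "subset_expect (pairs V) p (\<lambda>X. of_bool (\<forall>u\<in>T. \<not> pairs (u ` {..<k}) \<subseteq> X)) \<le> exp (- (\<rho> * Q / 2))"
proof -
  define P where "P = (\<Prod>i<k. real (card (A i)))"
  define N where "N = k choose 2"
  let ?C = "\<lambda>u. pairs (u ` {..<k})"
  have finA: "finite (A i)" if "i < k" for i using sub[OF that] fin finite_subset by blast
  have finT: "finite T" using T(1) finA by (meson finite_PiE finite_lessThan finite_subset lessThan_iff)
  have finP: "finite (PiE {..<k} A)" using finA by (intro finite_PiE) auto
  have cpos: "real (card (A i)) > 0" if "i < k" for i using big[OF that] par by linarith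
  have P0: "P > 0" unfolding P_def using cpos by (intro prod_pos) auto
  have Tpos: "real (card T) > 0" using dens P0 par unfolding P_def[symmetric]
    by (meson less_le_trans mult_pos_pos)
  have img: "u ` {..<k} \<subseteq> V" if "u \<in> T" for u
    using T(1) that sub by (auto simp: PiE_def Pi_def)
  have cardimg: "card (u ` {..<k}) = k" if "u \<in> T" for u using T(2)[OF that] by (simp add: card_image)
  have finC: "finite (?C u)" for u :: "nat \<Rightarrow> 'a" by (rule finite_pairs) auto
  have cardC: "card (?C u) = N" if "u \<in> T" for u
    using cardimg[OF that] by (simp add: card_pairs N_def)
  define \<mu> where "\<mu> = (\<Sum>u\<in>T. p ^ card (?C u))"
  define \<Delta> where "\<Delta> = (\<Sum>u\<in>T. \<Sum>w\<in>T. of_bool (u = w \<or> ?C u \<inter> ?C w \<noteq> {}) * p ^ card (?C u \<union> ?C w))"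
  have mu: "\<mu> = real (card T) * p ^ N" unfolding \<mu>_def using cardC by simp
  have row: "(\<Sum>w\<in>T. of_bool (u = w \<or> ?C u \<inter> ?C w \<noteq> {}) * p ^ card (?C u \<union> ?C w)) \<le> P * p ^ (2 * N) / Q"
    if u: "u \<in> T" for u
  proof -
    let ?K = "u ` {..<k}"
    let ?S = "\<lambda>w. {i \<in> {..<k}. w i \<in> ?K}"
    let ?h = "\<lambda>S. of_bool (2 \<le> card S) * p ^ (2 * N) / p ^ (card S choose 2)"
    have entry: "of_bool (u = w \<or> ?C u \<inter> ?C w \<noteq> {}) * p ^ card (?C u \<union> ?C w) \<le> ?h (?S w)"
      if w: "w \<in> T" for w
    proof -
      have "u ` {..<k} \<inter> w ` {..<k} = w ` ?S w"
      proof (intro equalityI subsetI)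
        fix x assume x: "x \<in> u ` {..<k} \<inter> w ` {..<k}"
        then obtain i where "i \<in> {..<k}" "x = w i" by blast
        then show "x \<in> w ` ?S w" using x by blast
      qed auto
      moreover have "card (w ` ?S w) = card (?S w)"
        using T(2)[OF w] by (intro card_image) (auto simp: inj_on_def)
      ultimately have cK: "card (u ` {..<k} \<inter> w ` {..<k}) = card (?S w)" by simp
      have cI: "card (?C u \<inter> ?C w) = card (?S w) choose 2"
        unfolding pairs_Int[symmetric] by (simp add: card_pairs cK)
      have un: "card (?C u \<union> ?C w) + card (?C u \<inter> ?C w) = 2 * N"
        using card_Un_Int[OF finC finC, of u w] cardC[OF u] cardC[OF w] by simp
      show ?thesis
      proof (cases "u = w \<or> ?C u \<inter> ?C w \<noteq> {}")
        case True
        have "2 \<le> card (?S w)"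
        proof (cases "u = w")
          case True
          then show ?thesis using cK cardimg[OF u] par by simp
        next
          case False
          then have "card (?S w) choose 2 \<noteq> 0" using True cI finC by (metis card_eq_0_iff finite_Int)
          then show ?thesis by (simp add: not_less[symmetric])
        qed
        moreover have "p ^ card (?C u \<union> ?C w) = p ^ (2 * N) / p ^ (card (?S w) choose 2)"
          unfolding un[symmetric] cI power_add using par by simp
        ultimately show ?thesis using True by simp
      next
        case False
        then show ?thesis using par by simp
      qed
    qed
    have h0: "?h S \<ge> 0" for S using par by simp
    \<comment> \<open>Sorting the tuples \<open>w\<close> by the set of positions in which they meet \<open>u\<close>.\<close>
    have ones: "(\<Sum>S\<in>Pow {..<k}. of_bool (?S w = S) * ?h S) = ?h (?S w)" for w
    proof -
      have "(\<Sum>S\<in>Pow {..<k}. of_bool (?S w = S) * ?h S) = (\<Sum>S\<in>{?S w}. of_bool (?S w = S) * ?h S)"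
        by (rule sum.mono_neutral_right) auto
      then show ?thesis by simp
    qed
    have "(\<Sum>w\<in>T. of_bool (u = w \<or> ?C u \<inter> ?C w \<noteq> {}) * p ^ card (?C u \<union> ?C w)) \<le> (\<Sum>w\<in>T. ?h (?S w))"
      by (rule sum_mono) (rule entry)
    also have "\<dots> = (\<Sum>w\<in>T. \<Sum>S\<in>Pow {..<k}. of_bool (?S w = S) * ?h S)" by (simp only: ones)
    also have "\<dots> = (\<Sum>S\<in>Pow {..<k}. \<Sum>w\<in>T. of_bool (?S w = S) * ?h S)" by (rule sum.swap)
    also have "\<dots> = (\<Sum>S\<in>Pow {..<k}. real (card {w \<in> T. ?S w = S}) * ?h S)"
      using finT by (simp only: sum_distrib_right[symmetric]) (simp add: Int_def)
    also have "\<dots> \<le> (\<Sum>S\<in>Pow {..<k}. of_bool (2 \<le> card S) * (P * p ^ (2 * N) * ((real k / \<alpha>) ^ card S / p ^ (card S choose 2))))"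
    proof (rule sum_mono)
      fix S assume S: "S \<in> Pow {..<k}"
      then have finS: "finite S" using finite_subset by auto
      have "card {w \<in> T. ?S w = S} \<le> card {w \<in> PiE {..<k} A. ?S w = S}"
        using T(1) finP by (intro card_mono) auto
      also have "\<dots> \<le> k ^ card S * (\<Prod>i\<in>{..<k} - S. card (A i))"
        using finA S cardimg[OF u] by (intro card_PiE_meeting) auto
      finally have "real (card {w \<in> T. ?S w = S}) \<le> real (k ^ card S * (\<Prod>i\<in>{..<k} - S. card (A i)))"
        by (rule of_nat_mono)
      also have "\<dots> = real k ^ card S * (\<Prod>i\<in>{..<k} - S. real (card (A i)))" by simp
      also have "(\<Prod>i\<in>{..<k} - S. real (card (A i))) \<le> P / \<alpha> ^ card S"
      proof -
        have "(\<Prod>i\<in>S. \<alpha>) \<le> (\<Prod>i\<in>S. real (card (A i)))"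
          using S big par by (intro prod_mono) auto
        moreover have "P = (\<Prod>i\<in>S. real (card (A i))) * (\<Prod>i\<in>{..<k} - S. real (card (A i)))"
          unfolding P_def using S by (subst prod.subset_diff[of S]) auto
        moreover have "(\<Prod>i\<in>{..<k} - S. real (card (A i))) \<ge> 0" by (intro prod_nonneg) auto
        ultimately have "\<alpha> ^ card S * (\<Prod>i\<in>{..<k} - S. real (card (A i))) \<le> P"
          by (simp add: mult_right_mono)
        then show ?thesis using par by (simp add: field_simps)
      qed
      finally have c: "real (card {w \<in> T. ?S w = S}) \<le> real k ^ card S * (P / \<alpha> ^ card S)"
        by (simp only: mult_left_mono zero_le_power of_nat_0_le_iff)
      have "real (card {w \<in> T. ?S w = S}) * ?h S \<le> real k ^ card S * (P / \<alpha> ^ card S) * ?h S"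
        by (rule mult_right_mono[OF c h0])
      also have "\<dots> = of_bool (2 \<le> card S) * (P * p ^ (2 * N) * ((real k / \<alpha>) ^ card S / p ^ (card S choose 2)))"
        by (simp add: power_divide)
      finally show "real (card {w \<in> T. ?S w = S}) * ?h S \<le> of_bool (2 \<le> card S) * (P * p ^ (2 * N) * ((real k / \<alpha>) ^ card S / p ^ (card S choose 2)))" .
    qed
    also have "\<dots> = (\<Sum>j\<le>k. real (k choose j) * (of_bool (2 \<le> j) * (P * p ^ (2 * N) * ((real k / \<alpha>) ^ j / p ^ (j choose 2)))))"
    proof -
      let ?g = "\<lambda>j. of_bool (2 \<le> j) * (P * p ^ (2 * N) * ((real k / \<alpha>) ^ j / p ^ (j choose 2))) :: real"
      have "(\<Sum>S\<in>Pow {..<k}. ?g (card S)) = (\<Sum>j\<le>k. \<Sum>S\<in>{S \<in> Pow {..<k}. card S = j}. ?g (card S))"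
      proof (rule sum.group[symmetric])
        show "card ` Pow {..<k} \<subseteq> {..k}"
          using card_mono[of "{..<k}"] by fastforce
      qed auto
      also have "\<dots> = (\<Sum>j\<le>k. \<Sum>S\<in>{S \<in> Pow {..<k}. card S = j}. ?g j)"
        by (intro sum.cong) auto
      also have "\<dots> = (\<Sum>j\<le>k. real (k choose j) * ?g j)"
        using n_subsets[of "{..<k}"] by (intro sum.cong) (auto simp: Pow_def)
      finally show ?thesis .
    qed
    also have "\<dots> \<le> (\<Sum>j\<le>k. of_bool (2 \<le> j) * (P * p ^ (2 * N) / (real k * Q)))"
    proof (rule sum_mono)
      fix j assume j: "j \<in> {..k}"
      show "real (k choose j) * (of_bool (2 \<le> j) * (P * p ^ (2 * N) * ((real k / \<alpha>) ^ j / p ^ (j choose 2))))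
         \<le> of_bool (2 \<le> j) * (P * p ^ (2 * N) / (real k * Q))"
      proof (cases "2 \<le> j")
        case True
        have "real (k choose j) \<le> real k ^ j" using binomial_le_pow[of j k] j
          by (simp flip: of_nat_power)
        then have "real (k choose j) * (P * p ^ (2 * N) * ((real k / \<alpha>) ^ j / p ^ (j choose 2)))
          \<le> real k ^ j * (P * p ^ (2 * N) * ((real k / \<alpha>) ^ j / p ^ (j choose 2)))"
          using P0 par by (intro mult_right_mono) auto
        also have "\<dots> = P * p ^ (2 * N) * (1 / ((\<alpha> / (real k)\<^sup>2) ^ j * p ^ (j choose 2)))"
          using par by (simp add: power_divide power2_eq_square power_mult_distrib)
        also have "\<dots> \<le> P * p ^ (2 * N) * (1 / (real k * Q))"
          using cond[OF True] j par P0 by (intro mult_left_mono divide_left_mono) auto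
        finally show ?thesis using True by simp
      qed auto
    qed
    also have "\<dots> = real (card {2..k}) * (P * p ^ (2 * N) / (real k * Q))"
    proof -
      let ?c = "P * p ^ (2 * N) / (real k * Q)"
      have "(\<Sum>j\<le>k. of_bool (2 \<le> j) * ?c) = (\<Sum>j\<in>{2..k}. of_bool (2 \<le> j) * ?c)"
        by (rule sum.mono_neutral_right) auto
      also have "\<dots> = (\<Sum>j\<in>{2..k}. ?c)" by (rule sum.cong) auto
      finally show ?thesis by simp
    qed
    also have "\<dots> \<le> real k * (P * p ^ (2 * N) / (real k * Q))"
      using par P0 by (intro mult_right_mono) auto
    also have "\<dots> = P * p ^ (2 * N) / Q" using par by simp
    finally show ?thesis .
  qed
  have "\<Delta> \<le> (\<Sum>u\<in>T. P * p ^ (2 * N) / Q)" unfolding \<Delta>_def by (rule sum_mono) (rule row)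
  then have Delta: "\<Delta> \<le> real (card T) * (P * p ^ (2 * N) / Q)" by simp
  have "\<mu> \<le> \<Delta>"
  proof -
    have "p ^ card (?C u) \<le> (\<Sum>w\<in>T. of_bool (u = w \<or> ?C u \<inter> ?C w \<noteq> {}) * p ^ card (?C u \<union> ?C w))"
      if "u \<in> T" for u
      using member_le_sum[OF that, of "\<lambda>w. of_bool (u = w \<or> ?C u \<inter> ?C w \<noteq> {}) * p ^ card (?C u \<union> ?C w)"]
        finT par by simp
    then show ?thesis unfolding \<mu>_def \<Delta>_def by (rule sum_mono)
  qed
  moreover have mu0: "\<mu> > 0" unfolding mu using Tpos par by simp
  ultimately have D0: "\<Delta> > 0" by linarith
  have "\<rho> * Q / 2 \<le> \<mu>\<^sup>2 / (2 * (real (card T) * (P * p ^ (2 * N) / Q)))"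
  proof -
    have "\<mu>\<^sup>2 / (2 * (real (card T) * (P * p ^ (2 * N) / Q))) = real (card T) / P * Q / 2"
    proof -
      have "(t * x)\<^sup>2 / (2 * (t * (P * x\<^sup>2 / Q))) = t / P * Q / 2" if "t > 0" "x > 0" for t x :: real
        using that P0 par by (simp add: power2_eq_square)
      from this[OF Tpos, of "p ^ N"] show ?thesis
        unfolding mu using par by (simp add: power_mult[symmetric] mult.commute)
    qed
    note eq = this
    have "\<rho> \<le> real (card T) / P" using dens P0 unfolding P_def[symmetric] by (simp add: field_simps)
    then have "\<rho> * Q \<le> real (card T) / P * Q" using par by (intro mult_right_mono) auto
    then show ?thesis unfolding eq by (rule divide_right_mono) simp
  qed
  also have "\<dots> \<le> \<mu>\<^sup>2 / (2 * \<Delta>)"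
  proof -
    have "\<mu>\<^sup>2 / (2 * B) \<le> \<mu>\<^sup>2 / (2 * \<Delta>)" if "\<Delta> \<le> B" for B
      using that D0 by (intro divide_left_mono) auto
    from this[OF Delta] show ?thesis .
  qed
  finally have "exp (- (\<mu>\<^sup>2 / (2 * \<Delta>))) \<le> exp (- (\<rho> * Q / 2))" by simp
  moreover have "subset_expect (pairs V) p (\<lambda>X. of_bool (\<forall>u\<in>T. \<not> ?C u \<subseteq> X)) \<le> exp (- (\<mu>\<^sup>2 / (2 * \<Delta>)))"
    unfolding \<mu>_def \<Delta>_def
  proof (rule janson)
    show "?C u \<subseteq> pairs V" if "u \<in> T" for u using img[OF that] by (auto simp: pairs_def)
  qed (use finite_pairs[OF fin] finT par in auto)
  ultimately show ?thesis by linarith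
qed

section \<open>Vertices adjacent to a large part of a set\<close>

definition nbrs :: "'a set set \<Rightarrow> 'a set \<Rightarrow> 'a \<Rightarrow> 'a set" where
  "nbrs X A v = {u \<in> A. {u, v} \<in> X}"

definition heavy :: "'a set set \<Rightarrow> 'a set \<Rightarrow> real \<Rightarrow> 'a set \<Rightarrow> 'a set" where
  "heavy X V \<theta> A = {v \<in> V - A. \<theta> * real (card A) \<le> real (card (nbrs X A v))}"

lemma binomial_le_exp_power:
  assumes "0 < r"
  shows "real (N choose r) \<le> (exp 1 * real N / real r) ^ r"
proof -
  have "real r ^ r / fact r \<le> exp (real r)"
  proof -
    have "(\<Sum>i\<in>{r}. real r ^ i /\<^sub>R fact i) \<le> (\<Sum>i. real r ^ i /\<^sub>R fact i)"
      by (rule sum_le_suminf[OF summable_exp_generic]) auto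
    then show ?thesis by (simp add: exp_def divide_inverse mult.commute)
  qed
  then have f: "real r ^ r \<le> exp 1 ^ r * fact r"
    by (simp add: field_simps flip: exp_of_nat_mult)
  have "real (N choose r) * fact r \<le> real N ^ r"
    using binomial_fact_pow[of N r] by (metis of_nat_fact of_nat_le_iff of_nat_mult of_nat_power)
  then have "real (N choose r) * fact r * real r ^ r \<le> real N ^ r * (exp 1 ^ r * fact r)"
    using f by (intro mult_mono) auto
  then have "real (N choose r) * real r ^ r \<le> (exp 1 * real N) ^ r"
    by (simp add: power_mult_distrib mult.commute mult.left_commute)
  then show ?thesis using assms by (simp add: power_divide field_simps)
qed

lemma card_subsets_bounded:
  assumes "finite V" "card V = n"
  shows "card {Z. Z \<subseteq> V \<and> card Z \<le> z} \<le> (n + 1) ^ z"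
proof -
  have "{Z. Z \<subseteq> V \<and> card Z \<le> z} = (\<Union>i\<in>{..z}. {Z. Z \<subseteq> V \<and> card Z = i})" by auto
  then have "card {Z. Z \<subseteq> V \<and> card Z \<le> z} \<le> (\<Sum>i\<in>{..z}. card {Z. Z \<subseteq> V \<and> card Z = i})"
    by (simp add: card_UN_le)
  also have "\<dots> = (\<Sum>i\<le>z. n choose i)" using assms by (simp add: n_subsets)
  also have "\<dots> \<le> (\<Sum>i\<le>z. (z choose i) * n ^ i * 1 ^ (z - i))"
  proof (rule sum_mono)
    fix i assume i: "i \<in> {..z}"
    have "n choose i \<le> n ^ i"
    proof (cases "i \<le> n")
      case False
      then show ?thesis by (simp add: binomial_eq_0)
    qed (rule binomial_le_pow)
    moreover have "1 \<le> z choose i" using i by (simp add: Suc_leI)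
    ultimately have "1 * (n choose i) \<le> (z choose i) * n ^ i" by (intro mult_mono) auto
    then show "n choose i \<le> (z choose i) * n ^ i * 1 ^ (z - i)" by simp
  qed
  also have "\<dots> = (n + 1) ^ z" by (simp only: binomial of_nat_id)
  finally show ?thesis .
qed

lemma many_edges_rare:
  assumes "finite E" "F \<subseteq> E" "0 \<le> p" "p \<le> 1" "0 < r"
  shows "subset_expect E p (\<lambda>X. of_bool (r \<le> card (X \<inter> F))) \<le> (exp 1 * p * real (card F) / real r) ^ r"
proof -
  let ?R = "{R. R \<subseteq> F \<and> card R = r}"
  have finF: "finite F" using assms finite_subset by blast
  then have finR: "finite ?R" by auto
  have "subset_expect E p (\<lambda>X. of_bool (r \<le> card (X \<inter> F))) \<le> subset_expect E p (\<lambda>X. \<Sum>R\<in>?R. of_bool (R \<subseteq> X))"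
  proof (rule subset_expect_mono[OF assms(3,4)])
    fix X
    show "of_bool (r \<le> card (X \<inter> F)) \<le> (\<Sum>R\<in>?R. of_bool (R \<subseteq> X) :: real)"
    proof (cases "r \<le> card (X \<inter> F)")
      case True
      then obtain R where R: "R \<subseteq> X \<inter> F" "card R = r" using obtain_subset_with_card_n by metis
      then have "of_bool (R \<subseteq> X) \<le> (\<Sum>R\<in>?R. of_bool (R \<subseteq> X) :: real)"
        using finR by (intro member_le_sum) auto
      then show ?thesis using R True by simp
    qed (simp add: sum_nonneg)
  qed
  also have "\<dots> = (\<Sum>R\<in>?R. p ^ r)"
    unfolding subset_expect_sum using assms(1,2) by (intro sum.cong refl) (auto simp: subset_expect_contains)
  also have "\<dots> = real (card F choose r) * p ^ r" using n_subsets[OF finF] by simp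
  also have "\<dots> \<le> (exp 1 * real (card F) / real r) ^ r * p ^ r"
    using binomial_le_exp_power[OF assms(5)] assms by (intro mult_right_mono) auto
  also have "\<dots> = (exp 1 * p * real (card F) / real r) ^ r"
    by (simp add: power_mult_distrib[symmetric] mult_ac)
  finally show ?thesis .
qed

text \<open>Adding the elements of \<open>H\<close> one at a time, the partial sums overshoot \<open>B\<close> by at most one term.\<close>

lemma subset_sum_between:
  fixes f :: "'a \<Rightarrow> real"
  assumes "finite H" "\<And>v. v \<in> H \<Longrightarrow> f v \<le> m" "0 \<le> B" "B < sum f H"
  shows "\<exists>Z\<subseteq>H. B < sum f Z \<and> sum f Z \<le> B + m"
  using assms
proof (induction H rule: finite_induct)
  case (insert v H)
  show ?case
  proof (cases "B < sum f H")
    case True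
    then show ?thesis using insert by (meson insertCI subset_insertI2)
  next
    case False
    moreover have "f v \<le> m" using insert(4) by simp
    ultimately have "sum f (insert v H) \<le> B + m" using insert(1,2) by simp
    then show ?thesis using insert by blast
  qed
qed simp

text \<open>A first-moment bound over pairs \<open>(A, Z)\<close>, where \<open>Z\<close> is a set of heavy vertices whose degrees into \<open>A\<close>
add up to more than \<open>\<beta>|A|\<close>, but not to more than \<open>(\<beta>+1)|A|\<close>. Then \<open>|Z|\<close> is at most \<open>\<zeta> = (\<beta>+1)/\<theta>\<close>, so that
the choice of \<open>Z\<close> costs only \<open>\<zeta> ln (n+1)\<close> in the exponent, which is less than \<open>|A|\<close> by \<open>big\<close>. The choice
of \<open>A\<close> costs \<open>|A|(1 + ln (n/a))\<close>, the \<open>\<beta>|A|\<close> edges between \<open>A\<close> and \<open>Z\<close> gain \<open>\<beta>|A| ln (\<theta>/(2ep))\<close>, and the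
gain wins by \<open>ent\<close>.\<close>

lemma heavy_degrees_rare:
  assumes V: "finite V" "card V = n" "0 < n"
    and par: "0 < p" "p \<le> 1" "0 < a" "1 \<le> \<beta>" "0 < \<theta>" "2 * exp 1 * p \<le> \<theta>"
    and ent: "2 + ln (real n / a) \<le> \<beta> * ln (\<theta> / (2 * exp 1 * p))"
    and big: "((\<beta> + 1) / \<theta> + 2) * ln (real n + 1) \<le> a"
  shows "subset_expect (pairs V) p (\<lambda>X. of_bool (\<exists>A\<subseteq>V. a \<le> real (card A) \<and>
      \<beta> * real (card A) < (\<Sum>v\<in>heavy X V \<theta> A. real (card (nbrs X A v))))) \<le> 1 / real n"
proof -
  define z where "z = nat \<lfloor>(\<beta> + 1) / \<theta>\<rfloor>"
  define \<zeta> where "\<zeta> = (\<beta> + 1) / \<theta>"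
  define lam where "lam = ln (\<theta> / (2 * exp 1 * p))"
  define F where "F = (\<lambda>(A :: 'a set, Z :: 'a set). (\<lambda>(u, v). {u, v}) ` (A \<times> Z))"
  define r where "r = (\<lambda>A :: 'a set. nat \<lceil>\<beta> * real (card A)\<rceil>)"
  let ?As = "{A. A \<subseteq> V \<and> a \<le> real (card A)}"
  let ?Zs = "{Z. Z \<subseteq> V \<and> card Z \<le> z}"
  have fins: "finite ?As" "finite ?Zs" using V by auto
  have z\<zeta>: "real z \<le> \<zeta>" unfolding z_def \<zeta>_def using par by simp
  have F_sub: "F (A, Z) \<subseteq> pairs V" if "A \<subseteq> V" "Z \<subseteq> V" "A \<inter> Z = {}" for A Z
    unfolding F_def pairs_def using that by (auto simp: card_insert_if)
  have rpos: "0 < r A" "\<beta> * real (card A) \<le> real (r A)" if "A \<in> ?As" for A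
  proof -
    have "0 < \<beta> * real (card A)" using that par by (intro mult_pos_pos) auto
    then show "0 < r A" "\<beta> * real (card A) \<le> real (r A)" unfolding r_def by linarith+
  qed
  let ?I = "{(A, Z). A \<in> ?As \<and> Z \<in> ?Zs \<and> A \<inter> Z = {}}"
  have finI: "finite ?I" by (rule finite_subset[of _ "?As \<times> ?Zs"]) (use fins in auto)
  have witness: "\<exists>x\<in>?I. r (fst x) \<le> card (X \<inter> F x)"
    if A: "A \<subseteq> V" "a \<le> real (card A)"
      and sum: "\<beta> * real (card A) < (\<Sum>v\<in>heavy X V \<theta> A. real (card (nbrs X A v)))" for X A
  proof -
    have finA: "finite A" using A V finite_subset by blast
    have finH: "finite (heavy X V \<theta> A)" unfolding heavy_def using V by auto
    have m0: "real (card A) > 0" using A par by linarith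
    have "real (card (nbrs X A v)) \<le> real (card A)" for v
      unfolding nbrs_def using finA by (simp add: card_mono)
    then obtain Z where Z: "Z \<subseteq> heavy X V \<theta> A"
      "\<beta> * real (card A) < (\<Sum>v\<in>Z. real (card (nbrs X A v)))"
      "(\<Sum>v\<in>Z. real (card (nbrs X A v))) \<le> \<beta> * real (card A) + real (card A)"
      using subset_sum_between[OF finH, of "\<lambda>v. real (card (nbrs X A v))" "real (card A)" "\<beta> * real (card A)"] sum par
      by auto
    have finZ: "finite Z" using Z(1) finH finite_subset by blast
    have disj: "A \<inter> Z = {}" and ZV: "Z \<subseteq> V" using Z(1) by (auto simp: heavy_def)
    have "real (card Z) * (\<theta> * real (card A)) \<le> (\<Sum>v\<in>Z. real (card (nbrs X A v)))"
      using Z(1) by (intro sum_bounded_below) (auto simp: heavy_def)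
    with Z(3) have "(real (card Z) * \<theta>) * real (card A) \<le> (\<beta> + 1) * real (card A)"
      by (simp add: algebra_simps)
    then have "real (card Z) * \<theta> \<le> \<beta> + 1" using m0 by simp
    then have "real (card Z) \<le> \<zeta>" unfolding \<zeta>_def using par by (simp add: field_simps)
    then have cZ: "card Z \<le> z" unfolding z_def \<zeta>_def[symmetric] by (simp add: le_nat_floor)
    have "(\<Sum>v\<in>Z. card (nbrs X A v)) = card (SIGMA v:Z. nbrs X A v)"
      using finZ finA by (subst card_SigmaI) (auto simp: nbrs_def)
    also have "\<dots> \<le> card (X \<inter> F (A, Z))"
    proof (rule card_inj_on_le)
      show "inj_on (\<lambda>(v, u). {u, v}) (SIGMA v:Z. nbrs X A v)"
        using disj by (auto simp: inj_on_def nbrs_def doubleton_eq_iff)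
      show "(\<lambda>(v, u). {u, v}) ` (SIGMA v:Z. nbrs X A v) \<subseteq> X \<inter> F (A, Z)"
        by (auto simp: nbrs_def F_def)
      show "finite (X \<inter> F (A, Z))" unfolding F_def using finA finZ by auto
    qed
    finally have "real (\<Sum>v\<in>Z. card (nbrs X A v)) \<le> real (card (X \<inter> F (A, Z)))" by (rule of_nat_mono)
    then have "\<beta> * real (card A) < real (card (X \<inter> F (A, Z)))" using Z(2) by simp
    then have "r A \<le> card (X \<inter> F (A, Z))" unfolding r_def by linarith
    then show ?thesis using A ZV cZ disj by (intro bexI[of _ "(A, Z)"]) auto
  qed
  have single: "subset_expect (pairs V) p (\<lambda>X. of_bool (r A \<le> card (X \<inter> F (A, Z)))) \<le> exp (- (\<beta> * real (card A) * lam))"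
    if AZ: "(A, Z) \<in> ?I" for A Z
  proof -
    have A: "A \<in> ?As" and Z: "Z \<in> ?Zs" "A \<inter> Z = {}" using AZ by auto
    have m0: "real (card A) > 0" using A par by auto
    have cF: "card (F (A, Z)) \<le> card A * card Z"
      unfolding F_def using A Z V card_image_le[of "A \<times> Z" "\<lambda>(u, v). {u, v}"]
      by (auto simp: card_cartesian_product finite_subset)
    \<comment> \<open>By \<open>(\<beta> + 1)/\<beta> \<le> 2\<close>, the expected number of edges between \<open>A\<close> and \<open>Z\<close> is at most \<open>(2p/\<theta>) r A\<close>.\<close>
    define t where "t = 2 * exp 1 * p / \<theta>"
    have t: "0 < t" "t \<le> 1" unfolding t_def using par by auto
    have lt: "ln t = - lam" unfolding t_def lam_def using par by (simp add: ln_div ln_mult)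
    have "real (card (F (A, Z))) \<le> real (card A) * real (card Z)" using cF by (metis of_nat_le_iff of_nat_mult)
    also have "\<dots> \<le> real (card A) * \<zeta>" using Z z\<zeta> by (intro mult_left_mono) auto
    also have "\<dots> \<le> real (card A) * (2 * \<beta> / \<theta>)" unfolding \<zeta>_def using par
      by (intro mult_left_mono divide_right_mono) auto
    also have "\<dots> = \<beta> * real (card A) * (2 / \<theta>)" by simp
    also have "\<dots> \<le> real (r A) * (2 / \<theta>)" using rpos(2)[OF A] par by (intro mult_right_mono) auto
    finally have cF': "real (card (F (A, Z))) / real (r A) \<le> 2 / \<theta>"
      using rpos(1)[OF A] by (simp add: field_simps)
    have "exp 1 * p * real (card (F (A, Z))) / real (r A) = exp 1 * p * (real (card (F (A, Z))) / real (r A))" by simp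
    also have "\<dots> \<le> exp 1 * p * (2 / \<theta>)" using cF' par by (intro mult_left_mono) auto
    also have "\<dots> = t" unfolding t_def by simp
    finally have base: "exp 1 * p * real (card (F (A, Z))) / real (r A) \<le> t" .
    have "subset_expect (pairs V) p (\<lambda>X. of_bool (r A \<le> card (X \<inter> F (A, Z))))
      \<le> (exp 1 * p * real (card (F (A, Z))) / real (r A)) ^ r A"
      using A Z par V rpos(1)[OF A] by (intro many_edges_rare F_sub finite_pairs) auto
    also have "\<dots> \<le> t ^ r A" using base par by (intro power_mono) auto
    also have "\<dots> = exp (real (r A) * ln t)" using t by (simp add: exp_of_nat_mult)
    also have "\<dots> \<le> exp (\<beta> * real (card A) * ln t)"
      using rpos(2)[OF A] t by (simp add: mult_right_mono_neg)
    also have "\<dots> = exp (- (\<beta> * real (card A) * lam))" unfolding lt by simp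
    finally show ?thesis .
  qed
  have "subset_expect (pairs V) p (\<lambda>X. of_bool (\<exists>A\<subseteq>V. a \<le> real (card A) \<and>
      \<beta> * real (card A) < (\<Sum>v\<in>heavy X V \<theta> A. real (card (nbrs X A v)))))
    \<le> subset_expect (pairs V) p (\<lambda>X. \<Sum>x\<in>?I. of_bool (r (fst x) \<le> card (X \<inter> F x)))"
  proof (rule subset_expect_mono)
    fix X
    show "of_bool (\<exists>A\<subseteq>V. a \<le> real (card A) \<and>
      \<beta> * real (card A) < (\<Sum>v\<in>heavy X V \<theta> A. real (card (nbrs X A v))))
      \<le> (\<Sum>x\<in>?I. of_bool (r (fst x) \<le> card (X \<inter> F x)) :: real)"
    proof (cases "\<exists>A\<subseteq>V. a \<le> real (card A) \<and>
      \<beta> * real (card A) < (\<Sum>v\<in>heavy X V \<theta> A. real (card (nbrs X A v)))")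
      case True
      then obtain A where "A \<subseteq> V" "a \<le> real (card A)"
        "\<beta> * real (card A) < (\<Sum>v\<in>heavy X V \<theta> A. real (card (nbrs X A v)))" by auto
      from witness[OF this] obtain x where x: "x \<in> ?I" "r (fst x) \<le> card (X \<inter> F x)" by (rule bexE)
      have "of_bool (r (fst x) \<le> card (X \<inter> F x)) \<le> (\<Sum>x\<in>?I. of_bool (r (fst x) \<le> card (X \<inter> F x)) :: real)"
        by (rule member_le_sum[OF x(1)]) (use finI in auto)
      then show ?thesis using x(2) True by simp
    next
      case False
      then show ?thesis by (simp only: of_bool_eq) (simp add: sum_nonneg)
    qed
  qed (use par in auto)
  also have "\<dots> = (\<Sum>x\<in>?I. subset_expect (pairs V) p (\<lambda>X. of_bool (r (fst x) \<le> card (X \<inter> F x))))"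
    by (rule subset_expect_sum)
  also have "\<dots> \<le> (\<Sum>x\<in>?I. exp (- (\<beta> * real (card (fst x)) * lam)))"
    by (rule sum_mono) (use single in auto)
  also have "\<dots> \<le> (\<Sum>x\<in>?As \<times> ?Zs. exp (- (\<beta> * real (card (fst x)) * lam)))"
    using fins by (intro sum_mono2) auto
  also have "\<dots> = (\<Sum>A\<in>?As. real (card ?Zs) * exp (- (\<beta> * real (card A) * lam)))"
    using sum.cartesian_product[where g = "\<lambda>A _. exp (- (\<beta> * real (card A) * lam))" and A = ?As and B = ?Zs]
    by (simp add: case_prod_unfold)
  also have "\<dots> \<le> (\<Sum>A\<in>?As. exp (\<zeta> * ln (real n + 1)) * exp (- (\<beta> * real (card A) * lam)))"
  proof (intro sum_mono mult_right_mono)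
    have "real (card ?Zs) \<le> real ((n + 1) ^ z)" using card_subsets_bounded[OF V(1,2)] by (rule of_nat_mono)
    also have "\<dots> = exp (real z * ln (real n + 1))" by (simp add: exp_of_nat_mult add.commute)
    also have "\<dots> \<le> exp (\<zeta> * ln (real n + 1))" using z\<zeta> by (simp add: mult_right_mono)
    finally show "real (card ?Zs) \<le> exp (\<zeta> * ln (real n + 1))" .
  qed auto
  also have "\<dots> = (\<Sum>m\<in>{1..n}. \<Sum>A\<in>{A \<in> ?As. card A = m}. exp (\<zeta> * ln (real n + 1)) * exp (- (\<beta> * real (card A) * lam)))"
  proof (rule sum.group[symmetric])
    show "card ` ?As \<subseteq> {1..n}"
    proof safe
      fix A assume A: "A \<subseteq> V" "a \<le> real (card A)"
      then have "card A \<le> n" using V card_mono by metis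
      moreover have "0 < card A" using A(2) par by (cases "card A") auto
      ultimately show "card A \<in> {1..n}" by simp
    qed
  qed (use fins in auto)
  also have "\<dots> \<le> (\<Sum>m\<in>{1..n}. 1 / (real n + 1)\<^sup>2)"
  proof (rule sum_mono)
    fix m assume m: "m \<in> {1..n}"
    have "(\<Sum>A\<in>{A \<in> ?As. card A = m}. exp (\<zeta> * ln (real n + 1)) * exp (- (\<beta> * real (card A) * lam)))
      = real (card {A \<in> ?As. card A = m}) * exp (\<zeta> * ln (real n + 1) - \<beta> * real m * lam)"
      by (simp add: exp_add[symmetric])
    also have "\<dots> \<le> 1 / (real n + 1)\<^sup>2"
    proof (cases "a \<le> real m")
      case True
      have "card {A \<in> ?As. card A = m} \<le> card {A. A \<subseteq> V \<and> card A = m}"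
        using V by (intro card_mono) auto
      also have "\<dots> = n choose m" using n_subsets[OF V(1)] V(2) by simp
      finally have "real (card {A \<in> ?As. card A = m}) \<le> real (n choose m)" by (rule of_nat_mono)
      also have "\<dots> \<le> (exp 1 * real n / real m) ^ m" using m by (intro binomial_le_exp_power) auto
      also have "\<dots> \<le> (exp 1 * real n / a) ^ m" using True par m
        by (intro power_mono divide_left_mono) auto
      also have "\<dots> = exp (real m * (1 + ln (real n / a)))"
        using V par by (simp add: exp_of_nat_mult exp_add)
      finally have "real (card {A \<in> ?As. card A = m}) * exp (\<zeta> * ln (real n + 1) - \<beta> * real m * lam)
        \<le> exp (real m * (1 + ln (real n / a))) * exp (\<zeta> * ln (real n + 1) - \<beta> * real m * lam)"
        by (intro mult_right_mono) auto
      also have "\<dots> = exp (real m * (1 + ln (real n / a) - \<beta> * lam) + \<zeta> * ln (real n + 1))"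
        by (simp add: exp_add[symmetric] algebra_simps)
      also have "\<dots> \<le> exp (- 2 * ln (real n + 1))"
      proof -
        have "real m * (1 + ln (real n / a) - \<beta> * lam) \<le> real m * (- 1)"
          using ent unfolding lam_def by (intro mult_left_mono) auto
        moreover have "\<zeta> * ln (real n + 1) + 2 * ln (real n + 1) \<le> real m"
          using big True unfolding \<zeta>_def by (simp add: algebra_simps)
        ultimately show ?thesis by simp
      qed
      also have "\<dots> = 1 / (real n + 1)\<^sup>2"
      proof -
        have "exp (2 * ln (real n + 1)) = (real n + 1)\<^sup>2" using exp_of_nat_mult[of 2 "ln (real n + 1)"] by simp
        then show ?thesis by (simp add: exp_minus divide_inverse)
      qed
      finally show ?thesis .
    next
      case False
      then have none: "{A \<in> ?As. card A = m} = {}" by auto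
      show ?thesis unfolding none by simp
    qed
    finally show "(\<Sum>A\<in>{A \<in> ?As. card A = m}. exp (\<zeta> * ln (real n + 1)) * exp (- (\<beta> * real (card A) * lam)))
      \<le> 1 / (real n + 1)\<^sup>2" .
  qed
  also have "\<dots> = real n / (real n + 1)\<^sup>2" by simp
  also have "\<dots> \<le> 1 / real n"
  proof (rule mult_imp_div_pos_le)
    show "real n \<le> 1 / real n * (real n + 1)\<^sup>2"
      using V(3) by (simp add: field_simps power2_eq_square)
  qed (simp add: zero_less_power)
  finally show ?thesis .
qed

section \<open>Hitting cliques for a fixed number of vertices\<close>

text \<open>What is needed for one fixed \<open>n\<close>. Every vertex outside \<open>W\<close> has at least \<open>a\<close> non-neighbours in \<open>W\<close>, and
the clique has \<open>k\<close> vertices. The degrees are controlled at two thresholds: the fractions of at least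
\<open>\<theta>\<close> have sum at most \<open>\<beta>\<close>, and those of at least \<open>\<theta>'\<close> have sum at most \<open>\<beta>'\<close>. In the applications \<open>\<theta>\<close> is a
constant times \<open>p\<close> and \<open>\<beta>\<close> a constant times \<open>ln n\<close>, whereas \<open>\<theta>'\<close> is a small power of \<open>p\<close> and \<open>\<beta>'\<close> is
below \<open>2k/3\<close>. At most \<open>B\<close> vertices are adjacent to more than \<open>2/3\<close> of \<open>W\<close>; at least \<open>c\<close> positions of the
clique remain after one has been spent on each of them and one more on summing up fractions.\<close>

locale clique_parameters =
  fixes n k B c :: nat and p a \<theta> \<beta> \<theta>' \<beta>' :: real
  assumes n: "2 \<le> n" and p: "0 < p" "p \<le> 1" and a: "0 < a" "a \<le> 3 * real n * p"
    and thresholds: "0 < \<theta>" "2 * exp 1 * p \<le> \<theta>" "\<theta> \<le> \<theta>'" "\<theta>' \<le> 2 / 3"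
    and masses: "1 \<le> \<beta>'" "\<beta>' \<le> \<beta>"
    and entropy: "2 + ln (real n / a) \<le> \<beta> * ln (\<theta> / (2 * exp 1 * p))"
      "2 + ln (real n / a) \<le> \<beta>' * ln (\<theta>' / (2 * exp 1 * p))"
    and a_large: "((\<beta> + 1) / \<theta> + 2) * ln (real n + 1) \<le> a"
    and B: "3 / 2 * \<beta>' < real B + 1" and c: "c + 1 + B \<le> k" "1 \<le> c"
    and k: "3 / 2 * \<beta>' \<le> real k - 1" "20 * (real k)\<^sup>2 \<le> a"
    and light: "real n * \<theta> ^ k \<le> 1 / 50" "real k * \<beta> * \<theta> ^ c \<le> 1 / 50" "\<beta> * \<theta>' ^ c \<le> 1 / 50"
    and cliques: "\<And>j. 2 \<le> j \<Longrightarrow> j \<le> k \<Longrightarrow>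
      real k * (20 * (3 * real n * p) * ln (real n)) \<le> (a / (real k)\<^sup>2) ^ j * p ^ (j choose 2)"
begin

definition degrees_tame :: "'a set set \<Rightarrow> 'a set \<Rightarrow> 'a set \<Rightarrow> bool" where
  "degrees_tame X V W \<longleftrightarrow>
    (\<forall>A\<subseteq>W. a \<le> real (card A) \<longrightarrow>
      (\<Sum>v\<in>heavy X V \<theta> A - W. real (card (nbrs X A v))) \<le> \<beta> * real (card A)) \<and>
    (\<Sum>v\<in>heavy X V \<theta>' W. real (card (nbrs X W v))) \<le> \<beta>' * real (card W)"

text \<open>A consequence of usefulness in which \<open>s\<close> and \<open>\<tau>\<close> no longer occur.\<close>

definition many_non_nbrs :: "'a set set \<Rightarrow> 'a set \<Rightarrow> 'a set \<Rightarrow> bool" where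
  "many_non_nbrs X V W \<longleftrightarrow> V - W \<noteq> {} \<and>
    (\<forall>v\<in>V - W. a \<le> real (card (W - nbrs X W v)) \<and>
      real (card W) - 2 * real n * p \<le> real (card (W - nbrs X W v)))"

end

text \<open>The worst contribution of the vertices with a fraction between \<open>\<theta>'\<close> and \<open>2/3\<close>: if \<open>r\<close> is what the
vertices above \<open>2/3\<close> leave of the sum \<open>\<beta>'\<close>, then at least \<open>3r/2\<close> further positions of the clique are
free. The maximum of \<open>r exp (-3r/5)\<close> is \<open>5/(3e)\<close>.\<close>

lemma linear_times_power_two_thirds:
  assumes "0 \<le> r" "3 / 2 * r \<le> real j"
  shows "r * (2 / 3) ^ j \<le> 67 / 100"
proof -
  have e25: "exp (2 / 5 :: real) \<le> 3 / 2"
  proof -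
    have "exp (2 / 5 :: real) ^ 5 = exp 1 ^ 2" by (simp flip: exp_of_nat_mult)
    also have "\<dots> \<le> (272 / 100) ^ 2" using e_less_272 by (intro power_mono) auto
    also have "\<dots> \<le> (3 / 2) ^ 5" by (simp add: eval_nat_numeral)
    finally show ?thesis by (rule power_le_imp_le_base[where n = 4, simplified]) auto
  qed
  have e1: "(5 / 2 :: real) \<le> exp 1" using exp_lower_Taylor_quadratic[of "1 :: real"] by simp
  have "(2 / 3 :: real) \<le> exp (- (2 / 5))"
  proof -
    have "(2 / 3 :: real) = 1 / (3 / 2)" by simp
    also have "\<dots> \<le> 1 / exp (2 / 5 :: real)" using e25 by (intro divide_left_mono) auto
    also have "\<dots> = exp (- (2 / 5))" by (simp only: exp_minus inverse_eq_divide)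
    finally show ?thesis .
  qed
  then have "(2 / 3 :: real) ^ j \<le> exp (- (2 / 5)) ^ j" by (intro power_mono) auto
  also have "\<dots> = exp (- (2 / 5 * real j))" by (simp add: mult.commute flip: exp_of_nat_mult)
  also have "\<dots> \<le> exp (- (3 / 5 * r))" using assms by simp
  finally have 1: "(2 / 3) ^ j \<le> exp (- (3 / 5 * r))" .
  have "3 / 5 * r \<le> exp (3 / 5 * r - 1)" using exp_ge_add_one_self[of "3 / 5 * r - 1"] by simp
  also have "\<dots> = exp (3 / 5 * r) / exp 1" by (simp add: exp_diff)
  also have "\<dots> \<le> exp (3 / 5 * r) / (5 / 2)" using e1 by (intro divide_left_mono) auto
  finally have "r \<le> 2 / 3 * exp (3 / 5 * r)" by simp
  then have "r * (2 / 3) ^ j \<le> 2 / 3 * exp (3 / 5 * r) * exp (- (3 / 5 * r))"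
    using 1 assms by (intro mult_mono) auto
  also have "\<dots> = 2 / 3" by (simp flip: exp_add)
  finally show ?thesis by simp
qed

context clique_parameters begin

text \<open>The sets from which the entries of a random tuple are drawn: for each vertex \<open>v\<close> adjacent to more than
\<open>2/3\<close> of \<open>W\<close> one position is reserved for the non-neighbours of \<open>v\<close>, the other positions draw from \<open>W\<close>.
The sum in the conclusion is the expected number of vertices outside \<open>W\<close> adjacent to all entries. The
bound on \<open>|W|\<close> holds if there is a reserved position, because a vertex adjacent to more than \<open>2/3\<close> of
\<open>W\<close> can have \<open>|W| - 2np\<close> non-neighbours only if \<open>|W| \<le> 3np\<close>.\<close>

lemma tuple_sets_exist:
  assumes V: "finite V" "card V = n" and W: "W \<subseteq> V"
    and non: "many_non_nbrs X V W" and tame: "degrees_tame X V W"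
  shows "\<exists>A. (\<forall>i<k. A i \<subseteq> W \<and> a \<le> real (card (A i))) \<and>
    ((\<forall>i<k. A i = W) \<or> real (card W) \<le> 3 * real n * p) \<and>
    (\<Sum>v\<in>V - W. \<Prod>i<k. real (card (nbrs X (A i) v)) / real (card (A i))) \<le> 3 / 4"
proof -
  define m where "m = real (card W)"
  define f where "f = (\<lambda>A v. real (card (nbrs X A v)) / real (card A))"
  define Z where "Z = {v \<in> V - W. 2 / 3 * m < real (card (nbrs X W v))}"
  define b where "b = card Z"
  have finW: "finite W" using V W finite_subset by auto
  have finZ: "finite Z" unfolding Z_def using V by auto
  have nbrs_sub: "nbrs X A v \<subseteq> A" for A v by (auto simp: nbrs_def)
  have f01: "0 \<le> f A v" "f A v \<le> 1" if "A \<subseteq> W" for A v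
  proof -
    have "finite A" using that finW finite_subset by auto
    then have "real (card (nbrs X A v)) \<le> real (card A)" using nbrs_sub by (simp add: card_mono)
    then show "0 \<le> f A v" "f A v \<le> 1" unfolding f_def by (auto simp: divide_le_eq_1)
  qed
  have m0: "m > 0"
  proof -
    obtain v where "v \<in> V - W" using non unfolding many_non_nbrs_def by blast
    then have "a \<le> real (card (W - nbrs X W v))" using non unfolding many_non_nbrs_def by blast
    also have "\<dots> \<le> m" unfolding m_def using finW by (simp add: card_mono)
    finally show ?thesis using a by simp
  qed
  have heavyf: "v \<in> heavy X V t A \<longleftrightarrow> v \<in> V - A \<and> t \<le> f A v" if "0 < card A" for v t A
    unfolding heavy_def f_def using that by (simp add: le_divide_eq)
  have cW: "0 < card W" using m0 unfolding m_def by simp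
  have finH: "finite (heavy X V t A)" for t A unfolding heavy_def using V by auto
  have mass: "(\<Sum>v\<in>heavy X V \<theta>' W. f W v) \<le> \<beta>'"
  proof -
    have "(\<Sum>v\<in>heavy X V \<theta>' W. f W v) = (\<Sum>v\<in>heavy X V \<theta>' W. real (card (nbrs X W v))) / m"
      unfolding f_def m_def by (simp add: sum_divide_distrib)
    also have "\<dots> \<le> \<beta>' * m / m"
      using tame m0 unfolding degrees_tame_def m_def by (intro divide_right_mono) auto
    finally show ?thesis using m0 by simp
  qed
  have massA: "(\<Sum>v\<in>heavy X V \<theta> A - W. f A v) \<le> \<beta>" if "A \<subseteq> W" "a \<le> real (card A)" for A
  proof -
    have "(\<Sum>v\<in>heavy X V \<theta> A - W. f A v) = (\<Sum>v\<in>heavy X V \<theta> A - W. real (card (nbrs X A v))) / real (card A)"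
      unfolding f_def by (simp add: sum_divide_distrib)
    also have "\<dots> \<le> \<beta> * real (card A) / real (card A)"
      using tame that unfolding degrees_tame_def by (intro divide_right_mono) auto
    finally show ?thesis using that a by simp
  qed
  have Zf: "v \<in> Z \<longleftrightarrow> v \<in> V - W \<and> 2 / 3 < f W v" for v
    unfolding Z_def f_def m_def using cW by (simp add: less_divide_eq)
  have ZH: "Z \<subseteq> heavy X V \<theta>' W" using thresholds by (auto simp: Zf heavyf[OF cW])
  have split_mass: "(\<Sum>v\<in>heavy X V \<theta>' W - Z. f W v) \<le> \<beta>' - 2 / 3 * real b"
  proof -
    have "(\<Sum>v\<in>heavy X V \<theta>' W. f W v) = (\<Sum>v\<in>heavy X V \<theta>' W - Z. f W v) + (\<Sum>v\<in>Z. f W v)"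
      by (rule sum.subset_diff[OF ZH finH])
    moreover have "real (card Z) * (2 / 3) \<le> (\<Sum>v\<in>Z. f W v)"
      by (rule sum_bounded_below) (auto simp: Zf)
    ultimately show ?thesis using mass unfolding b_def by linarith
  qed
  moreover have "0 \<le> (\<Sum>v\<in>heavy X V \<theta>' W - Z. f W v)" by (rule sum_nonneg) (use f01 in auto)
  ultimately have r0: "0 \<le> \<beta>' - 2 / 3 * real b" by linarith
  then have "b \<le> B" using B by linarith
  then have bk: "b + c + 1 \<le> k" using c by linarith
  obtain e where e: "bij_betw e {..<b} Z" using ex_bij_betw_nat_finite[OF finZ] unfolding b_def
    by (metis atLeast0LessThan)
  define A where "A = (\<lambda>i. if i < b then W - nbrs X W (e i) else W)"
  have AW: "A i \<subseteq> W" for i unfolding A_def by auto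
  have eZ: "e i \<in> Z" if "i < b" for i using e that by (auto simp: bij_betw_def)
  have Abig: "a \<le> real (card (A i))" for i
  proof -
    obtain v where v: "v \<in> V - W" "i < b \<longrightarrow> v = e i"
      using non eZ unfolding many_non_nbrs_def Z_def by blast
    have "a \<le> real (card (W - nbrs X W v))" using non v unfolding many_non_nbrs_def by blast
    also have "\<dots> \<le> real (card (A i))"
      using finW v unfolding A_def by (auto intro!: card_mono)
    finally show ?thesis .
  qed
  have cA: "0 < card (A i)" for i using Abig[of i] a by (cases "card (A i)") auto
  define P where "P = (\<lambda>v. \<Prod>i<k. f (A i) v)"
  have tail: "P v = (\<Prod>i<b. f (A i) v) * f W v ^ (k - b)" for v
  proof -
    have "{..<k} = {..<b} \<union> {b..<k}" using bk by auto
    then have "P v = (\<Prod>i<b. f (A i) v) * (\<Prod>i\<in>{b..<k}. f (A i) v)"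
      unfolding P_def by (simp add: prod.union_disjoint ivl_disj_int_one)
    also have "(\<Prod>i\<in>{b..<k}. f (A i) v) = (\<Prod>i\<in>{b..<k}. f W v)"
      by (rule prod.cong) (auto simp: A_def)
    finally show ?thesis by simp
  qed
  have headone: "(\<Prod>i<b. f (A i) v) \<le> 1" "0 \<le> (\<Prod>i<b. f (A i) v)" for v
    using f01[OF AW] by (auto intro!: prod_le_1 prod_nonneg)
  have kb: "k - b = Suc (k - b - 1)" using bk by simp
  \<comment> \<open>The vertices that are heavy for a reserved set, those with a fraction between \<open>\<theta>\<close> and \<open>\<theta>'\<close> of \<open>W\<close>,
    and those with a fraction between \<open>\<theta>'\<close> and \<open>2/3\<close>. One factor of the product is kept so that the
    bounds on the sums of fractions apply; the free positions make up the power.\<close>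
  let ?g1 = "\<lambda>i v. of_bool (v \<in> heavy X V \<theta> (A i) - W) * (f (A i) v * \<theta> ^ c)"
  let ?g2 = "\<lambda>v. of_bool (v \<in> heavy X V \<theta> W - W) * (f W v * \<theta>' ^ c)"
  let ?g3 = "\<lambda>v. of_bool (v \<in> heavy X V \<theta>' W - Z) * (f W v * (2 / 3) ^ (k - b - 1))"
  have g_nonneg: "0 \<le> ?g1 i v" "0 \<le> ?g2 v" "0 \<le> ?g3 v" for i v
    using f01[OF AW] f01[of W] thresholds by auto
  have bound: "P v \<le> \<theta> ^ k + (\<Sum>i<b. ?g1 i v) + ?g2 v + ?g3 v" if v: "v \<in> V - W" for v
  proof -
    have s0: "0 \<le> (\<Sum>i<b. ?g1 i v)" by (rule sum_nonneg) (rule g_nonneg)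
    have t0: "0 \<le> \<theta> ^ k" using thresholds by simp
    have fW: "0 \<le> f W v" "f W v \<le> 1" using f01[of W v] by auto
    have Ptail: "P v \<le> f W v * f W v ^ (k - b - 1)"
    proof -
      have "P v \<le> 1 * f W v ^ (k - b)" unfolding tail using headone fW by (intro mult_right_mono) auto
      also have "\<dots> = f W v * f W v ^ (k - b - 1)" by (subst kb) simp
      finally show ?thesis .
    qed
    consider "v \<in> Z" | "v \<notin> Z" "\<theta>' \<le> f W v" | "\<theta> \<le> f W v" "f W v < \<theta>'"
      | "f W v < \<theta>" "\<exists>i<b. \<theta> \<le> f (A i) v" | "f W v < \<theta>" "\<forall>i<b. f (A i) v < \<theta>"
      by force
    then show ?thesis
    proof cases
      case 1
      then obtain i where i: "i < b" "e i = v" using e by (auto simp: bij_betw_def)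
      then have "nbrs X (A i) v = {}" unfolding A_def nbrs_def by auto
      then have "f (A i) v = 0" unfolding f_def by simp
      then have "P v = 0" unfolding P_def using i bk by (intro prod_zero) auto
      then show ?thesis using s0 t0 g_nonneg(2,3)[of v] by linarith
    next
      case 2
      then have h: "v \<in> heavy X V \<theta>' W - Z" using v by (simp add: heavyf[OF cW])
      have "f W v \<le> 2 / 3" using 2 v Zf by auto
      then have "f W v * f W v ^ (k - b - 1) \<le> f W v * (2 / 3) ^ (k - b - 1)"
        using fW by (intro mult_left_mono power_mono) auto
      then have "P v \<le> ?g3 v" using Ptail h by simp
      then show ?thesis using s0 t0 g_nonneg(2,3)[of v] by linarith
    next
      case 3
      then have h: "v \<in> heavy X V \<theta> W - W" using v by (simp add: heavyf[OF cW])
      have "f W v ^ (k - b - 1) \<le> \<theta>' ^ (k - b - 1)" using 3 fW by (intro power_mono) auto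
      also have "\<dots> \<le> \<theta>' ^ c" using bk thresholds by (intro power_decreasing) auto
      finally have "f W v * f W v ^ (k - b - 1) \<le> f W v * \<theta>' ^ c" using fW by (intro mult_left_mono)
      then have "P v \<le> ?g2 v" using Ptail h by simp
      then show ?thesis using s0 t0 g_nonneg(2,3)[of v] by linarith
    next
      case 4
      then obtain i where i: "i < b" "\<theta> \<le> f (A i) v" by blast
      have h: "v \<in> heavy X V \<theta> (A i) - W" using v i AW[of i] by (auto simp: heavyf[OF cA])
      have "f W v ^ (k - b) \<le> \<theta> ^ (k - b)" using 4 fW by (intro power_mono) auto
      also have "\<dots> \<le> \<theta> ^ c" using bk thresholds by (intro power_decreasing) auto
      finally have t: "f W v ^ (k - b) \<le> \<theta> ^ c" .
      have "(\<Prod>i<b. f (A i) v) = f (A i) v * (\<Prod>i\<in>{..<b} - {i}. f (A i) v)"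
        using i by (subst prod.remove[of _ i]) auto
      also have "\<dots> \<le> f (A i) v * 1"
        using f01[OF AW] by (intro mult_left_mono prod_le_1) auto
      finally have "P v \<le> f (A i) v * \<theta> ^ c"
        unfolding tail using t f01[OF AW] fW headone by (intro mult_mono) auto
      also have "\<dots> = ?g1 i v" using h by simp
      also have "\<dots> \<le> (\<Sum>i<b. ?g1 i v)" using i by (intro member_le_sum g_nonneg) auto
      finally show ?thesis using t0 g_nonneg(2,3)[of v] by linarith
    next
      case 5
      have "P v \<le> (\<Prod>i<k. \<theta>)" unfolding P_def
      proof (rule prod_mono)
        fix i assume "i \<in> {..<k}"
        have "f (A i) v \<le> \<theta>" using 5 by (cases "i < b") (auto simp: A_def less_imp_le)
        then show "0 \<le> f (A i) v \<and> f (A i) v \<le> \<theta>" using f01(1)[OF AW] by blast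
      qed
      then have "P v \<le> \<theta> ^ k" by simp
      then show ?thesis using s0 g_nonneg(2,3)[of v] by linarith
    qed
  qed
  have indic: "(\<Sum>v\<in>V - W. of_bool (v \<in> H) * g v) = (\<Sum>v\<in>H. g v)" if "H \<subseteq> V - W" for H and g :: "'a \<Rightarrow> real"
  proof -
    have "(\<Sum>v\<in>H. g v) = (\<Sum>v\<in>H. of_bool (v \<in> H) * g v)" by (rule sum.cong) auto
    also have "\<dots> = (\<Sum>v\<in>V - W. of_bool (v \<in> H) * g v)"
      using that V by (intro sum.mono_neutral_left) auto
    finally show ?thesis by simp
  qed
  have S0: "(\<Sum>v\<in>V - W. \<theta> ^ k) \<le> 1 / 50"
  proof -
    have "real (card (V - W)) \<le> real n" using V by (simp add: card_Diff_subset_Int card_mono flip: V(2))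
    then have "real (card (V - W)) * \<theta> ^ k \<le> real n * \<theta> ^ k" using thresholds by (intro mult_right_mono) auto
    then show ?thesis using light by simp
  qed
  have S1: "(\<Sum>v\<in>V - W. \<Sum>i<b. ?g1 i v) \<le> 1 / 50"
  proof -
    have "(\<Sum>v\<in>V - W. \<Sum>i<b. ?g1 i v) = (\<Sum>i<b. \<Sum>v\<in>V - W. ?g1 i v)" by (rule sum.swap)
    also have "\<dots> = (\<Sum>i<b. (\<Sum>v\<in>heavy X V \<theta> (A i) - W. f (A i) v) * \<theta> ^ c)"
      by (subst indic) (auto simp: heavy_def sum_distrib_right)
    also have "\<dots> \<le> (\<Sum>i<b. \<beta> * \<theta> ^ c)"
      using massA[OF AW Abig] thresholds by (intro sum_mono mult_right_mono) auto
    also have "\<dots> = real b * (\<beta> * \<theta> ^ c)" by simp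
    also have "\<dots> \<le> real k * (\<beta> * \<theta> ^ c)"
      using bk masses thresholds by (intro mult_right_mono) auto
    finally show ?thesis using light by (simp add: mult.assoc)
  qed
  have S2: "(\<Sum>v\<in>V - W. ?g2 v) \<le> 1 / 50"
  proof -
    have "(\<Sum>v\<in>V - W. ?g2 v) = (\<Sum>v\<in>heavy X V \<theta> W - W. f W v) * \<theta>' ^ c"
      by (subst indic) (auto simp: heavy_def sum_distrib_right)
    also have "\<dots> \<le> \<beta> * \<theta>' ^ c"
      using massA[of W] Abig[of b] thresholds unfolding A_def by (intro mult_right_mono) auto
    finally show ?thesis using light by simp
  qed
  have S3: "(\<Sum>v\<in>V - W. ?g3 v) \<le> 67 / 100"
  proof -
    have "(\<Sum>v\<in>V - W. ?g3 v) = (\<Sum>v\<in>heavy X V \<theta>' W - Z. f W v) * (2 / 3) ^ (k - b - 1)"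
      by (subst indic) (auto simp: heavy_def sum_distrib_right)
    also have "\<dots> \<le> (\<beta>' - 2 / 3 * real b) * (2 / 3) ^ (k - b - 1)"
      using split_mass by (intro mult_right_mono) auto
    also have "\<dots> \<le> 67 / 100"
    proof (rule linear_times_power_two_thirds[OF r0])
      have "real (k - b - 1) = real k - real b - 1" using bk by linarith
      then show "3 / 2 * (\<beta>' - 2 / 3 * real b) \<le> real (k - b - 1)" using k by simp
    qed
    finally show ?thesis .
  qed
  have "(\<Sum>v\<in>V - W. P v) \<le> (\<Sum>v\<in>V - W. \<theta> ^ k + (\<Sum>i<b. ?g1 i v) + ?g2 v + ?g3 v)"
    by (rule sum_mono) (rule bound)
  also have "\<dots> = (\<Sum>v\<in>V - W. \<theta> ^ k) + (\<Sum>v\<in>V - W. \<Sum>i<b. ?g1 i v) + (\<Sum>v\<in>V - W. ?g2 v) + (\<Sum>v\<in>V - W. ?g3 v)"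
    by (simp only: sum.distrib)
  also have "\<dots> \<le> 3 / 4" using S0 S1 S2 S3 by linarith
  finally have total: "(\<Sum>v\<in>V - W. P v) \<le> 3 / 4" .
  have "(\<forall>i<k. A i = W) \<or> m \<le> 3 * real n * p"
  proof (cases "b = 0")
    case False
    then obtain v where v: "v \<in> Z" using finZ unfolding b_def by fastforce
    have "card (W - nbrs X W v) + card (nbrs X W v) = card W"
      using finW nbrs_sub[of W v] by (metis card_Diff_subset card_mono finite_subset le_add_diff_inverse2)
    then have "real (card (W - nbrs X W v)) = m - real (card (nbrs X W v))" unfolding m_def by linarith
    moreover have "m - 2 * real n * p \<le> real (card (W - nbrs X W v))"
      using non v unfolding many_non_nbrs_def Z_def m_def by blast
    moreover have "2 / 3 * m < real (card (nbrs X W v))" using v unfolding Z_def by simp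
    ultimately have "m \<le> 3 * real n * p" by linarith
    then show ?thesis ..
  qed (simp add: A_def)
  then show ?thesis using AW Abig total unfolding P_def f_def m_def by blast
qed

end

definition has_hitting_clique :: "nat set set \<Rightarrow> nat set \<Rightarrow> nat set \<Rightarrow> bool" where
  "has_hitting_clique X V W \<longleftrightarrow> (\<exists>K\<subseteq>W. is_clique X K \<and> (\<forall>v\<in>V - W. \<exists>u\<in>K. {u, v} \<notin> X))"

lemma sum_power_card_Pow:
  fixes x :: real
  assumes "finite V"
  shows "(\<Sum>W\<in>Pow V. x ^ card W) = (1 + x) ^ card V"
  using assms
proof (induction V rule: finite_induct)
  case (insert v V)
  have inj: "inj_on (insert v) (Pow V)" using insert(2) by (auto simp: inj_on_def)
  have "(\<Sum>W\<in>Pow (insert v V). x ^ card W) = (\<Sum>W\<in>Pow V. x ^ card W) + (\<Sum>W\<in>insert v ` Pow V. x ^ card W)"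
    unfolding Pow_insert by (rule sum.union_disjoint) (use insert in auto)
  also have "(\<Sum>W\<in>insert v ` Pow V. x ^ card W) = (\<Sum>W\<in>Pow V. x * x ^ card W)"
    unfolding sum.reindex[OF inj] o_def
  proof (rule sum.cong[OF refl])
    fix W assume "W \<in> Pow V"
    then have "finite W" "v \<notin> W" using insert finite_subset by auto
    then show "x ^ card (insert v W) = x * x ^ card W" by simp
  qed
  also have "\<dots> = x * (\<Sum>W\<in>Pow V. x ^ card W)" by (simp add: sum_distrib_left)
  finally show ?case using insert by (simp add: algebra_simps)
qed simp

context clique_parameters begin

text \<open>Here \<open>X\<close> consists of edges that have been exposed before those inside \<open>W\<close>. At most three quarters of
all tuples have an outside vertex adjacent to all entries and at most a twentieth have a repeated
entry, which leaves a fifth. The lower bound \<open>\<alpha>\<close> for the sizes of the sets is \<open>a\<close> if \<open>|W| \<le> 3np\<close>, and \<open>|W|\<close>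
otherwise.\<close>

lemma no_hitting_clique_rare:
  fixes V :: "nat set"
  assumes V: "finite V" "card V = n" and W: "W \<subseteq> V"
    and non: "many_non_nbrs X V W" and tame: "degrees_tame X V W"
  shows "subset_expect (pairs W) p (\<lambda>Y. of_bool (\<not> has_hitting_clique (X \<union> Y) V W))
    \<le> exp (- 2 * real (card W) * ln (real n))"
proof -
  have finW: "finite W" using V W finite_subset by auto
  from tuple_sets_exist[OF V W non tame] obtain A where
    AW: "\<forall>i<k. A i \<subseteq> W \<and> a \<le> real (card (A i))"
    and shape: "(\<forall>i<k. A i = W) \<or> real (card W) \<le> 3 * real n * p"
    and missed: "(\<Sum>v\<in>V - W. \<Prod>i<k. real (card (nbrs X (A i) v)) / real (card (A i))) \<le> 3 / 4"
    by (elim exE conjE) (rule that)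
  have A: "A i \<subseteq> W" "a \<le> real (card (A i))" if "i < k" for i using AW that by simp_all
  have finA: "finite (A i)" if "i < k" for i using A(1)[OF that] finW finite_subset by blast
  have finP: "finite (PiE {..<k} A)" using finA by (intro finite_PiE) auto
  have cA: "real (card (A i)) > 0" if "i < k" for i using A(2)[OF that] a by linarith
  define P where "P = (\<Prod>i<k. real (card (A i)))"
  have P0: "P > 0" unfolding P_def using cA by (intro prod_pos) auto
  have k2: "2 \<le> k" using k(1) masses by linarith
  have lnn: "0 < ln (real n)" using n by simp
  define T where "T = {u \<in> PiE {..<k} A. inj_on u {..<k} \<and> (\<forall>v\<in>V - W. \<exists>i<k. {u i, v} \<notin> X)}"
  have dens: "1 / 5 * P \<le> real (card T)"
  proof -
    let ?N = "{u \<in> PiE {..<k} A. \<not> inj_on u {..<k}}"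
    let ?M = "\<lambda>v. PiE {..<k} (\<lambda>i. nbrs X (A i) v)"
    have nsub: "nbrs X (A i) v \<subseteq> A i" for i v by (auto simp: nbrs_def)
    have finM: "finite (?M v)" for v
      using finite_subset[OF nsub finA] by (intro finite_PiE) auto
    have "PiE {..<k} A \<subseteq> T \<union> ?N \<union> (\<Union>v\<in>V - W. ?M v)"
      unfolding T_def by (auto simp: nbrs_def PiE_def Pi_def)
    then have "card (PiE {..<k} A) \<le> card (T \<union> ?N \<union> (\<Union>v\<in>V - W. ?M v))"
      using finP finM V by (intro card_mono) (auto simp: T_def)
    also have "\<dots> \<le> card (T \<union> ?N) + card (\<Union>v\<in>V - W. ?M v)" by (rule card_Un_le)
    also have "\<dots> \<le> card T + card ?N + (\<Sum>v\<in>V - W. card (?M v))"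
      using V by (intro add_mono card_Un_le card_UN_le) auto
    finally have "card (PiE {..<k} A) \<le> card T + card ?N + (\<Sum>v\<in>V - W. card (?M v))" .
    then have "real (card (PiE {..<k} A)) \<le> real (card T) + real (card ?N) + real (\<Sum>v\<in>V - W. card (?M v))"
      by linarith
    moreover have "real (card (PiE {..<k} A)) = P" unfolding P_def by (simp add: card_PiE)
    moreover have "real (card ?N) \<le> 1 / 20 * P"
    proof -
      have "real (card ?N) \<le> (real k)\<^sup>2 / a * P"
        unfolding P_def using finA A a by (intro card_PiE_noninjective) auto
      also have "\<dots> \<le> 1 / 20 * P" using k(2) a P0 by (intro mult_right_mono) (auto simp: field_simps)
      finally show ?thesis .
    qed
    moreover have "real (\<Sum>v\<in>V - W. card (?M v)) \<le> 3 / 4 * P"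
    proof -
      have "real (card (?M v)) = (\<Prod>i<k. real (card (nbrs X (A i) v)) / real (card (A i))) * P" for v
        unfolding P_def using cA by (simp add: card_PiE prod_dividef prod_pos less_imp_neq[THEN not_sym])
      then have "real (\<Sum>v\<in>V - W. card (?M v)) = (\<Sum>v\<in>V - W. \<Prod>i<k. real (card (nbrs X (A i) v)) / real (card (A i))) * P"
        by (simp only: of_nat_sum sum_distrib_right)
      also have "\<dots> \<le> 3 / 4 * P" using missed P0 by (intro mult_right_mono) auto
      finally show ?thesis .
    qed
    ultimately show ?thesis by linarith
  qed
  \<comment> \<open>This \<open>Q\<close> turns the bound \<open>exp (- \<rho> Q / 2)\<close> with \<open>\<rho> = 1/5\<close> into \<open>n^(-2|W|)\<close>.\<close>
  define Q where "Q = 20 * real (card W) * ln (real n)"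
  have W0: "real (card W) \<ge> a"
  proof -
    have "real (card (A 0)) \<le> real (card W)" using A(1)[of 0] k2 finW by (auto intro!: card_mono)
    then show ?thesis using A(2)[of 0] k2 by linarith
  qed
  have Q0: "Q > 0" unfolding Q_def using W0 a lnn by simp
  have "\<exists>\<alpha>>0. (\<forall>i<k. \<alpha> \<le> real (card (A i))) \<and>
      (\<forall>j. 2 \<le> j \<longrightarrow> j \<le> k \<longrightarrow> real k * Q \<le> (\<alpha> / (real k)\<^sup>2) ^ j * p ^ (j choose 2))"
  proof (cases "real (card W) \<le> 3 * real n * p")
    case True
    have "real k * Q \<le> (a / (real k)\<^sup>2) ^ j * p ^ (j choose 2)" if "2 \<le> j" "j \<le> k" for j
    proof -
      have "real k * Q \<le> real k * (20 * (3 * real n * p) * ln (real n))"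
        unfolding Q_def using True lnn by (intro mult_left_mono mult_right_mono) auto
      also have "\<dots> \<le> (a / (real k)\<^sup>2) ^ j * p ^ (j choose 2)" by (rule cliques[OF that])
      finally show ?thesis .
    qed
    then show ?thesis using a A(2) by blast
  next
    case False
    then have AW: "A i = W" if "i < k" for i using shape that by blast
    define m where "m = real (card W)"
    have m: "0 < m" "1 \<le> m / a" using W0 a unfolding m_def by auto
    have "real k * Q \<le> (m / (real k)\<^sup>2) ^ j * p ^ (j choose 2)" if j: "2 \<le> j" "j \<le> k" for j
    proof -
      have "(3 * real n * p) * (m / a) \<ge> m"
        using a m by (simp add: field_simps)
      then have "real k * Q \<le> real k * (20 * ((3 * real n * p) * (m / a)) * ln (real n))"
        unfolding Q_def m_def[symmetric] using lnn by (intro mult_left_mono mult_right_mono) auto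
      also have "\<dots> = (m / a) * (real k * (20 * (3 * real n * p) * ln (real n)))" by simp
      also have "\<dots> \<le> (m / a) ^ j * ((a / (real k)\<^sup>2) ^ j * p ^ (j choose 2))"
      proof (rule mult_mono)
        show "m / a \<le> (m / a) ^ j" using m j self_le_power[of "m / a" j] by simp
        show "real k * (20 * (3 * real n * p) * ln (real n)) \<le> (a / (real k)\<^sup>2) ^ j * p ^ (j choose 2)"
          by (rule cliques[OF j])
      qed (use m p lnn in auto)
      also have "\<dots> = ((m / a) * (a / (real k)\<^sup>2)) ^ j * p ^ (j choose 2)"
        by (simp only: power_mult_distrib mult.assoc)
      also have "(m / a) * (a / (real k)\<^sup>2) = m / (real k)\<^sup>2" using a by simp
      finally show ?thesis .
    qed
    then show ?thesis using AW m unfolding m_def by (intro exI[of _ "real (card W)"]) auto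
  qed
  then obtain \<alpha> where \<alpha>: "0 < \<alpha>" "\<And>i. i < k \<Longrightarrow> \<alpha> \<le> real (card (A i))"
      "\<And>j. 2 \<le> j \<Longrightarrow> j \<le> k \<Longrightarrow> real k * Q \<le> (\<alpha> / (real k)\<^sup>2) ^ j * p ^ (j choose 2)" by blast
  have "subset_expect (pairs W) p (\<lambda>Y. of_bool (\<not> has_hitting_clique (X \<union> Y) V W))
    \<le> subset_expect (pairs W) p (\<lambda>Y. of_bool (\<forall>u\<in>T. \<not> pairs (u ` {..<k}) \<subseteq> Y))"
  proof (rule subset_expect_mono)
    fix Y assume Y: "Y \<subseteq> pairs W"
    have "has_hitting_clique (X \<union> Y) V W" if u: "u \<in> T" "pairs (u ` {..<k}) \<subseteq> Y" for u
      unfolding has_hitting_clique_def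
    proof (intro exI[of _ "u ` {..<k}"] conjI)
      show "u ` {..<k} \<subseteq> W" using u(1) A(1) unfolding T_def by (auto simp: PiE_def Pi_def)
      show "is_clique (X \<union> Y) (u ` {..<k})"
        unfolding is_clique_def
      proof (intro ballI impI)
        fix x y assume "x \<in> u ` {..<k}" "y \<in> u ` {..<k}" "x \<noteq> y"
        then have "{x, y} \<in> pairs (u ` {..<k})" unfolding pairs_def by simp
        then show "{x, y} \<in> X \<union> Y" using u(2) by blast
      qed
      show "\<forall>v\<in>V - W. \<exists>x\<in>u ` {..<k}. {x, v} \<notin> X \<union> Y"
      proof
        fix v assume v: "v \<in> V - W"
        then obtain i where "i < k" "{u i, v} \<notin> X" using u(1) unfolding T_def by blast
        moreover have "{u i, v} \<notin> Y" using v Y unfolding pairs_def by auto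
        ultimately show "\<exists>x\<in>u ` {..<k}. {x, v} \<notin> X \<union> Y" by blast
      qed
    qed
    then show "of_bool (\<not> has_hitting_clique (X \<union> Y) V W)
      \<le> (of_bool (\<forall>u\<in>T. \<not> pairs (u ` {..<k}) \<subseteq> Y) :: real)" by auto
  qed (use p in auto)
  also have "\<dots> \<le> exp (- (1 / 5 * Q / 2))"
    using A(1) \<alpha> dens p k2 Q0 unfolding P_def
    by (intro no_clique_among_tuples[OF finW, of k A \<alpha>]) (auto simp: T_def)
  also have "- (1 / 5 * Q / 2) = - 2 * real (card W) * ln (real n)" unfolding Q_def by simp
  finally show ?thesis .
qed

text \<open>Both \<open>many_non_nbrs\<close> and \<open>degrees_tame\<close> depend only on the edges that are not inside \<open>W\<close>. For each \<open>W\<close>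
these edges are therefore exposed first. The union over all nonempty \<open>W\<close> costs the sum of \<open>n^(-2|W|)\<close>,
which is \<open>(1 + n^(-2))^n - 1\<close>.\<close>

theorem hitting_cliques_exist:
  "measure_pmf.prob (random_graph n p)
    {X. \<exists>W\<subseteq>{1..n}. many_non_nbrs X {1..n} W \<and> \<not> has_hitting_clique X {1..n} W} \<le> 4 / real n"
proof -
  define V where "V = {1..n}"
  have V: "finite V" "card V = n" "0 < n" unfolding V_def using n by auto
  let ?bad = "\<lambda>X W. many_non_nbrs X V W \<and> \<not> has_hitting_clique X V W"
  let ?D = "\<lambda>t b X. \<exists>A\<subseteq>V. a \<le> real (card A) \<and> b * real (card A) < (\<Sum>v\<in>heavy X V t A. real (card (nbrs X A v)))"
  let ?Ws = "Pow V - {{}}"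
  have finH: "finite (heavy X V t A)" for X :: "nat set set" and t A unfolding heavy_def using V by auto
  have W_large: "a \<le> real (card W)" if non: "many_non_nbrs X V W" and "W \<subseteq> V" for X W
  proof -
    have finW: "finite W" using that V finite_subset by auto
    obtain v where "v \<in> V - W" using non unfolding many_non_nbrs_def by blast
    then have "a \<le> real (card (W - nbrs X W v))" using non unfolding many_non_nbrs_def by blast
    also have "\<dots> \<le> real (card W)" using finW by (simp add: card_mono)
    finally show ?thesis .
  qed
  have tame: "degrees_tame X V W" if "\<not> ?D \<theta> \<beta> X" "\<not> ?D \<theta>' \<beta>' X" "many_non_nbrs X V W" "W \<subseteq> V" for X W
    unfolding degrees_tame_def
  proof (intro conjI allI impI)
    fix A assume A: "A \<subseteq> W" "a \<le> real (card A)"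
    have "(\<Sum>v\<in>heavy X V \<theta> A - W. real (card (nbrs X A v))) \<le> (\<Sum>v\<in>heavy X V \<theta> A. real (card (nbrs X A v)))"
      using finH by (intro sum_mono2) auto
    also have "\<dots> \<le> \<beta> * real (card A)" using that A by (meson not_le order_trans)
    finally show "(\<Sum>v\<in>heavy X V \<theta> A - W. real (card (nbrs X A v))) \<le> \<beta> * real (card A)" .
  next
    show "(\<Sum>v\<in>heavy X V \<theta>' W. real (card (nbrs X W v))) \<le> \<beta>' * real (card W)"
      using that W_large[OF that(3,4)] by (meson not_le)
  qed
  have rare_W: "subset_expect (pairs V) p (\<lambda>X. of_bool (?bad X W \<and> degrees_tame X V W)) \<le> (1 / (real n)\<^sup>2) ^ card W"
    if W: "W \<in> ?Ws" for W
  proof -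
    have sub: "pairs W \<subseteq> pairs V" using W by (auto simp: pairs_def)
    have fin: "finite (pairs V - pairs W)" "finite (pairs W)"
      using V sub finite_pairs finite_subset by blast+
    have local_nbrs: "nbrs (X \<union> Y) A v = nbrs X A v" if "Y \<subseteq> pairs W" "v \<notin> W" for X Y A v
      using that by (auto simp: nbrs_def pairs_def)
    have local_heavy: "heavy (X \<union> Y) V t A - W = heavy X V t A - W" if "Y \<subseteq> pairs W" for X Y A t
      using local_nbrs[OF that] by (auto simp: heavy_def)
    have local_heavy': "heavy (X \<union> Y) V t W = heavy X V t W" if "Y \<subseteq> pairs W" for X Y t
      using local_nbrs[OF that] by (auto simp: heavy_def)
    have local_non: "many_non_nbrs (X \<union> Y) V W = many_non_nbrs X V W" if "Y \<subseteq> pairs W" for X Y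
      using local_nbrs[OF that] by (auto simp: many_non_nbrs_def)
    have local_tame: "degrees_tame (X \<union> Y) V W = degrees_tame X V W" if Y: "Y \<subseteq> pairs W" for X Y
    proof -
      have "(\<Sum>v\<in>heavy (X \<union> Y) V \<theta> A - W. real (card (nbrs (X \<union> Y) A v))) = (\<Sum>v\<in>heavy X V \<theta> A - W. real (card (nbrs X A v)))" for A
        unfolding local_heavy[OF Y] by (rule sum.cong) (auto simp: local_nbrs[OF Y])
      moreover have "(\<Sum>v\<in>heavy (X \<union> Y) V \<theta>' W. real (card (nbrs (X \<union> Y) W v))) = (\<Sum>v\<in>heavy X V \<theta>' W. real (card (nbrs X W v)))"
        unfolding local_heavy'[OF Y] by (rule sum.cong) (auto simp: local_nbrs[OF Y] heavy_def)
      ultimately show ?thesis unfolding degrees_tame_def by simp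
    qed
    have "subset_expect (pairs V) p (\<lambda>X. of_bool (?bad X W \<and> degrees_tame X V W))
      = subset_expect ((pairs V - pairs W) \<union> pairs W) p (\<lambda>X. of_bool (?bad X W \<and> degrees_tame X V W))"
      using sub by (simp add: Un_absorb2)
    also have "\<dots> = subset_expect (pairs V - pairs W) p (\<lambda>X. subset_expect (pairs W) p (\<lambda>Y. of_bool (?bad (X \<union> Y) W \<and> degrees_tame (X \<union> Y) V W)))"
      by (rule subset_expect_union) (use fin in auto)
    also have "\<dots> \<le> subset_expect (pairs V - pairs W) p (\<lambda>X. exp (- 2 * real (card W) * ln (real n)))"
    proof (rule subset_expect_mono)
      fix X
      show "subset_expect (pairs W) p (\<lambda>Y. of_bool (?bad (X \<union> Y) W \<and> degrees_tame (X \<union> Y) V W))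
        \<le> exp (- 2 * real (card W) * ln (real n))"
      proof (cases "many_non_nbrs X V W \<and> degrees_tame X V W")
        case True
        have "subset_expect (pairs W) p (\<lambda>Y. of_bool (?bad (X \<union> Y) W \<and> degrees_tame (X \<union> Y) V W))
          \<le> subset_expect (pairs W) p (\<lambda>Y. of_bool (\<not> has_hitting_clique (X \<union> Y) V W))"
          using p by (intro subset_expect_mono) auto
        also have "\<dots> \<le> exp (- 2 * real (card W) * ln (real n))"
          using no_hitting_clique_rare[OF V(1,2)] True W by blast
        finally show ?thesis .
      next
        case False
        have "subset_expect (pairs W) p (\<lambda>Y. of_bool (?bad (X \<union> Y) W \<and> degrees_tame (X \<union> Y) V W))
          = subset_expect (pairs W) p (\<lambda>Y. 0)"
          using False by (intro subset_expect_cong) (auto simp: local_non local_tame)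
        then show ?thesis using fin by (simp add: subset_expect_const)
      qed
    qed (use p in auto)
    also have "\<dots> = exp (- 2 * real (card W) * ln (real n))" using fin by (simp add: subset_expect_const)
    also have "\<dots> = exp (real (card W) * (- (2 * ln (real n))))" by (rule arg_cong[where f = exp]) simp
    also have "\<dots> = exp (- (2 * ln (real n))) ^ card W" by (rule exp_of_nat_mult)
    also have "exp (- (2 * ln (real n))) = 1 / (real n)\<^sup>2"
    proof -
      have "exp (2 * ln (real n)) = (real n)\<^sup>2" using V(3) exp_of_nat_mult[of 2 "ln (real n)"] by simp
      then show ?thesis by (simp only: exp_minus inverse_eq_divide)
    qed
    finally show ?thesis .
  qed
  have "measure_pmf.prob (random_graph n p) {X. \<exists>W\<subseteq>V. ?bad X W}
    = subset_expect (pairs V) p (\<lambda>X. of_bool (\<exists>W\<subseteq>V. ?bad X W))"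
    using prob_random_graph[of p n] p by (simp add: pairs_def vertex_pairs_def V_def)
  also have "\<dots> \<le> subset_expect (pairs V) p (\<lambda>X. of_bool (?D \<theta> \<beta> X) + (of_bool (?D \<theta>' \<beta>' X)
      + (\<Sum>W\<in>?Ws. of_bool (?bad X W \<and> degrees_tame X V W))))"
  proof (rule subset_expect_mono)
    fix X
    have s0: "0 \<le> (\<Sum>W\<in>?Ws. of_bool (?bad X W \<and> degrees_tame X V W) :: real)" by (rule sum_nonneg) simp
    show "of_bool (\<exists>W\<subseteq>V. ?bad X W) \<le> of_bool (?D \<theta> \<beta> X) + (of_bool (?D \<theta>' \<beta>' X)
      + (\<Sum>W\<in>?Ws. of_bool (?bad X W \<and> degrees_tame X V W) :: real))"
    proof (cases "(\<exists>W\<subseteq>V. ?bad X W) \<and> \<not> ?D \<theta> \<beta> X \<and> \<not> ?D \<theta>' \<beta>' X")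
      case True
      from conjunct1[OF True] obtain W where W: "W \<subseteq> V" "?bad X W"
        by (elim conjE exE) (rule that, assumption, rule conjI)
      have "degrees_tame X V W" using True W by (intro tame) auto
      moreover have "W \<in> ?Ws" using W W_large[of X W] a by auto
      then have "of_bool (?bad X W \<and> degrees_tame X V W) \<le> (\<Sum>W\<in>?Ws. of_bool (?bad X W \<and> degrees_tame X V W) :: real)"
        using V by (intro member_le_sum) auto
      ultimately have "1 \<le> (\<Sum>W\<in>?Ws. of_bool (?bad X W \<and> degrees_tame X V W) :: real)" using W by simp
      moreover have "of_bool (\<exists>W\<subseteq>V. ?bad X W) \<le> (1 :: real)" by simp
      moreover have "0 \<le> (of_bool (?D \<theta> \<beta> X) :: real)" "0 \<le> (of_bool (?D \<theta>' \<beta>' X) :: real)" by simp_all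
      ultimately show ?thesis by linarith
    next
      case False
      then consider "\<not> (\<exists>W\<subseteq>V. ?bad X W)" | "?D \<theta> \<beta> X" | "?D \<theta>' \<beta>' X" by blast
      then show ?thesis
      proof cases
        case 1
        then have "of_bool (\<exists>W\<subseteq>V. ?bad X W) = (0 :: real)" by simp
        moreover have "0 \<le> (of_bool (?D \<theta> \<beta> X) :: real)" "0 \<le> (of_bool (?D \<theta>' \<beta>' X) :: real)" by simp_all
        ultimately show ?thesis using s0 by linarith
      qed (use s0 in \<open>simp_all add: of_bool_def\<close>)
    qed
  qed (use p in auto)
  also have "\<dots> = subset_expect (pairs V) p (\<lambda>X. of_bool (?D \<theta> \<beta> X)) + (subset_expect (pairs V) p (\<lambda>X. of_bool (?D \<theta>' \<beta>' X))
      + (\<Sum>W\<in>?Ws. subset_expect (pairs V) p (\<lambda>X. of_bool (?bad X W \<and> degrees_tame X V W))))"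
    by (simp only: subset_expect_add subset_expect_sum)
  also have "\<dots> \<le> 1 / real n + (1 / real n + 2 / real n)"
  proof (intro add_mono)
    show "subset_expect (pairs V) p (\<lambda>X. of_bool (?D \<theta> \<beta> X)) \<le> 1 / real n"
      using heavy_degrees_rare[OF V p a(1) _ thresholds(1,2) entropy(1) a_large] masses by linarith
    have "(\<beta>' + 1) / \<theta>' \<le> (\<beta> + 1) / \<theta>"
      using masses thresholds by (intro frac_le) auto
    then have "((\<beta>' + 1) / \<theta>' + 2) * ln (real n + 1) \<le> ((\<beta> + 1) / \<theta> + 2) * ln (real n + 1)"
      by (intro mult_right_mono) auto
    then have "((\<beta>' + 1) / \<theta>' + 2) * ln (real n + 1) \<le> a" using a_large by linarith
    then show "subset_expect (pairs V) p (\<lambda>X. of_bool (?D \<theta>' \<beta>' X)) \<le> 1 / real n"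
      using heavy_degrees_rare[OF V p a(1) masses(1) _ _ entropy(2)] thresholds by linarith
    have "(\<Sum>W\<in>?Ws. subset_expect (pairs V) p (\<lambda>X. of_bool (?bad X W \<and> degrees_tame X V W)))
      \<le> (\<Sum>W\<in>?Ws. (1 / (real n)\<^sup>2) ^ card W)" by (rule sum_mono) (rule rare_W)
    also have "\<dots> = (\<Sum>W\<in>Pow V. (1 / (real n)\<^sup>2) ^ card W) - 1"
      using V by (subst sum_diff) auto
    also have "\<dots> = (1 + 1 / (real n)\<^sup>2) ^ n - 1" using sum_power_card_Pow[OF V(1)] V(2) by simp
    also have "\<dots> \<le> exp (1 / (real n)\<^sup>2) ^ n - 1"
      using exp_ge_add_one_self[of "1 / (real n)\<^sup>2"] by (intro diff_right_mono power_mono) auto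
    also have "exp (1 / (real n)\<^sup>2) ^ n = exp (1 / real n)"
      using V(3) by (simp add: power2_eq_square flip: exp_of_nat_mult)
    also have "exp (1 / real n) - 1 \<le> 2 / real n"
    proof -
      have le1: "1 / real n \<le> 1" using V(3) by simp
      have "exp (1 / real n) \<le> 1 + 1 / real n + (1 / real n)\<^sup>2" using le1 by (intro exp_bound) auto
      also have "(1 / real n)\<^sup>2 \<le> 1 / real n"
        using mult_right_mono[OF le1, of "1 / real n"] by (simp add: power2_eq_square)
      finally show ?thesis by simp
    qed
    finally show "(\<Sum>W\<in>?Ws. subset_expect (pairs V) p (\<lambda>X. of_bool (?bad X W \<and> degrees_tame X V W))) \<le> 2 / real n" .
  qed
  also have "\<dots> = 4 / real n" by simp
  finally show ?thesis unfolding V_def .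
qed

end

section \<open>Parameters on the logarithmic scale\<close>

lemma real_choose_two: "real (j choose 2) = real j * (real j - 1) / 2"
proof (induction j)
  case (Suc j)
  then show ?case by (simp add: numeral_2_eq_2 field_simps)
qed simp

text \<open>The function of \<open>t\<close> on the right is concave. Up to lower order terms it is the logarithm of
\<open>(a/k\<^sup>2)^t p^(t(t-1)/2)\<close>, the quantity in the condition for cliques that share \<open>t\<close> vertices.\<close>

lemma quadratic_above_from_endpoints:
  fixes D y K t k :: real
  assumes "0 \<le> y" "2 \<le> t" "t \<le> k" "2 < k"
    and "K \<le> 2 * D - y" "K \<le> k * D - k * (k - 1) / 2 * y"
  shows "K \<le> t * D - t * (t - 1) / 2 * y"
proof -
  have "(k - 2) * K = (k - t) * K + (t - 2) * K" by (simp add: algebra_simps)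
  also have "\<dots> \<le> (k - t) * (2 * D - y) + (t - 2) * (k * D - k * (k - 1) / 2 * y)"
    using assms by (intro add_mono mult_left_mono) auto
  also have "\<dots> \<le> (k - t) * (2 * D - y) + (t - 2) * (k * D - k * (k - 1) / 2 * y)
      + y / 2 * ((t - 2) * (k - t)) * (k - 2)"
    using assms by (simp add: mult_nonneg_nonneg)
  also have "\<dots> = (k - 2) * (t * D - t * (t - 1) / 2 * y)" by (simp add: field_simps)
  finally show ?thesis using assms by (simp add: mult_le_cancel_left_pos)
qed

text \<open>All conditions on the parameters become almost linear in terms of \<open>L = ln n\<close>, \<open>y = - ln p\<close> and
\<open>E = ln L\<close>; powers of \<open>L\<close> are absorbed by multiples of \<open>E\<close> or by small powers of \<open>n\<close>. The thresholds are
\<open>\<theta> = 2 e\<^sup>2 p\<close>, which makes \<open>ln (\<theta>/(2ep))\<close> equal to \<open>1\<close>, and \<open>\<theta>' = p^(1/100)\<close>. The conditions \<open>two\<close> and \<open>full\<close>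
are those of Janson's inequality for \<open>j = 2\<close> and \<open>j = k\<close>.\<close>

lemma clique_parameters_from_logs:
  fixes n k B c :: nat and p \<delta> L y E \<beta>' :: real
  assumes n: "2 \<le> n" and L: "L = ln (real n)" and p: "p = exp (- y)" and E: "E = ln L"
    and E10: "10 \<le> E" "10 * E \<le> L" and y: "200 \<le> y" "y \<le> 2 / 5 * L"
    and \<delta>: "0 < \<delta>" "\<delta> \<le> 1 / 2" "L / 10 \<le> (1 - \<delta>) * L - 2 * y"
    and poly: "28 * L ^ 3 \<le> exp (L / 10)" "600 * L\<^sup>2 \<le> exp (L / 20)" "200 * L \<le> exp (6 / 10000 * L)"
    and k: "3 \<le> k" "real k \<le> 3 * L"
    and \<beta>': "1 \<le> \<beta>'" "\<beta>' \<le> 4 * L" "3 + \<delta> * L + y + E \<le> \<beta>' * (99 / 100 * y - 17 / 10)"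
    and B: "3 / 2 * \<beta>' < real B + 1" and c: "c + 1 + B \<le> k" "1 \<le> c"
    and k\<beta>: "3 / 2 * \<beta>' \<le> real k - 1"
    and light: "L + 4 \<le> real k * (y - 27 / 10)" "L / 20 \<le> real c * (y - 27 / 10)" "6 / 100 * L \<le> real c * y"
    and two: "12 * E \<le> (1 - 2 * \<delta>) * L - 2 * y"
    and full: "L - y + 4 * E \<le> real k * ((1 - \<delta>) * L - y - 4 * E) - real k * (real k - 1) / 2 * y"
  shows "clique_parameters n k B c p (real n powr (1 - \<delta>) * p / (2 * L)) (2 * exp 2 * p) (4 * L) (exp (- (y / 100))) \<beta>'"
proof -
  define a where "a = real n powr (1 - \<delta>) * p / (2 * L)"
  have Lpos: "0 < L" unfolding L using n by simp
  have Lexp: "L = exp E" unfolding E using Lpos by simp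
  have L100: "100 \<le> L" using E10 by linarith
  have ln2: "ln 2 \<le> (7 / 10 :: real)" using ln2_le_25_over_36 by linarith
  have ln2': "0 \<le> ln (2 :: real)" by simp
  have npos: "0 < real n" using n by simp
  have nexp: "real n = exp L" unfolding L using npos by simp
  have ppos: "0 < p" "p \<le> 1" unfolding p using y by simp_all
  have apos: "0 < a" unfolding a_def using npos ppos Lpos by simp
  have lna: "ln a = (1 - \<delta>) * L - y - ln 2 - E"
    unfolding a_def E using npos ppos Lpos
    by (simp add: ln_div ln_mult ln_powr L[symmetric] p)
  have aexp: "a = exp ((1 - \<delta>) * L - y) / (2 * L)"
    unfolding a_def nexp p by (simp add: powr_def exp_add[symmetric] algebra_simps)
  have lnna: "ln (real n / a) \<le> \<delta> * L + y + E + 7 / 10"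
    using npos apos ln2 by (simp add: ln_div lna L[symmetric] algebra_simps)
  have e2: "1 \<le> exp (2 :: real)" "exp (1 :: real) \<le> exp 2" by simp_all
  have invp: "1 / p = exp y" unfolding p by (simp add: exp_minus divide_inverse)
  have a14: "14 * L\<^sup>2 * exp y \<le> a"
  proof -
    have "28 * L ^ 3 * exp y \<le> exp (L / 10) * exp y" using poly(1) by simp
    also have "\<dots> \<le> exp ((1 - \<delta>) * L - y)" unfolding exp_add[symmetric] using \<delta>(3) by simp
    finally show ?thesis unfolding aexp using Lpos
      by (simp add: pos_le_divide_eq power2_eq_square power3_eq_cube algebra_simps)
  qed
  have \<theta>exp: "2 * exp 2 * p = exp (ln 2 + 2 - y)" unfolding p by (simp add: exp_add exp_diff exp_minus divide_inverse)
  have \<theta>le: "(2 * exp 2 * p) ^ i \<le> exp (- (real i * (y - 27 / 10)))" for i :: nat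
  proof -
    have "(2 * exp 2 * p) ^ i = exp (real i * (ln 2 + 2 - y))" unfolding \<theta>exp by (rule exp_of_nat_mult[symmetric])
    also have "\<dots> \<le> exp (- (real i * (y - 27 / 10)))"
    proof -
      have "real i * (ln 2 + 2 - y) \<le> real i * (- (y - 27 / 10))" using ln2 by (intro mult_left_mono) auto
      then show ?thesis by (simp only: exp_le_cancel_iff mult_minus_right)
    qed
    finally show ?thesis .
  qed
  have e27: "27 / 10 \<le> exp (1 :: real)"
    using e_approx_32 by (simp add: abs_if split: if_splits)
  have e4: "exp (- 4 :: real) \<le> 1 / 50"
  proof -
    have "(50 :: real) \<le> (27 / 10) ^ 4" by (simp add: eval_nat_numeral)
    also have "\<dots> \<le> exp 1 ^ 4"
      using e27 by (intro power_mono) auto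
    also have "\<dots> = exp 4" by (simp flip: exp_of_nat_mult)
    finally have "1 / exp 4 \<le> 1 / (50 :: real)" by (intro divide_left_mono) auto
    then show ?thesis by (simp only: exp_minus inverse_eq_divide)
  qed
  have lnk: "ln (real k) \<le> E + 12 / 10"
  proof -
    have "ln (real k) \<le> ln (3 * L)" using k Lpos by simp
    also have "\<dots> = ln 3 + E" using Lpos unfolding E by (simp add: ln_mult)
    also have "ln (3 :: real) \<le> 12 / 10"
    proof -
      have "(3 :: real) ^ 10 \<le> (27 / 10) ^ 12" by (simp add: eval_nat_numeral)
      also have "\<dots> \<le> exp 1 ^ 12" using e27 by (intro power_mono) auto
      also have "\<dots> = exp (12 / 10) ^ 10" by (simp flip: exp_of_nat_mult)
      finally have "3 \<le> exp (12 / 10 :: real)" by (rule power_le_imp_le_base[where n = 9, simplified]) auto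
      then have "ln 3 \<le> ln (exp (12 / 10 :: real))" by (subst ln_le_cancel_iff) auto
      then show ?thesis by (simp only: ln_exp)
    qed
    finally show ?thesis by simp
  qed
  show ?thesis unfolding a_def[symmetric]
  proof
    show "2 \<le> n" "0 < p" "p \<le> 1" "0 < a" by fact+
    have "real n powr (1 - \<delta>) \<le> real n powr 1" using n \<delta> by (intro powr_mono) auto
    then have "real n powr (1 - \<delta>) * p / (2 * L) \<le> real n * p / 1"
      using npos ppos L100 by (intro frac_le mult_right_mono) auto
    moreover have "0 \<le> real n * p" using npos ppos by simp
    ultimately show "a \<le> 3 * real n * p" unfolding a_def by linarith
    show "0 < 2 * exp 2 * p" using ppos by simp
    show "2 * exp 1 * p \<le> 2 * exp 2 * p" using ppos by simp
    show "2 * exp 2 * p \<le> exp (- (y / 100))" unfolding \<theta>exp using ln2 y by simp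
    have "1 + y / 100 \<le> exp (y / 100)" by (rule exp_ge_add_one_self)
    then have "3 / 2 \<le> exp (y / 100)" using y by linarith
    then have "1 / exp (y / 100) \<le> 1 / (3 / 2)" by (intro divide_left_mono) auto
    also have "1 / (3 / 2) = (2 / 3 :: real)" by simp
    finally show "exp (- (y / 100)) \<le> 2 / 3" by (simp only: exp_minus inverse_eq_divide)
    show "1 \<le> \<beta>'" "\<beta>' \<le> 4 * L" by fact+
    have ratio: "2 * exp 2 * p / (2 * exp 1 * p) = exp 1" using ppos by (simp add: exp_diff[symmetric])
    have "\<delta> * L \<le> 1 / 2 * L" using \<delta> Lpos by (intro mult_right_mono) auto
    then have "2 + ln (real n / a) \<le> 4 * L * 1" using lnna y E10 L100 by linarith
    then show "2 + ln (real n / a) \<le> 4 * L * ln (2 * exp 2 * p / (2 * exp 1 * p))"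
      unfolding ratio ln_exp .
    have "ln (exp (- (y / 100)) / (2 * exp 1 * p)) = 99 / 100 * y - 1 - ln 2"
      using ppos by (simp add: ln_div ln_mult p)
    then have "\<beta>' * (99 / 100 * y - 17 / 10) \<le> \<beta>' * ln (exp (- (y / 100)) / (2 * exp 1 * p))"
      using \<beta>'(1) ln2 by (intro mult_left_mono) auto
    then show "2 + ln (real n / a) \<le> \<beta>' * ln (exp (- (y / 100)) / (2 * exp 1 * p))"
      using lnna \<beta>'(3) by linarith
    have "((4 * L + 1) / (2 * exp 2 * p) + 2) * ln (real n + 1) \<le> (7 * L * exp y) * (2 * L)"
    proof (rule mult_mono)
      have "(1 :: real) \<le> 2 * exp 2" using e2 by linarith
      then have "(4 * L + 1) / (2 * exp 2 * p) \<le> (5 * L) / (1 * p)"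
        using L100 ppos by (intro frac_le mult_right_mono) auto
      also have "\<dots> = 5 * L * exp y" using invp by (metis mult.right_neutral mult_1 times_divide_eq_right)
      finally have 1: "(4 * L + 1) / (2 * exp 2 * p) \<le> 5 * L * exp y" .
      have "1 * 1 \<le> L * exp y" using L100 y by (intro mult_mono) auto
      then show "(4 * L + 1) / (2 * exp 2 * p) + 2 \<le> 7 * L * exp y" using 1 by simp
      have "ln (real n + 1) \<le> ln (real n * real n)"
      proof -
        have "real n * 2 \<le> real n * real n" using n by (intro mult_left_mono) auto
        then have "real n + 1 \<le> real n * real n" using n by linarith
        then show ?thesis using npos by simp
      qed
      also have "\<dots> = 2 * L" unfolding L using npos by (simp add: ln_mult)
      finally show "ln (real n + 1) \<le> 2 * L" .
    qed (use Lpos n in auto)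
    also have "\<dots> = 14 * L\<^sup>2 * exp y" by (simp add: power2_eq_square)
    also have "\<dots> \<le> a" by (rule a14)
    finally show "((4 * L + 1) / (2 * exp 2 * p) + 2) * ln (real n + 1) \<le> a" .
    show "3 / 2 * \<beta>' < real B + 1" "c + 1 + B \<le> k" "1 \<le> c" "3 / 2 * \<beta>' \<le> real k - 1" by fact+
    have "20 * (real k)\<^sup>2 \<le> 20 * (3 * L)\<^sup>2" using k by (intro mult_left_mono power_mono) auto
    also have "\<dots> \<le> 14 * L\<^sup>2 * exp y"
    proof -
      have "180 / 14 \<le> exp y" using exp_ge_add_one_self[of y] y by linarith
      then have "14 * L\<^sup>2 * (180 / 14) \<le> 14 * L\<^sup>2 * exp y" by (intro mult_left_mono) auto
      then show ?thesis by (simp add: power_mult_distrib)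
    qed
    also have "\<dots> \<le> a" by (rule a14)
    finally show "20 * (real k)\<^sup>2 \<le> a" .
    have "real n * (2 * exp 2 * p) ^ k \<le> exp L * exp (- (real k * (y - 27 / 10)))"
      unfolding nexp by (intro mult_left_mono \<theta>le) auto
    also have "\<dots> \<le> exp (- 4)" unfolding exp_add[symmetric] using light(1) by simp
    finally show "real n * (2 * exp 2 * p) ^ k \<le> 1 / 50" using e4 by linarith
    have "real k * (4 * L) * (2 * exp 2 * p) ^ c \<le> (3 * L) * (4 * L) * exp (- (L / 20))"
    proof (intro mult_mono)
      show "(2 * exp 2 * p) ^ c \<le> exp (- (L / 20))" using \<theta>le[of c] light(2) by (meson exp_le_cancel_iff neg_le_iff_le order_trans)
    qed (use k Lpos ppos in auto)
    also have "\<dots> = (12 * L\<^sup>2) / exp (L / 20)"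
      by (simp only: exp_minus inverse_eq_divide) (simp add: power2_eq_square)
    also have "\<dots> \<le> 1 / 50" using poly(2) by (simp add: divide_le_eq)
    finally show "real k * (4 * L) * (2 * exp 2 * p) ^ c \<le> 1 / 50" .
    have "4 * L * exp (- (y / 100)) ^ c = 4 * L * exp (- (real c * y / 100))"
      by (simp flip: exp_of_nat_mult)
    also have "\<dots> \<le> 4 * L * exp (- (6 / 10000 * L))" using light(3) Lpos by (intro mult_left_mono) auto
    also have "\<dots> = 4 * L / exp (6 / 10000 * L)"
      by (simp only: exp_minus inverse_eq_divide) simp
    also have "\<dots> \<le> 1 / 50" using poly(3) by (simp add: divide_le_eq)
    finally show "4 * L * exp (- (y / 100)) ^ c \<le> 1 / 50" .
    fix j assume j: "2 \<le> j" "j \<le> k"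
    have kpos: "0 < real k" using k by simp
    have "L - y + 4 * E \<le> real j * ((1 - \<delta>) * L - y - 4 * E) - real j * (real j - 1) / 2 * y"
    proof (rule quadratic_above_from_endpoints[OF _ _ _ _ _ full])
      show "L - y + 4 * E \<le> 2 * ((1 - \<delta>) * L - y - 4 * E) - y" using two by (simp add: algebra_simps)
    qed (use j k y in auto)
    also have "\<dots> \<le> real j * (ln a - 2 * ln (real k)) - real j * (real j - 1) / 2 * y"
      using lna lnk ln2 E10 by (intro diff_right_mono mult_left_mono) auto
    also have "\<dots> = ln ((a / (real k)\<^sup>2) ^ j * p ^ (j choose 2))"
      using apos kpos ppos by (simp add: ln_mult ln_realpow ln_div real_choose_two p)
    finally have main: "L - y + 4 * E \<le> ln ((a / (real k)\<^sup>2) ^ j * p ^ (j choose 2))" .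
    have "ln (60 :: real) \<le> 42 / 10"
    proof -
      have "(60 :: real) ^ 10 \<le> (27 / 10) ^ 42" by (simp add: eval_nat_numeral)
      also have "\<dots> \<le> exp 1 ^ 42" using e27 by (intro power_mono) auto
      also have "\<dots> = exp (42 / 10) ^ 10" by (simp flip: exp_of_nat_mult)
      finally have "60 \<le> exp (42 / 10 :: real)" by (rule power_le_imp_le_base[where n = 9, simplified]) auto
      then have "ln 60 \<le> ln (exp (42 / 10 :: real))" by (subst ln_le_cancel_iff) auto
      then show ?thesis by (simp only: ln_exp)
    qed
    moreover have "ln (real k * (20 * (3 * real n * p) * ln (real n))) = ln (real k) + (ln 60 + (L - y + E))"
    proof -
      have np: "real n * p = exp (L - y)" unfolding nexp p by (simp flip: exp_add)
      have "20 * (3 * real n * p) * ln (real n) = 60 * ((real n * p) * L)" unfolding L by simp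
      also have "\<dots> = 60 * (exp (L - y) * exp E)" by (simp only: np Lexp[symmetric])
      also have "\<dots> = 60 * exp (L - y + E)" by (simp only: exp_add)
      finally have eq: "20 * (3 * real n * p) * ln (real n) = 60 * exp (L - y + E)" .
      show ?thesis unfolding eq using kpos by (simp add: ln_mult)
    qed
    ultimately have "ln (real k * (20 * (3 * real n * p) * ln (real n))) \<le> L - y + 4 * E"
      using lnk E10 by linarith
    then have "ln (real k * (20 * (3 * real n * p) * ln (real n))) \<le> ln ((a / (real k)\<^sup>2) ^ j * p ^ (j choose 2))"
      using main by linarith
    then show "real k * (20 * (3 * real n * p) * ln (real n)) \<le> (a / (real k)\<^sup>2) ^ j * p ^ (j choose 2)"
      using apos kpos ppos npos Lpos L by (subst (asm) ln_le_cancel_iff) auto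
  qed
qed

text \<open>Numerical facts that hold for all large \<open>n\<close>. The constants are not optimised.\<close>

locale log_scale =
  fixes n :: nat and p L y E :: real
  assumes n: "2 \<le> n" and L: "L = ln (real n)" and p: "p = exp (- y)" and E: "E = ln L"
    and E_bounds: "10 \<le> E" "100000 * E \<le> L" and y: "100000 \<le> y" "y \<le> 2 / 5 * L"
    and poly: "28 * L ^ 3 \<le> exp (L / 10)" "600 * L\<^sup>2 \<le> exp (L / 20)" "200 * L \<le> exp (6 / 10000 * L)"
begin

text \<open>A quantity that tends to \<open>0\<close> and pays for logarithmic factors (first summand) and for constant factors
per clique vertex (second summand).\<close>

definition \<eta> :: real where "\<eta> = 10 * (E / L + 1 / y)"

definition admissible :: "real \<Rightarrow> bool" where
  "admissible \<delta> \<longleftrightarrow> (\<exists>k B c \<beta>'. clique_parameters n k B c p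
    (real n powr (1 - \<delta>) * p / (2 * L)) (2 * exp 2 * p) (4 * L) (exp (- (y / 100))) \<beta>')"

lemma L_large: "1000000 \<le> L" using E_bounds by linarith

text \<open>For \<open>p \<lless> n^(-1/3)\<close> triangles suffice. Since \<open>\<delta> \<le> 1/200\<close> is small compared with \<open>x = y/L\<close>, the sum of
the fractions is at most \<open>11/10\<close>, so that only one vertex can be adjacent to more than \<open>2/3\<close> of \<open>W\<close>.\<close>

lemma admissible_triangles:
  assumes \<delta>: "0 < \<delta>" "\<delta> \<le> 1 / 200" and small: "L / 3 + 5 \<le> y" "5 * y + 16 * E \<le> (2 - 3 * \<delta>) * L"
  shows "admissible \<delta>"
proof -
  have d: "0 \<le> \<delta> * L" "\<delta> * L \<le> 1 / 200 * L" using \<delta> L_large by (auto intro!: mult_right_mono)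
  have s: "5 * y + 16 * E \<le> 2 * L - 3 * (\<delta> * L)" using small(2) by (simp add: algebra_simps)
  have "clique_parameters n 3 1 1 p (real n powr (1 - \<delta>) * p / (2 * L)) (2 * exp 2 * p) (4 * L) (exp (- (y / 100))) (11 / 10)"
  proof (rule clique_parameters_from_logs[OF n L p E])
    have "(1 - \<delta>) * L - 2 * y = L - \<delta> * L - 2 * y" by (simp add: algebra_simps)
    then show "L / 10 \<le> (1 - \<delta>) * L - 2 * y" using d y by linarith
    have "(1 - 2 * \<delta>) * L - 2 * y = L - 2 * (\<delta> * L) - 2 * y" by (simp add: algebra_simps)
    then show "12 * E \<le> (1 - 2 * \<delta>) * L - 2 * y" using d y E_bounds by linarith
    have "11 / 10 * (99 / 100 * y - 17 / 10) = 1089 / 1000 * y - 187 / 100" by simp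
    then show "3 + \<delta> * L + y + E \<le> 11 / 10 * (99 / 100 * y - 17 / 10)"
      using d small(1) E_bounds y by linarith
    have "real 3 * ((1 - \<delta>) * L - y - 4 * E) - real 3 * (real 3 - 1) / 2 * y
      = 3 * L - 3 * (\<delta> * L) - 6 * y - 12 * E" by (simp add: algebra_simps)
    then show "L - y + 4 * E \<le> real 3 * ((1 - \<delta>) * L - y - 4 * E) - real 3 * (real 3 - 1) / 2 * y"
      using s by linarith
  qed (use E_bounds y \<delta> small L_large poly in simp_all)
  then show ?thesis unfolding admissible_def by blast
qed

definition clique_size :: nat where "clique_size = nat \<lceil>(1 + \<eta>) * L / y\<rceil>"

lemma \<eta>_facts:
  shows "\<eta> * L = 10 * E + 10 * (L / y)" "0 < \<eta>" "\<eta> \<le> 1 / 5000" "\<eta> * L \<le> 1 / 5000 * L"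
proof -
  show "\<eta> * L = 10 * E + 10 * (L / y)" unfolding \<eta>_def using L_large by (simp add: algebra_simps)
  show "0 < \<eta>" unfolding \<eta>_def using L_large y E_bounds by (simp add: add_pos_pos)
  have "E / L \<le> 1 / 100000" using L_large E_bounds by (simp add: divide_le_eq)
  moreover have "1 / y \<le> 1 / 100000" using y by (simp add: divide_le_eq)
  ultimately have "E / L + 1 / y \<le> 1 / 100000 + 1 / 100000" by (rule add_mono)
  moreover have "10 * z \<le> 1 / 5000" if "z \<le> 1 / 100000 + 1 / 100000" for z :: real using that by simp
  ultimately show h: "\<eta> \<le> 1 / 5000" unfolding \<eta>_def by blast
  show "\<eta> * L \<le> 1 / 5000 * L" using h L_large by (intro mult_right_mono) auto
qed

lemma clique_size_facts:
  shows "L \<le> real clique_size * y" "(real clique_size - 1) * y \<le> L + \<eta> * L"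
    "L / y \<le> real clique_size" "real clique_size \<le> 3 * L"
    "L + 4 \<le> real clique_size * (y - 27 / 10)"
proof -
  define q where "q = (1 + \<eta>) * L / y"
  have ypos: "0 < y" using y by simp
  have Lpos: "0 < L" using L_large by simp
  have g: "0 < L / y" using ypos Lpos by simp
  have g_small: "L / y \<le> L / 100000" using Lpos y by (intro divide_left_mono) auto
  have qg: "q = (1 + \<eta>) * (L / y)" unfolding q_def by simp
  have q0: "0 < q" unfolding qg using g \<eta>_facts(2) by (intro mult_pos_pos) auto
  have k: "q \<le> real clique_size" "real clique_size < q + 1"
    unfolding clique_size_def q_def[symmetric] using q0 by linarith+
  have qy: "q * y = L + \<eta> * L" unfolding q_def using ypos by (simp add: field_simps)
  have "1 * (L / y) \<le> q" unfolding qg using g \<eta>_facts(2) by (intro mult_right_mono) auto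
  moreover have "q \<le> 2 * (L / y)" unfolding qg using g \<eta>_facts(3) by (intro mult_right_mono) auto
  ultimately have q2: "L / y \<le> q" "q \<le> 2 * (L / y)" by simp_all
  show "L \<le> real clique_size * y"
  proof -
    have "q * y \<le> real clique_size * y" using k ypos by (intro mult_right_mono) auto
    moreover have "0 \<le> \<eta> * L" using \<eta>_facts(2) Lpos by simp
    ultimately show ?thesis using qy by linarith
  qed
  show "(real clique_size - 1) * y \<le> L + \<eta> * L"
    unfolding qy[symmetric] using k ypos by (intro mult_right_mono) auto
  show "L / y \<le> real clique_size" using q2 k by linarith
  show "real clique_size \<le> 3 * L" using q2 g_small k L_large by linarith
  have "q * (y - 27 / 10) \<le> real clique_size * (y - 27 / 10)" using k y by (intro mult_right_mono) auto
  moreover have "q * (y - 27 / 10) = L + \<eta> * L - 27 / 10 * q" using qy by (simp add: algebra_simps)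
  ultimately show "L + 4 \<le> real clique_size * (y - 27 / 10)"
    using q2 g g_small \<eta>_facts(1) E_bounds by linarith
qed

text \<open>By the choice of the clique size, \<open>(k - 1) y \<le> (1 + \<eta>) L\<close>.\<close>

lemma full_clique_bound:
  assumes "X = L / 2 - \<delta> * L - \<eta> * L / 2 - y - 4 * E"
  shows "real clique_size * X \<le> real clique_size * ((1 - \<delta>) * L - y - 4 * E)
    - real clique_size * (real clique_size - 1) / 2 * y"
proof -
  have "X \<le> (L - \<delta> * L) - y - 4 * E - (real clique_size - 1) * y / 2"
    using divide_right_mono[OF clique_size_facts(2), of 2] unfolding assms by argo
  also have "L - \<delta> * L = (1 - \<delta>) * L" by (simp add: algebra_simps)
  finally have "X \<le> (1 - \<delta>) * L - y - 4 * E - (real clique_size - 1) * y / 2" .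
  then have "real clique_size * X \<le> real clique_size * ((1 - \<delta>) * L - y - 4 * E - (real clique_size - 1) * y / 2)"
    by (intro mult_left_mono) auto
  then show ?thesis by (simp add: algebra_simps)
qed

text \<open>If \<open>y\<close> exceeds \<open>0.326 L\<close>, then \<open>k = 4\<close>, and up to lower order terms the condition for \<open>j = k\<close> is
\<open>9y < (3 - 4\<delta>) L\<close>. Otherwise it follows from \<open>k \<ge> 4\<close> and \<open>full_clique_bound\<close>.\<close>

lemma admissible_sparse:
  assumes \<delta>: "0 < \<delta>" "\<delta> \<le> 1 / 200" and range: "6 / 100 * L \<le> y" "9 * y + 20 * E \<le> (3 - 4 * \<delta>) * L"
  shows "admissible \<delta>"
proof -
  let ?k = clique_size
  have Lpos: "0 < L" and ypos: "0 < y" using L_large y by auto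
  have d: "0 \<le> \<delta> * L" "\<delta> * L \<le> 1 / 200 * L" using \<delta> L_large by (auto intro!: mult_right_mono)
  have s: "9 * y + 20 * E \<le> 3 * L - 4 * (\<delta> * L)" using range(2) by (simp add: algebra_simps)
  have k4: "4 \<le> ?k"
  proof -
    have "3 * y < L" using s d E_bounds by linarith
    then have "3 * y < real ?k * y" using clique_size_facts(1) by linarith
    then have "3 < real ?k" using ypos by simp
    then show ?thesis by linarith
  qed
  have "clique_parameters n ?k 1 1 p (real n powr (1 - \<delta>) * p / (2 * L)) (2 * exp 2 * p) (4 * L) (exp (- (y / 100))) (11 / 10)"
  proof (rule clique_parameters_from_logs[OF n L p E])
    have "(1 - \<delta>) * L - 2 * y = L - \<delta> * L - 2 * y" by (simp add: algebra_simps)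
    then show "L / 10 \<le> (1 - \<delta>) * L - 2 * y" using d y by linarith
    have "(1 - 2 * \<delta>) * L - 2 * y = L - 2 * (\<delta> * L) - 2 * y" by (simp add: algebra_simps)
    then show "12 * E \<le> (1 - 2 * \<delta>) * L - 2 * y" using d y E_bounds by linarith
    have "11 / 10 * (99 / 100 * y - 17 / 10) = 1089 / 1000 * y - 187 / 100" by simp
    then show "3 + \<delta> * L + y + E \<le> 11 / 10 * (99 / 100 * y - 17 / 10)"
      using d range(1) E_bounds y by linarith
    show "L - y + 4 * E \<le> real ?k * ((1 - \<delta>) * L - y - 4 * E) - real ?k * (real ?k - 1) / 2 * y"
    proof (cases "y \<le> 326 / 1000 * L")
      case True
      define X where "X = L / 2 - \<delta> * L - \<eta> * L / 2 - y - 4 * E"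
      have X: "L - y + 4 * E \<le> 4 * X" "0 \<le> X"
      proof -
        have hd: "4 * (\<delta> * L) \<le> 20 / 1000 * L" "2 * (\<eta> * L) \<le> 4 / 10000 * L" "20 * E \<le> 2 / 10000 * L"
          using d \<eta>_facts(4) E_bounds by linarith+
        have "4 * X = 2 * L - 4 * (\<delta> * L) - 2 * (\<eta> * L) - 4 * y - 16 * E" unfolding X_def by (simp add: field_simps)
        then show "L - y + 4 * E \<le> 4 * X" "0 \<le> X" using hd True L_large E_bounds y by linarith+
      qed
      have "4 * X \<le> real ?k * X" using k4 X by (intro mult_right_mono) auto
      then show ?thesis using X full_clique_bound[OF X_def] by linarith
    next
      case False
      have "(real ?k - 1) * y < 4 * y" using False clique_size_facts(2) \<eta>_facts(4) Lpos by linarith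
      then have "real ?k - 1 < 4" using ypos by simp
      moreover have "?k \<noteq> 5"
      proof
        assume "?k = 5"
        then have "4 * y \<le> L + \<eta> * L" using clique_size_facts(2) by simp
        then show False using False \<eta>_facts(4) Lpos by linarith
      qed
      ultimately have k: "?k = 4" using k4 by linarith
      have "real 4 * ((1 - \<delta>) * L - y - 4 * E) - real 4 * (real 4 - 1) / 2 * y
        = 4 * L - 4 * (\<delta> * L) - 10 * y - 16 * E" by (simp add: algebra_simps)
      then show ?thesis unfolding k using s by linarith
    qed
    show "L + 4 \<le> real ?k * (y - 27 / 10)" "real ?k \<le> 3 * L" by (rule clique_size_facts)+
  qed (use E_bounds y \<delta> range k4 L_large poly in simp_all)
  then show ?thesis unfolding admissible_def by blast
qed

text \<open>Here \<open>p \<ge> n^(-6/100)\<close>. With \<open>x = y/L\<close>, the sum of the fractions is at most \<open>\<beta>' = 0.55/x\<close>, so at most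
\<open>0.825/x\<close> of the at least \<open>1/x\<close> positions are reserved. The term \<open>8y/L = 8x\<close> in \<open>\<delta>\<close> makes each clique vertex
gain a factor \<open>n^(7x)\<close> in the condition for \<open>j = k\<close>, which amounts to at least \<open>n^7\<close> altogether.\<close>

lemma admissible_dense:
  assumes range: "y \<le> 6 / 100 * L" and \<delta>: "\<delta> = 1 / 2 - 8 * y / L - \<eta>"
  shows "admissible \<delta>"
proof -
  let ?k = clique_size
  define g where "g = L / y"
  define B where "B = nat \<lfloor>825 / 1000 * g\<rfloor>"
  define c where "c = ?k - 1 - B"
  have Lpos: "0 < L" and ypos: "0 < y" using L_large y by auto
  have gy: "g * y = L" unfolding g_def using ypos by simp
  have "g \<le> L / 100000" unfolding g_def using Lpos y by (intro divide_left_mono) auto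
  moreover have "50 / 3 \<le> g" unfolding g_def using range ypos by (simp add: le_divide_eq)
  ultimately have g: "50 / 3 \<le> g" "g \<le> L / 100000" by simp_all
  have h: "\<eta> * L = 10 * E + 10 * g" unfolding g_def by (rule \<eta>_facts)
  have d: "\<delta> * L = L / 2 - 8 * y - \<eta> * L" unfolding \<delta> using Lpos by (simp add: algebra_simps)
  have k: "g \<le> real ?k" unfolding g_def by (rule clique_size_facts)
  have Bb: "real B \<le> 825 / 1000 * g" "825 / 1000 * g < real B + 1" unfolding B_def using g by linarith+
  have c: "115 / 1000 * g \<le> real c" "1 \<le> c" "c + 1 + B = ?k"
  proof -
    have "B + 1 \<le> ?k" using k Bb g by linarith
    then show s: "c + 1 + B = ?k" unfolding c_def by simp
    then have "real c + 1 + real B = real ?k" by (metis of_nat_1 of_nat_add)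
    then show c': "115 / 1000 * g \<le> real c" using Bb k g by linarith
    then show "1 \<le> c" using g by linarith
  qed
  have \<delta>01: "0 < \<delta>" "\<delta> \<le> 1 / 2"
  proof -
    have "8 * y / L \<le> 48 / 100" using range Lpos by (simp add: divide_le_eq)
    moreover have "0 \<le> 8 * y / L" using ypos Lpos by simp
    ultimately show "0 < \<delta>" "\<delta> \<le> 1 / 2" unfolding \<delta> using \<eta>_facts(2,3) by linarith+
  qed
  have "clique_parameters n ?k B c p (real n powr (1 - \<delta>) * p / (2 * L)) (2 * exp 2 * p) (4 * L) (exp (- (y / 100))) (55 / 100 * g)"
  proof (rule clique_parameters_from_logs[OF n L p E])
    have "(1 - \<delta>) * L - 2 * y = L - \<delta> * L - 2 * y" by (simp add: algebra_simps)
    then show "L / 10 \<le> (1 - \<delta>) * L - 2 * y" using d h g E_bounds ypos by linarith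
    have "(1 - 2 * \<delta>) * L - 2 * y = L - 2 * (\<delta> * L) - 2 * y" by (simp add: algebra_simps)
    then show "12 * E \<le> (1 - 2 * \<delta>) * L - 2 * y" using d h g ypos E_bounds by linarith
    have "55 / 100 * g * (99 / 100 * y - 17 / 10) = 5445 / 10000 * (g * y) - 935 / 1000 * g" by (simp add: algebra_simps)
    then show "3 + \<delta> * L + y + E \<le> 55 / 100 * g * (99 / 100 * y - 17 / 10)"
      unfolding gy using d h g E_bounds ypos L_large by linarith
    show "L - y + 4 * E \<le> real ?k * ((1 - \<delta>) * L - y - 4 * E) - real ?k * (real ?k - 1) / 2 * y"
    proof -
      define X where "X = L / 2 - \<delta> * L - \<eta> * L / 2 - y - 4 * E"
      have "7 * y \<le> X" unfolding X_def using d h g E_bounds by linarith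
      then have "real ?k * (7 * y) \<le> real ?k * X" by (intro mult_left_mono) auto
      moreover have "7 * L \<le> real ?k * (7 * y)" using clique_size_facts(1) by simp
      ultimately show ?thesis using full_clique_bound[OF X_def] E_bounds ypos by linarith
    qed
    show "L + 4 \<le> real ?k * (y - 27 / 10)" "real ?k \<le> 3 * L" by (rule clique_size_facts)+
    have "115 / 1000 * g * (y - 27 / 10) \<le> real c * (y - 27 / 10)" using c y by (intro mult_right_mono) auto
    moreover have "115 / 1000 * g * (y - 27 / 10) = 115 / 1000 * (g * y) - 3105 / 10000 * g" by (simp add: field_simps)
    ultimately show "L / 20 \<le> real c * (y - 27 / 10)" unfolding gy using g Lpos by linarith
    have "115 / 1000 * g * y \<le> real c * y" using c ypos by (intro mult_right_mono) auto
    then show "6 / 100 * L \<le> real c * y" using gy Lpos by simp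
    show "3 / 2 * (55 / 100 * g) < real B + 1" using Bb by simp
    show "3 / 2 * (55 / 100 * g) \<le> real ?k - 1" using k g by linarith
    show "3 \<le> ?k" using k g by linarith
    show "1 \<le> 55 / 100 * g" "55 / 100 * g \<le> 4 * L" using g Lpos by linarith+
    show "1 \<le> c" "c + 1 + B \<le> ?k" using c by simp_all
  qed (use E_bounds y \<delta>01 L_large poly in simp_all)
  then show ?thesis unfolding admissible_def by blast
qed

end

section \<open>Useful sets\<close>

context log_scale begin

lemma real_n: "real n = exp L" and n_pos: "0 < real n"
  unfolding L using n by simp_all

lemma p_bounds: "0 < p" "p \<le> 1 / 2"
proof -
  show "0 < p" unfolding p by simp
  have "2 \<le> exp y" using exp_ge_add_one_self[of y] y by linarith
  then have "1 / exp y \<le> 1 / 2" by (intro divide_left_mono) auto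
  then show "p \<le> 1 / 2" unfolding p by (simp only: exp_minus inverse_eq_divide)
qed

lemma poly_gain:
  assumes "\<delta> \<le> 1 / 2"
  shows "28 * L ^ 3 \<le> real n powr (1 - \<delta>) * p"
proof -
  have "real n powr (1 - \<delta>) * p = exp ((1 - \<delta>) * L - y)"
    unfolding real_n p by (simp add: powr_def exp_diff exp_minus divide_inverse)
  note N_eq = this
  have "\<delta> * L \<le> 1 / 2 * L" using assms L_large by (intro mult_right_mono) auto
  moreover have "(1 - \<delta>) * L = L - \<delta> * L" by (simp add: algebra_simps)
  ultimately have "L / 10 \<le> (1 - \<delta>) * L - y" using y by linarith
  then have "exp (L / 10) \<le> exp ((1 - \<delta>) * L - y)" by simp
  then show ?thesis using poly(1) unfolding N_eq by linarith
qed

lemma tau_le_half: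
  assumes \<delta>: "0 < \<delta>" "\<delta> \<le> 1 / 2"
  shows "tau_param n p \<delta> \<le> 1 / 2"
proof -
  define N where "N = real n powr (1 - \<delta>) * p"
  have L1: "100 \<le> L" using L_large by simp
  have sq: "256 * L\<^sup>2 \<le> N"
  proof -
    have "256 * L\<^sup>2 \<le> 28 * L * L\<^sup>2" using L1 by (intro mult_right_mono) auto
    also have "\<dots> = 28 * L ^ 3" by (simp add: power3_eq_cube power2_eq_square)
    also have "\<dots> \<le> N" unfolding N_def by (rule poly_gain[OF \<delta>(2)])
    finally show ?thesis .
  qed
  have "L * 1 \<le> L * L" using L1 by (intro mult_left_mono) auto
  then have L_le: "256 * L \<le> N" using sq by (simp add: power2_eq_square)
  have "real n powr (1 - \<delta>) \<le> real n powr 1" using n \<delta> by (intro powr_mono) auto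
  then have "N \<le> real n * p" unfolding N_def using p_bounds n_pos by (intro mult_right_mono) auto
  then have np: "256 * L \<le> real n * p" using L_le by linarith
  have np_pos: "0 < real n * p" using p_bounds n_pos by simp
  have half: "ln (real n) / (real n * p) \<le> 1 / 2"
    unfolding L[symmetric] using np L1 np_pos by (simp add: divide_le_eq)
  have "2 * ln (real n) / (real n * p) \<le> 1 / 2"
    unfolding L[symmetric] using np L1 np_pos by (simp add: divide_le_eq)
  moreover have "sqrt (32 * (ln (real n))\<^sup>2 / (N * (1 - ln (real n) / (real n * p)))) \<le> 1 / 2"
  proof (rule real_le_lsqrt)
    have Npos: "0 < N" using L_le L1 by linarith
    have "128 * L\<^sup>2 \<le> N * (1 / 2)" using sq by simp
    also have "\<dots> \<le> N * (1 - ln (real n) / (real n * p))" using half Npos by (intro mult_left_mono) auto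
    finally have D: "128 * L\<^sup>2 \<le> N * (1 - ln (real n) / (real n * p))" .
    have "0 < 128 * L\<^sup>2" using L1 by simp
    then show "32 * (ln (real n))\<^sup>2 / (N * (1 - ln (real n) / (real n * p))) \<le> (1 / 2)\<^sup>2"
      using D unfolding L[symmetric] by (simp add: divide_le_eq power2_eq_square)
  qed simp_all
  ultimately show ?thesis unfolding tau_param_def N_def[symmetric] by simp
qed

lemma s_param_bounds:
  assumes \<delta>: "0 < \<delta>" "\<delta> \<le> 1 / 2" and large: "4 \<le> \<delta> * L"
  shows "2 \<le> s_param n p \<delta>" "real_of_int (s_param n p \<delta>) \<le> L / p"
proof -
  define r where "r = - ln (1 - p)"
  have r: "p \<le> r" "r \<le> 2 * p"
  proof -
    show "p \<le> r" unfolding r_def using ln_le_minus_one[of "1 - p"] p_bounds by simp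
    have "- p - 2 * p\<^sup>2 \<le> ln (1 - p)" using p_bounds by (intro ln_one_minus_pos_lower_bound) auto
    moreover have "2 * p\<^sup>2 \<le> p" using p_bounds mult_right_mono[of p "1 / 2" p] by (simp add: power2_eq_square)
    ultimately show "r \<le> 2 * p" unfolding r_def by linarith
  qed
  have lg: "log (1 / (1 - p)) (real n) = L / r"
    unfolding log_def r_def L using p_bounds by (simp add: ln_div)
  have Lpos: "0 < L" using L_large by simp
  have "2 * r \<le> \<delta> * L" using r p_bounds large by linarith
  then have "2 \<le> \<delta> * L / r" using r p_bounds by (simp add: le_divide_eq)
  then show "2 \<le> s_param n p \<delta>" unfolding s_param_def lg by (simp add: le_floor_iff)
  have "real_of_int (s_param n p \<delta>) \<le> \<delta> * (L / r)" unfolding s_param_def lg by (rule of_int_floor_le)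
  also have "\<dots> \<le> 1 * (L / p)" using r p_bounds Lpos \<delta> by (intro mult_mono divide_left_mono) auto
  finally show "real_of_int (s_param n p \<delta>) \<le> L / p" by simp
qed

lemma ell1_lower_bound:
  assumes \<delta>: "0 < \<delta>" "\<delta> \<le> 1 / 2" and large: "4 \<le> \<delta> * L"
  shows "real n powr (1 - \<delta>) * p / (2 * L) \<le> ell1 n p \<delta> W"
proof -
  let ?s = "real_of_int (s_param n p \<delta>)"
  have s: "0 < ?s" "?s \<le> L / p" using s_param_bounds[OF assms] by linarith+
  have Lpos: "0 < L" using L_large by simp
  have "real n powr (1 - \<delta>) * p / (2 * L) = (1 / 2 * real n powr (1 - \<delta>)) / (L / p)"
    using Lpos p_bounds by simp
  also have "\<dots> \<le> ((1 - tau_param n p \<delta>) * real n powr (1 - \<delta>)) / ?s"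
    using s tau_le_half[OF \<delta>] by (intro frac_le mult_right_mono) auto
  finally show ?thesis unfolding ell1_def by simp
qed

lemma useful_sets_contain_hitting_cliques:
  assumes \<delta>: "0 < \<delta>" "\<delta> \<le> 1 / 2" and large: "4 \<le> \<delta> * L" and adm: "admissible \<delta>"
  shows "1 - 4 / real n \<le> measure_pmf.prob (random_graph n p)
    {X. \<forall>W. useful n p \<delta> X W \<longrightarrow>
      (\<exists>K\<subseteq>W. is_clique X K \<and> (\<forall>v\<in>{1..n} - W. non_neighbors_in X K v \<noteq> {}))}"
    (is "_ \<le> measure_pmf.prob _ ?good")
proof -
  from adm obtain k B c \<beta>' where "clique_parameters n k B c p
    (real n powr (1 - \<delta>) * p / (2 * L)) (2 * exp 2 * p) (4 * L) (exp (- (y / 100))) \<beta>'"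
    unfolding admissible_def by blast
  then interpret clique_parameters n k B c p "real n powr (1 - \<delta>) * p / (2 * L)"
    "2 * exp 2 * p" "4 * L" "exp (- (y / 100))" \<beta>' .
  let ?bad = "{X. \<exists>W\<subseteq>{1..n}. many_non_nbrs X {1..n} W \<and> \<not> has_hitting_clique X {1..n} W}"
  have "- ?good \<subseteq> ?bad"
  proof
    fix X assume "X \<in> - ?good"
    then obtain W where W: "useful n p \<delta> X W"
      and none: "\<not> (\<exists>K\<subseteq>W. is_clique X K \<and> (\<forall>v\<in>{1..n} - W. non_neighbors_in X K v \<noteq> {}))" by blast
    have sub: "W \<subseteq> {1..n}" using W unfolding useful_def by simp
    have non: "non_neighbors_in X W v = W - nbrs X W v" if "v \<in> {1..n} - W" for v
      using that unfolding non_neighbors_in_def nbrs_def by auto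
    have "many_non_nbrs X {1..n} W"
      unfolding many_non_nbrs_def
    proof (intro conjI ballI)
      have "1 \<le> card ({1..n} - W)" using W unfolding useful_def by linarith
      then show "{1..n} - W \<noteq> {}" by (metis card.empty not_one_le_zero)
    next
      fix v assume v: "v \<in> {1..n} - W"
      have l: "ell1 n p \<delta> W \<le> real (card (W - nbrs X W v))"
        using W v unfolding useful_def non[OF v, symmetric] by blast
      then show "real n powr (1 - \<delta>) * p / (2 * L) \<le> real (card (W - nbrs X W v))"
        using ell1_lower_bound[OF \<delta> large, of W] by linarith
      have "real (card W) - 2 * real n * p \<le> ell1 n p \<delta> W" unfolding ell1_def by simp
      then show "real (card W) - 2 * real n * p \<le> real (card (W - nbrs X W v))" using l by linarith
    qed
    moreover have "\<not> has_hitting_clique X {1..n} W"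
    proof
      assume "has_hitting_clique X {1..n} W"
      then obtain K where K: "K \<subseteq> W" "is_clique X K" "\<forall>v\<in>{1..n} - W. \<exists>u\<in>K. {u, v} \<notin> X"
        unfolding has_hitting_clique_def by blast
      have "\<forall>v\<in>{1..n} - W. non_neighbors_in X K v \<noteq> {}"
      proof
        fix v assume v: "v \<in> {1..n} - W"
        then obtain u where "u \<in> K" "{u, v} \<notin> X" using K(3) by blast
        then have "u \<in> non_neighbors_in X K v" using v K(1) unfolding non_neighbors_in_def by auto
        then show "non_neighbors_in X K v \<noteq> {}" by blast
      qed
      then show False using none K(1,2) by blast
    qed
    ultimately show "X \<in> ?bad" using sub by blast
  qed
  then have "measure_pmf.prob (random_graph n p) (- ?good) \<le> measure_pmf.prob (random_graph n p) ?bad"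
    by (intro measure_pmf.finite_measure_mono) auto
  also have "\<dots> \<le> 4 / real n" by (rule hitting_cliques_exist)
  also have "measure_pmf.prob (random_graph n p) (- ?good) = 1 - measure_pmf.prob (random_graph n p) ?good"
    using measure_pmf.prob_compl[of ?good "random_graph n p"] by (simp add: Compl_eq_Diff_UNIV)
  finally show ?thesis by linarith
qed

end

section \<open>Asymptotics\<close>

text \<open>In the first case, the value is the one of \<open>admissible_dense\<close>, truncated to the required interval;
the truncation is inactive for large \<open>n\<close>.\<close>

definition delta_choice :: "real \<Rightarrow> (nat \<Rightarrow> real) \<Rightarrow> nat \<Rightarrow> real" where
  "delta_choice \<epsilon> p n =
    (let L = ln (real n); y = - ln (p n); \<delta>\<^sub>0 = min \<epsilon> (1 / 200)
     in if y \<le> 6 / 100 * L then min (1 / 2) (max \<delta>\<^sub>0 (1 / 2 - 8 * y / L - 10 * (ln L / L + 1 / y))) else \<delta>\<^sub>0)"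

lemma eventually_ln_nat:
  assumes "eventually P at_top"
  shows "\<forall>\<^sub>F n in sequentially. P (ln (real n))"
proof -
  have "filterlim (\<lambda>n. ln (real n)) at_top sequentially" by real_asymp
  then show ?thesis using assms by (rule eventually_compose_filterlim[rotated])
qed

lemma eventually_log_scale:
  assumes "\<forall>\<^sub>F n in sequentially. 0 < p n"
    and "\<forall>\<^sub>F n in sequentially. 100000 \<le> - ln (p n)"
    and "\<forall>\<^sub>F n in sequentially. - ln (p n) \<le> 2 / 5 * ln (real n)"
  shows "\<forall>\<^sub>F n in sequentially. log_scale n (p n) (ln (real n)) (- ln (p n)) (ln (ln (real n)))"
proof -
  have 1: "eventually (\<lambda>L :: real. 10 \<le> ln L) at_top" by real_asymp
  have 2: "eventually (\<lambda>L :: real. 100000 * ln L \<le> L) at_top" by real_asymp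
  have 3: "eventually (\<lambda>L :: real. 28 * L ^ 3 \<le> exp (L / 10)) at_top" by real_asymp
  have 4: "eventually (\<lambda>L :: real. 600 * L\<^sup>2 \<le> exp (L / 20)) at_top" by real_asymp
  have 5: "eventually (\<lambda>L :: real. 200 * L \<le> exp (6 / 10000 * L)) at_top" by real_asymp
  show ?thesis
    using assms eventually_ge_at_top[of 2] eventually_ln_nat[OF 1] eventually_ln_nat[OF 2]
      eventually_ln_nat[OF 3] eventually_ln_nat[OF 4] eventually_ln_nat[OF 5]
    by eventually_elim (unfold_locales, auto)
qed

lemma ln_over_at_top: "((\<lambda>n. ln (ln (real n)) / ln (real n)) \<longlongrightarrow> 0) sequentially"
  by real_asymp

theorem theorem1p5:
  fixes \<epsilon> :: real and p :: "nat \<Rightarrow> real"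
  assumes "\<epsilon> > 0"
    and "\<And>n. n \<ge> 1 \<Longrightarrow> 0 < p n \<and> p n < 1"
    and "(\<lambda>n. real n powr (- 2 / 5 + \<epsilon>)) \<in> o(p) \<and> p \<in> o(\<lambda>n. real n powr (- 1 / 3))
       \<or> (\<lambda>n. real n powr (- 1 / 3 + \<epsilon>)) \<in> o(p) \<and> p \<in> o(\<lambda>n. 1)"
  shows "\<exists>\<delta> :: nat \<Rightarrow> real.
      (\<forall>n. min \<epsilon> (1 / 200) \<le> \<delta> n \<and> \<delta> n \<le> 1 / 2)
    \<and> (\<forall>n. 0 < \<delta> n \<and> \<delta> n < 1)
    \<and> (\<lambda>n. (ln (real n))\<^sup>2) \<in> o(\<lambda>n. real n powr (1 - \<delta> n) * p n)
    \<and> (\<forall>\<^sub>F n in sequentially. s_param n (p n) (\<delta> n) \<ge> 2)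
    \<and> (\<lambda>n. measure_pmf.prob (random_graph n (p n))
          {E. \<forall>W. useful n (p n) (\<delta> n) E W \<longrightarrow>
                (\<exists>K\<subseteq>W. is_clique E K \<and>
                   (\<forall>v\<in>{1..n} - W. non_neighbors_in E K v \<noteq> {}))}) \<longlonglongrightarrow> 1
    \<and> (subpoly_lower_bound p \<and> p \<in> o(\<lambda>n. 1) \<longrightarrow> \<delta> \<longlonglongrightarrow> 1 / 2)"
proof -
  define \<delta>\<^sub>0 where "\<delta>\<^sub>0 = min \<epsilon> (1 / 200)"
  define L where "L = (\<lambda>n. ln (real n))"
  define y where "y = (\<lambda>n. - ln (p n))"
  define h where "h = (\<lambda>n. 10 * (ln (L n) / L n + 1 / y n))"
  define \<delta> where "\<delta> = delta_choice \<epsilon> p"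
  have \<delta>0: "0 < \<delta>\<^sub>0" "\<delta>\<^sub>0 \<le> \<epsilon>" "\<delta>\<^sub>0 \<le> 1 / 200" unfolding \<delta>\<^sub>0_def using assms(1) by auto
  have \<delta>_eq: "\<delta> n = (if y n \<le> 6 / 100 * L n then min (1 / 2) (max \<delta>\<^sub>0 (1 / 2 - 8 * y n / L n - h n)) else \<delta>\<^sub>0)" for n
    unfolding \<delta>_def delta_choice_def L_def y_def h_def \<delta>\<^sub>0_def by (simp add: Let_def)
  have \<delta>_bounds: "\<delta>\<^sub>0 \<le> \<delta> n" "\<delta> n \<le> 1 / 2" for n
    unfolding \<delta>_eq using \<delta>0 by (auto simp: min_def max_def)
  have \<delta>_pos: "0 < \<delta> n" for n using \<delta>_bounds[of n] \<delta>0 by linarith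
  have ev_p: "\<forall>\<^sub>F n in sequentially. 0 < p n" using eventually_ge_at_top[of 1] by eventually_elim (use assms(2) in auto)
  have ev_n: "\<forall>\<^sub>F n in sequentially. 2 \<le> n" by (rule eventually_ge_at_top)
  have ev_L: "\<forall>\<^sub>F n in sequentially. C \<le> L n" for C
    unfolding L_def by (rule eventually_ln_nat) (rule eventually_ge_at_top)
  have ev_E: "\<forall>\<^sub>F n in sequentially. ln (L n) \<le> C * L n" if "0 < C" for C
  proof -
    have "eventually (\<lambda>L :: real. ln L / L \<le> C) at_top"
    proof -
      have "((\<lambda>L :: real. ln L / L) \<longlongrightarrow> 0) at_top" by real_asymp
      from order_tendstoD(2)[OF this that] show ?thesis by eventually_elim simp
    qed
    from eventually_ln_nat[OF this] ev_L[of 1] show ?thesis unfolding L_def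
      by eventually_elim (simp add: divide_le_eq)
  qed
  have y_ge: "\<forall>\<^sub>F n in sequentially. t * L n + C \<le> y n" if "p \<in> o(\<lambda>n. real n powr (- t))" for t C
  proof -
    have "\<forall>\<^sub>F n in sequentially. norm (p n) \<le> exp (- C) * norm (real n powr (- t))"
      by (rule landau_o.smallD[OF that]) simp
    then show ?thesis using ev_p ev_n
    proof eventually_elim
      case (elim n)
      have "p n \<le> exp (- C) * exp (- (t * L n))" using elim by (simp add: powr_def L_def)
      then have "ln (p n) \<le> ln (exp (- C) * exp (- (t * L n)))" using elim by simp
      then show ?case unfolding y_def by (simp add: ln_mult)
    qed
  qed
  have y_le: "\<forall>\<^sub>F n in sequentially. y n \<le> t * L n" if "(\<lambda>n. real n powr (- t)) \<in> o(p)" for t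
  proof -
    have "\<forall>\<^sub>F n in sequentially. norm (real n powr (- t)) \<le> 1 * norm (p n)"
      by (rule landau_o.smallD[OF that]) simp
    then show ?thesis using ev_p ev_n
    proof eventually_elim
      case (elim n)
      have "exp (- (t * L n)) \<le> p n" using elim by (simp add: powr_def L_def)
      then have "ln (exp (- (t * L n))) \<le> ln (p n)" using elim by (subst ln_le_cancel_iff) auto
      then show ?case unfolding y_def by simp
    qed
  qed
  have y_large: "\<forall>\<^sub>F n in sequentially. C \<le> y n" if "p \<in> o(\<lambda>n. 1)" for C
  proof -
    have "\<forall>\<^sub>F n in sequentially. real n powr (- 0) = 1"
      using ev_n by eventually_elim simp
    then have "o(\<lambda>n. real n powr (- 0)) = o(\<lambda>n. 1 :: real)" by (rule landau_o.small.cong)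
    then have "p \<in> o(\<lambda>n. real n powr (- 0))" using that by simp
    from y_ge[OF this, of C] show ?thesis by simp
  qed
  let ?triangles = "\<lambda>n. L n / 3 + 5 \<le> y n \<and> y n \<le> (2 / 5 - \<epsilon>) * L n"
  let ?larger = "\<lambda>n. y n \<le> (1 / 3 - \<epsilon>) * L n"
  have range: "(\<forall>\<^sub>F n in sequentially. ?triangles n \<or> ?larger n) \<and> (\<forall>\<^sub>F n in sequentially. 100000 \<le> y n)"
    using assms(3)
  proof (elim disjE conjE)
    assume lo: "(\<lambda>n. real n powr (- 2 / 5 + \<epsilon>)) \<in> o(p)" and hi: "p \<in> o(\<lambda>n. real n powr (- 1 / 3))"
    have 1: "\<forall>\<^sub>F n in sequentially. y n \<le> (2 / 5 - \<epsilon>) * L n" using lo by (intro y_le) simp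
    have 2: "\<forall>\<^sub>F n in sequentially. 1 / 3 * L n + 5 \<le> y n" using hi by (intro y_ge) simp
    show ?thesis
    proof
      show "\<forall>\<^sub>F n in sequentially. ?triangles n \<or> ?larger n" using 1 2 by eventually_elim simp
      show "\<forall>\<^sub>F n in sequentially. 100000 \<le> y n" using 2 ev_L[of 300000] by eventually_elim simp
    qed
  next
    assume lo: "(\<lambda>n. real n powr (- 1 / 3 + \<epsilon>)) \<in> o(p)" and hi: "p \<in> o(\<lambda>n. 1)"
    have "\<forall>\<^sub>F n in sequentially. y n \<le> (1 / 3 - \<epsilon>) * L n" using lo by (intro y_le) simp
    then show ?thesis using y_large[OF hi] by (auto elim: eventually_mono)
  qed
  have y_upper: "\<forall>\<^sub>F n in sequentially. y n \<le> 2 / 5 * L n"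
    using conjunct1[OF range] ev_L[of 1]
  proof eventually_elim
    case (elim n)
    have "0 \<le> \<epsilon> * L n" using assms(1) elim by simp
    then show ?case using elim by (auto simp: left_diff_distrib)
  qed
  have scale: "\<forall>\<^sub>F n in sequentially. log_scale n (p n) (L n) (y n) (ln (L n))"
    unfolding L_def y_def
    by (rule eventually_log_scale) (use ev_p range y_upper in \<open>simp_all add: L_def y_def\<close>)
  have ev_small: "\<forall>\<^sub>F n in sequentially. ln (L n) \<le> \<epsilon> / 10 * L n"
    by (rule ev_E) (use assms(1) in simp)
  have adm: "\<forall>\<^sub>F n in sequentially. log_scale.admissible n (p n) (L n) (y n) (\<delta> n)"
    using scale conjunct1[OF range] ev_small ev_L[of 1]
  proof eventually_elim
    case (elim n)
    interpret log_scale n "p n" "L n" "y n" "ln (L n)" by fact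
    have \<epsilon>L: "0 \<le> \<epsilon> * L n" "\<delta>\<^sub>0 * L n \<le> \<epsilon> * L n" using assms(1) \<delta>0 elim by (auto intro!: mult_right_mono)
    have small: "10 * ln (L n) \<le> \<epsilon> * L n" using elim assms(1) by simp
    show ?case
    proof (cases "y n \<le> 6 / 100 * L n")
      case True
      have h: "h n = \<eta>" unfolding h_def \<eta>_def by simp
      have "8 * y n / L n \<le> 48 / 100" using True elim by (simp add: divide_le_eq)
      moreover have "0 \<le> 8 * y n / L n" using y(1) elim by simp
      ultimately have "\<delta> n = 1 / 2 - 8 * y n / L n - \<eta>"
        unfolding \<delta>_eq h using True \<delta>0 \<eta>_facts(2,3) by simp
      then show ?thesis by (rule admissible_dense[OF True])
    next
      case False
      then have d: "\<delta> n = \<delta>\<^sub>0" unfolding \<delta>_eq by simp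
      from elim(2) show ?thesis
      proof
        assume t: "?triangles n"
        have "(2 / 5 - \<epsilon>) * L n = 2 / 5 * L n - \<epsilon> * L n"
          "(2 - 3 * \<delta>\<^sub>0) * L n = 2 * L n - 3 * (\<delta>\<^sub>0 * L n)" by (simp_all add: left_diff_distrib)
        then have "5 * y n + 16 * ln (L n) \<le> (2 - 3 * \<delta>\<^sub>0) * L n" using t \<epsilon>L small by linarith
        then show ?thesis unfolding d using t \<delta>0 by (intro admissible_triangles) auto
      next
        assume t: "?larger n"
        have "(1 / 3 - \<epsilon>) * L n = 1 / 3 * L n - \<epsilon> * L n"
          "(3 - 4 * \<delta>\<^sub>0) * L n = 3 * L n - 4 * (\<delta>\<^sub>0 * L n)" by (simp_all add: left_diff_distrib)
        then have "9 * y n + 20 * ln (L n) \<le> (3 - 4 * \<delta>\<^sub>0) * L n" using t \<epsilon>L small by linarith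
        then show ?thesis unfolding d using False \<delta>0 by (intro admissible_sparse) auto
      qed
    qed
  qed
  have \<delta>_large: "\<forall>\<^sub>F n in sequentially. 4 \<le> \<delta> n * L n"
    using ev_L[of "4 / \<delta>\<^sub>0"] ev_L[of 0]
  proof eventually_elim
    case (elim n)
    have "4 \<le> \<delta>\<^sub>0 * L n" using elim \<delta>0 by (simp add: divide_le_eq mult.commute)
    also have "\<dots> \<le> \<delta> n * L n" using \<delta>_bounds elim by (intro mult_right_mono) auto
    finally show ?case .
  qed
  have claim1: "(\<lambda>n. (ln (real n))\<^sup>2) \<in> o(\<lambda>n. real n powr (1 - \<delta> n) * p n)"
  proof (rule landau_o.smallI)
    fix c :: real assume c: "0 < c"
    show "\<forall>\<^sub>F n in sequentially. norm ((ln (real n))\<^sup>2) \<le> c * norm (real n powr (1 - \<delta> n) * p n)"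
      using scale ev_L[of "1 / c"]
    proof eventually_elim
      case (elim n)
      interpret log_scale n "p n" "L n" "y n" "ln (L n)" by fact
      have "1 \<le> c * L n" using elim c by (simp add: divide_le_eq mult.commute)
      then have "1 * (L n)\<^sup>2 \<le> (c * L n) * (L n)\<^sup>2" by (intro mult_right_mono) auto
      also have "\<dots> = c * L n ^ 3" by (simp add: power3_eq_cube power2_eq_square)
      also have "\<dots> \<le> c * (real n powr (1 - \<delta> n) * p n)"
      proof (intro mult_left_mono)
        have "0 \<le> L n ^ 3" using L_large by simp
        then show "L n ^ 3 \<le> real n powr (1 - \<delta> n) * p n" using poly_gain[OF \<delta>_bounds(2)[of n]] by linarith
      qed (use c in simp)
      finally show ?case using p_bounds by (simp add: L_def abs_mult)
    qed
  qed
  have claim2: "\<forall>\<^sub>F n in sequentially. s_param n (p n) (\<delta> n) \<ge> 2"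
    using scale \<delta>_large
  proof eventually_elim
    case (elim n)
    then show ?case using log_scale.s_param_bounds(1)[OF elim(1) \<delta>_pos \<delta>_bounds(2)] by blast
  qed
  let ?P = "\<lambda>n. measure_pmf.prob (random_graph n (p n))
          {E. \<forall>W. useful n (p n) (\<delta> n) E W \<longrightarrow>
                (\<exists>K\<subseteq>W. is_clique E K \<and>
                   (\<forall>v\<in>{1..n} - W. non_neighbors_in E K v \<noteq> {}))}"
  have "\<forall>\<^sub>F n in sequentially. 1 - 4 / real n \<le> ?P n"
    using scale \<delta>_large adm
  proof eventually_elim
    case (elim n)
    show ?case
      by (rule log_scale.useful_sets_contain_hitting_cliques[OF elim(1) \<delta>_pos \<delta>_bounds(2) elim(2,3)])
  qed
  then have claim3: "?P \<longlonglongrightarrow> 1"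
  proof (rule tendsto_sandwich)
    show "\<forall>\<^sub>F n in sequentially. ?P n \<le> 1" by simp
    show "(\<lambda>n. 1 - 4 / real n) \<longlonglongrightarrow> 1" by real_asymp
  qed simp
  have claim4: "\<delta> \<longlonglongrightarrow> 1 / 2" if sub: "subpoly_lower_bound p" and po: "p \<in> o(\<lambda>n. 1)"
  proof -
    obtain \<gamma> where \<gamma>: "\<gamma> \<longlonglongrightarrow> 0" "\<forall>\<^sub>F n in sequentially. p n \<ge> real n powr (- \<gamma> n)"
      using sub unfolding subpoly_lower_bound_def by blast
    have y_gamma: "\<forall>\<^sub>F n in sequentially. y n / L n \<le> \<gamma> n"
      using \<gamma>(2) ev_p ev_n ev_L[of 1]
    proof eventually_elim
      case (elim n)
      have "exp (- (\<gamma> n * L n)) \<le> p n" using elim by (simp add: powr_def L_def)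
      then have "ln (exp (- (\<gamma> n * L n))) \<le> ln (p n)" using elim by (subst ln_le_cancel_iff) auto
      then have "y n \<le> \<gamma> n * L n" unfolding y_def by simp
      then show ?case using elim by (simp add: divide_le_eq)
    qed
    have yL: "(\<lambda>n. y n / L n) \<longlonglongrightarrow> 0"
    proof (rule tendsto_sandwich[OF _ y_gamma _ \<gamma>(1)])
      show "\<forall>\<^sub>F n in sequentially. 0 \<le> y n / L n"
        using y_large[OF po, of 0] ev_L[of 0] by eventually_elim simp
    qed simp
    have "filterlim y at_top sequentially"
      unfolding filterlim_at_top using y_large[OF po] by blast
    then have "(\<lambda>n. 1 / y n) \<longlonglongrightarrow> 0"
      by (intro tendsto_divide_0[OF tendsto_const] filterlim_at_top_imp_at_infinity)
    then have "h \<longlonglongrightarrow> 10 * (0 + 0)"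
      unfolding h_def using ln_over_at_top unfolding L_def by (intro tendsto_intros)
    then have lim: "(\<lambda>n. 1 / 2 - 8 * (y n / L n) - h n) \<longlonglongrightarrow> 1 / 2 - 8 * 0 - 10 * (0 + 0)"
      using yL by (intro tendsto_intros)
    have "\<forall>\<^sub>F n in sequentially. y n / L n < 6 / 100" by (rule order_tendstoD(2)[OF yL]) simp
    then have lower: "\<forall>\<^sub>F n in sequentially. 1 / 2 - 8 * (y n / L n) - h n \<le> \<delta> n"
      using ev_L[of 1] scale
    proof eventually_elim
      case (elim n)
      interpret log_scale n "p n" "L n" "y n" "ln (L n)" by fact
      have "y n \<le> 6 / 100 * L n" using elim by (simp add: divide_less_eq)
      moreover have "0 \<le> h n" using \<eta>_facts(2) unfolding h_def \<eta>_def by simp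
      moreover have "0 \<le> 8 * y n / L n" using y(1) elim by simp
      ultimately show ?case unfolding \<delta>_eq by simp
    qed
    show ?thesis
      by (rule tendsto_sandwich[OF lower _ _ tendsto_const]) (use lim \<delta>_bounds in auto)
  qed
  show ?thesis
  proof (intro exI[of _ \<delta>] conjI allI impI)
    fix n
    show "min \<epsilon> (1 / 200) \<le> \<delta> n" using \<delta>_bounds(1) unfolding \<delta>\<^sub>0_def .
    show "\<delta> n \<le> 1 / 2" "0 < \<delta> n" by (rule \<delta>_bounds \<delta>_pos)+
    show "\<delta> n < 1" using \<delta>_bounds(2)[of n] by simp
  next
    assume "subpoly_lower_bound p \<and> p \<in> o(\<lambda>n. 1)"
    then show "\<delta> \<longlonglongrightarrow> 1 / 2" using claim4 by blast
  qed (fact claim1 claim2 claim3)+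
qed

end
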